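(* Let $(W,S)$ be a Coxeter system and let $\mathcal{SC}=\mathcal{SC}(W,S)$ be its singular Coxeter monoid (a category). The category $\mathcal{SC}$ has the following presentation by generators and relations. Objects: the finitary subsets of $S$. Generating morphisms: for each finitary $I\subset S$ and $s\in S\setminus I$ with $Is$ finitary, a morphism $I\to Is$ (the $(Is,I)$-coset containing $e$) and a morphism $Is\to I$ (the $(I,Is)$-coset containing $e$), so that an expression $[I_0,\dots,I_d]$ denotes the composition $I_d\to\cdots\to I_1\to I_0$ of generators. Relations: (1) (up-up) $[J+s+t]= [J+t+s]$ for $s\neq t$ in $S\setminus J$ with $J\cup\{s,t\}$ finitary; (2) (down-down) $[J-s-t]= [J-t-s]$ for $J$ finitary and $s\neq t$ in $J$; (3) (switchback) $[J+s-t]= [J-u_1+s-u_2+u_1-u_3+u_2-\cdots -u_\delta+u_{\delta-1}]$ for all $s\notin J$ with $Js$ finitary and all $t\in Js$ with $s\neq w_{Js}tw_{Js}$, where $(u_i)$ is the rotation sequence of $(J,s,t)$ and $\delta$ is the associated integer (here $u_0=s$ and $u_\delta=t$); (4) ($*$-quadratic) $[J-s+s]= [J]$ for $J$ finitary and $s\in J$. That is, two expressions (sequences of generators) compose to the same morphism of $\mathcal{SC}$ if and only if they are related by finitely many applications of these relations to contiguous subwords, and every morphism of $\mathcal{SC}$ is a composition of generators.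
   Context: Let $(W,S)$ be a Coxeter system with identity $e$ and Bruhat order $\le$. For $I\subset S$ let $W_I$ be the parabolic subgroup generated by $I$; $I$ is finitary if $W_I$ is finite, and then $w_I$ is the longest element of $W_I$. Write $Is=I\sqcup\{s\}$. For finitary $I,J$, a $(J,I)$-coset is a double coset $p\in W_J\backslash W/W_I$ (the pair $(J,I)$ is part of the data); it has a unique Bruhat-maximal element $\overline{p}$ and a unique Bruhat-minimal element $\underline{p}$. The $*$-product on $W$ is the associative product with $x*s=xs$ if $xs>x$ and $x*s=x$ if $xs<x$ ($s\in S$). Singular Coxeter monoid: $\mathcal{SC}$ is the category whose objects are finitary subsets of $S$, with $\mathrm{Hom}(I,J)=W_J\backslash W/W_I$, the composition of a $(K,J)$-coset $p$ with a $(J,I)$-coset $q$ being $p*q:=W_K(\overline p*\overline q)W_I$; the identity of $I$ is the $(I,I)$-coset containing $e$. Expressions: an expression is a sequence $[I_0,\dots,I_d]$ of finitary subsets, consecutive ones differing by adding or removing exactly one element of $S$. Notation such as $[J+s-t]$ means $[J,\,J\sqcup\{s\},\,(J\sqcup\{s\})\setminus\{t\}]$, and similarly for longer strings of $+$'s and $-$'s. The forward path of $[I_0,\dots,I_d]$ is the sequence $p_0,\dots,p_d$ where $p_i$ is an $(I_0,I_i)$-coset, $e\in p_0$; if $I_i\subset I_{i+1}$, $p_{i+1}$ is the $(I_0,I_{i+1})$-coset containing $p_i$; if $I_i\supset I_{i+1}$, $p_{i+1}$ is the $(I_0,I_{i+1})$-coset containing $\overline{p_i}$. The left redundancy of an $(I_0,I_i)$-coset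 $p_i$ is $K_i=I_0\cap\underline{p_i}I_i\underline{p_i}^{-1}$. The expression is reduced if for every $i$ with $I_i\subset I_{i+1}$ one has $\underline{p_i}=\underline{p_{i+1}}$ and $K_i=K_{i+1}$. Rotation sequence: given $s\notin J$ with $Js$ finitary and $t\in Js$ with $s\ne w_{Js}tw_{Js}$, put $u_0=s$, $u_{-1}=w_{Js}tw_{Js}$, $I_i=Js\setminus\{u_i\}$, and $u_{i+1}=w_{I_i}u_{i-1}w_{I_i}$ for all $i\in\mathbb Z$; all $u_i$ lie in $Js$. Put $L_i=Js\setminus\{u_i,u_{i-1}\}$. The integer $\delta$ is the largest integer such that $[I_0,L_1,I_1,\dots,L_k,I_k]$ is reduced for all $1\le k\le\delta$ (such $\delta\geq 1$ exists and $u_\delta=t$). *)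

theory Defs
  imports "HOL-Algebra.Generated_Groups" "HOL-Algebra.Multiplicative_Group"
begin

section \<open>Coxeter systems\<close>

context group
begin

definition word_prod :: "'a list \<Rightarrow> 'a" where
  "word_prod ws = foldr (\<otimes>) ws \<one>"

text \<open>
  Deletion of one relator \<open>(st)^m(s,t)\<close>, where \<open>m(s,t)\<close> is the order of \<open>st\<close>. If that order is
  infinite then \<open>ord\<close> is 0 and the relator is the empty word. For \<open>s = t\<close> the relator is \<open>ss\<close>; since
  it makes every generator its own inverse, words without formal inverses suffice to present
  the group.
\<close>
definition coxeter_reduction :: "'a set \<Rightarrow> 'a list \<Rightarrow> 'a list \<Rightarrow> bool" where
  "coxeter_reduction S v w \<longleftrightarrow>
     (\<exists>a \<in> lists S. \<exists>b \<in> lists S. \<exists>s \<in> S. \<exists>t \<in> S.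
        v = a @ concat (replicate (ord (s \<otimes> t)) [s, t]) @ b \<and> w = a @ b)"

end

text \<open>The generating set may be infinite.\<close>
locale coxeter_system = group W for W (structure) +
  fixes S :: "'a set"
  assumes generators_closed: "S \<subseteq> carrier W"
    and generators_involutive: "\<And>s. s \<in> S \<Longrightarrow> s \<noteq> \<one> \<and> s \<otimes> s = \<one>"
    and generators_generate: "generate W S = carrier W"
    and presentation: "\<And>v w. v \<in> lists S \<Longrightarrow> w \<in> lists S \<Longrightarrow>
          word_prod v = word_prod w \<longleftrightarrow> equivclp (coxeter_reduction S) v w"
begin

definition len :: "'a \<Rightarrow> nat" where
  "len w = (LEAST n. \<exists>ws \<in> lists S. length ws = n \<and> word_prod ws = w)"

definition reflections :: "'a set" where
  "reflections = {w \<otimes> s \<otimes> inv w | w s. w \<in> carrier W \<and> s \<in> S}"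

definition bruhat_step :: "'a \<Rightarrow> 'a \<Rightarrow> bool" where
  "bruhat_step x y \<longleftrightarrow>
     x \<in> carrier W \<and> (\<exists>r \<in> reflections. y = x \<otimes> r \<and> len x < len y)"

definition bruhat_le :: "'a \<Rightarrow> 'a \<Rightarrow> bool" where
  "bruhat_le = bruhat_step\<^sup>*\<^sup>*"

definition bruhat_less :: "'a \<Rightarrow> 'a \<Rightarrow> bool" where
  "bruhat_less x y \<longleftrightarrow> bruhat_le x y \<and> x \<noteq> y"

text \<open>
  The conditions determine the product on the carrier. The unit law contained in \<open>monoid\<close> is
  needed for this: for a one-element \<open>S\<close> the remaining ones do not fix the value at \<open>(\<one>, \<one>)\<close>.
\<close>
definition star :: "'a \<Rightarrow> 'a \<Rightarrow> 'a" where
  "star = (SOME m. monoid \<lparr>carrier = carrier W, monoid.mult = m, one = \<one>\<rparr> \<and>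
     (\<forall>x \<in> carrier W. \<forall>s \<in> S.
        (bruhat_less x (x \<otimes> s) \<longrightarrow> m x s = x \<otimes> s) \<and>
        (bruhat_less (x \<otimes> s) x \<longrightarrow> m x s = x)))"


section \<open>Parabolic subgroups and double cosets\<close>

definition finitary :: "'a set \<Rightarrow> bool" where
  "finitary I \<longleftrightarrow> I \<subseteq> S \<and> finite (generate W I)"

definition longest :: "'a set \<Rightarrow> 'a" where
  "longest I = (THE w. w \<in> generate W I \<and> (\<forall>v \<in> generate W I. len v \<le> len w))"

text \<open>
  \<open>W\<^sub>J X W\<^sub>I\<close>: if the set \<open>X\<close> is contained in a single double coset, this is the
  \<open>(J, I)\<close>-coset containing \<open>X\<close>.
\<close>
definition double_coset :: "'a set \<Rightarrow> 'a set \<Rightarrow> 'a set \<Rightarrow> 'a set" where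
  "double_coset J X I = generate W J <#> X <#> generate W I"

definition double_cosets :: "'a set \<Rightarrow> 'a set \<Rightarrow> 'a set set" where
  "double_cosets J I = {double_coset J {w} I | w. w \<in> carrier W}"

definition max_elt :: "'a set \<Rightarrow> 'a" where
  "max_elt p = (THE x. x \<in> p \<and> \<not> (\<exists>y \<in> p. bruhat_less x y))"

definition min_elt :: "'a set \<Rightarrow> 'a" where
  "min_elt p = (THE x. x \<in> p \<and> \<not> (\<exists>y \<in> p. bruhat_less y x))"


section \<open>Expressions, forward paths, reducedness\<close>

definition adjacent :: "'a set \<Rightarrow> 'a set \<Rightarrow> bool" where
  "adjacent I J \<longleftrightarrow>
     (\<exists>s \<in> S. (s \<notin> I \<and> J = insert s I) \<or> (s \<in> I \<and> J = I - {s}))"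

definition expression :: "'a set list \<Rightarrow> bool" where
  "expression Is \<longleftrightarrow> Is \<noteq> [] \<and> (\<forall>I \<in> set Is. finitary I) \<and> successively adjacent Is"

fun forward_path :: "'a set list \<Rightarrow> nat \<Rightarrow> 'a set" where
  "forward_path Is 0 = double_coset (Is ! 0) {\<one>} (Is ! 0)"
| "forward_path Is (Suc i) =
     (if Is ! i \<subset> Is ! Suc i
      then double_coset (Is ! 0) (forward_path Is i) (Is ! Suc i)
      else double_coset (Is ! 0) {max_elt (forward_path Is i)} (Is ! Suc i))"

definition left_redundancy :: "'a set \<Rightarrow> 'a set \<Rightarrow> 'a set \<Rightarrow> 'a set" where
  "left_redundancy J p I = J \<inter> {min_elt p \<otimes> x \<otimes> inv (min_elt p) | x. x \<in> I}"

definition reduced :: "'a set list \<Rightarrow> bool" where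
  "reduced Is \<longleftrightarrow> expression Is \<and>
     (\<forall>i. Suc i < length Is \<and> Is ! i \<subset> Is ! Suc i \<longrightarrow>
        min_elt (forward_path Is i) = min_elt (forward_path Is (Suc i)) \<and>
        left_redundancy (Is ! 0) (forward_path Is i) (Is ! i) =
        left_redundancy (Is ! 0) (forward_path Is (Suc i)) (Is ! Suc i))"


section \<open>Rotation sequences\<close>

definition rotation_sequence :: "'a set \<Rightarrow> 'a \<Rightarrow> 'a \<Rightarrow> (int \<Rightarrow> 'a) \<Rightarrow> bool" where
  "rotation_sequence J s t u \<longleftrightarrow>
     u 0 = s \<and>
     u (-1) = longest (insert s J) \<otimes> t \<otimes> longest (insert s J) \<and>
     (\<forall>i. u (i + 1) = longest (insert s J - {u i}) \<otimes> u (i - 1) \<otimes> longest (insert s J - {u i}))"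

text \<open>The expression \<open>[I\<^sub>0, L\<^sub>1, I\<^sub>1, \<dots>, L\<^sub>k, I\<^sub>k]\<close>, with \<open>M\<close> the set \<open>Js\<close>.\<close>
definition rotation_expression :: "'a set \<Rightarrow> (int \<Rightarrow> 'a) \<Rightarrow> nat \<Rightarrow> 'a set list" where
  "rotation_expression M u k =
     (M - {u 0}) # concat (map (\<lambda>i. [M - {u i, u (i - 1)}, M - {u i}]) [1..int k])"

definition rotation_length :: "'a set \<Rightarrow> (int \<Rightarrow> 'a) \<Rightarrow> nat" where
  "rotation_length M u =
     (GREATEST d. \<forall>k. 1 \<le> k \<and> k \<le> d \<longrightarrow> reduced (rotation_expression M u k))"

end


section \<open>The singular Coxeter monoid\<close>

text \<open>
  A morphism \<open>I \<rightarrow> J\<close> is a triple \<open>(J, p, I)\<close> with \<open>p\<close> a \<open>(J, I)\<close>-coset, since different pairs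
  \<open>(J, I)\<close> may share the same underlying set \<open>p\<close>.
\<close>
type_synonym 'a sc_morphism = "'a set \<times> 'a set \<times> 'a set"

context coxeter_system
begin

definition sc_hom :: "'a set \<Rightarrow> 'a set \<Rightarrow> 'a sc_morphism set" where
  "sc_hom I J = {(J, p, I) | p. p \<in> double_cosets J I}"

text \<open>\<open>sc_comp f g\<close> is meaningful only if the source of \<open>f\<close> is the target of \<open>g\<close>.\<close>
fun sc_comp :: "'a sc_morphism \<Rightarrow> 'a sc_morphism \<Rightarrow> 'a sc_morphism" where
  "sc_comp (K, p, J) (J', q, I) =
     (K, double_coset K {star (max_elt p) (max_elt q)} I, I)"

definition sc_id :: "'a set \<Rightarrow> 'a sc_morphism" where
  "sc_id I = (I, double_coset I {\<one>} I, I)"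

definition sc_gen :: "'a set \<Rightarrow> 'a set \<Rightarrow> 'a sc_morphism" where
  "sc_gen I J = (I, double_coset I {\<one>} J, J)"

text \<open>The composition \<open>I\<^sub>d \<rightarrow> \<dots> \<rightarrow> I\<^sub>1 \<rightarrow> I\<^sub>0\<close> denoted by \<open>[I\<^sub>0, \<dots>, I\<^sub>d]\<close>.\<close>
fun sc_eval :: "'a set list \<Rightarrow> 'a sc_morphism" where
  "sc_eval [] = undefined"
| "sc_eval [I] = sc_id I"
| "sc_eval (I # J # Is) = sc_comp (sc_gen I J) (sc_eval (J # Is))"

end


section \<open>The relations\<close>

datatype 'a sign = Plus 'a | Minus 'a

text \<open>\<open>path J [Plus s, Minus t]\<close> is the sequence written \<open>[J+s-t]\<close>.\<close>
fun path :: "'a set \<Rightarrow> 'a sign list \<Rightarrow> 'a set list" where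
  "path J [] = [J]"
| "path J (Plus s # xs) = J # path (insert s J) xs"
| "path J (Minus s # xs) = J # path (J - {s}) xs"

context coxeter_system
begin

inductive sc_relation :: "'a set list \<Rightarrow> 'a set list \<Rightarrow> bool" where
  up_up: "s \<in> S - J \<Longrightarrow> t \<in> S - J \<Longrightarrow> s \<noteq> t \<Longrightarrow> finitary (J \<union> {s, t}) \<Longrightarrow>
     sc_relation (path J [Plus s, Plus t]) (path J [Plus t, Plus s])"
| down_down: "finitary J \<Longrightarrow> s \<in> J \<Longrightarrow> t \<in> J \<Longrightarrow> s \<noteq> t \<Longrightarrow>
     sc_relation (path J [Minus s, Minus t]) (path J [Minus t, Minus s])"
| switchback: "s \<notin> J \<Longrightarrow> finitary (insert s J) \<Longrightarrow> t \<in> insert s J \<Longrightarrow>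
     s \<noteq> longest (insert s J) \<otimes> t \<otimes> longest (insert s J) \<Longrightarrow>
     rotation_sequence J s t u \<Longrightarrow> \<delta> = rotation_length (insert s J) u \<Longrightarrow>
     sc_relation (path J [Plus s, Minus t])
       (path J (concat (map (\<lambda>i. [Minus (u i), Plus (u (i - 1))]) [1..int \<delta>])))"
| star_quadratic: "finitary J \<Longrightarrow> s \<in> J \<Longrightarrow>
     sc_relation (path J [Minus s, Plus s]) (path J [])"

text \<open>
  Both sides of a relation are sequences of objects with the same first and last entries, so a
  contiguous subword is replaced together with its end objects.
\<close>
definition sc_rewrite :: "'a set list \<Rightarrow> 'a set list \<Rightarrow> bool" where
  "sc_rewrite Is Js \<longleftrightarrow> expression Is \<and> expression Js \<and>
     (\<exists>a x y b. sc_relation x y \<and> Is = a @ x @ b \<and> Js = a @ y @ b)"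

definition sc_equiv :: "'a set list \<Rightarrow> 'a set list \<Rightarrow> bool" where
  "sc_equiv = equivclp sc_rewrite"

end

end

theory Submission
  imports Defs
begin

text \<open>
  Everything is transported to the star product. Since every step of an expression multiplies the
  maximal element by a longest element, \<open>[I(0), \<dots>, I(d)]\<close> denotes the coset whose maximal element is
  \<open>w(I(0)) * \<dots> * w(I(d))\<close> (\<open>sc_eval_star_prod\<close>). Hence two expressions are equal in \<open>\<S>\<C>\<close> if and only if
  they have the same end objects and the same star product of longest elements (\<open>sc_eval_eq_iff\<close>).
  The theory of Coxeter systems that is needed for this is derived from the exchange condition,
  which follows from the presentation of \<open>W\<close> by counting reflections modulo 2.

  That the relations hold is immediate in this form, except for the switchback relation. Write
  \<open>M = Js\<close> and \<open>a(k) = w(I(0)) * \<dots> * w(I(k))\<close>. The invariant is that conjugation by \<open>a(k)\<close> maps \<open>L(k+1)\<close>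
  to \<open>L(0)\<close>. If it holds and \<open>a(k) \<noteq> w\<^sub>M\<close>, then \<open>d(k) = a(k) w(L(k+1))\<close> is shortest in \<open>d(k) W(I(k+1))\<close>, so
  that \<open>a(k+1) = d(k) w(I(k+1))\<close> with lengths adding up, and the invariant passes on to \<open>k + 1\<close>. Let \<open>N\<close>
  be the first index with \<open>a(N) = w\<^sub>M\<close>. The same description of \<open>a(k)\<close> shows that the rotation
  expression is reduced up to \<open>N\<close> and fails to be reduced at \<open>N + 1\<close>; so \<open>N\<close> is the number \<open>\<delta>\<close>
  (\<open>rotation_length_N\<close>). Comparing descents of the two sides of \<open>d(N-1) = w\<^sub>M w(I(N))\<close> gives \<open>u(\<delta>) = t\<close>
  (\<open>u_N\<close>).

  For the converse, that the relations suffice, note that going from \<open>I\<close> down to \<open>\<emptyset>\<close> and up again is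
  equivalent to \<open>[I]\<close> by the quadratic relation. Composing with such paths at both ends reduces the
  claim to expressions from \<open>\<emptyset>\<close> to \<open>\<emptyset>\<close>, and inserting them at each step cuts such an expression into
  loops \<open>[\<emptyset> \<up> I \<down> \<emptyset>]\<close> (\<open>cut_into_loops\<close>). If \<open>I\<close> has at least two elements, a switchback at the top of
  the loop replaces it by an expression through smaller sets, so by induction on the size every
  expression from \<open>\<emptyset>\<close> to \<open>\<emptyset>\<close> is equivalent to the expression \<open>[\<emptyset>, {s\<^sub>1}, \<emptyset>, {s\<^sub>2}, \<dots>, \<emptyset>]\<close> of a word
  (\<open>loop_wordlike\<close>). For two-element sets the same computation yields the braid relations: going
  around \<open>{s, t}\<close>, the switchback relation produces a reduced word for the longest element, and
  there is one that begins with \<open>s\<close> and one that begins with \<open>t\<close> (\<open>dihedral_word\<close>). The argument of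
  Matsumoto then makes all reduced words of an element equivalent (\<open>eqv_reduced_words\<close>), and with
  the quadratic relation two words with the same star product are equivalent (\<open>eqv_words\<close>).
\<close>

section \<open>Words\<close>

context group
begin

lemma word_prod_simps [simp]:
  "word_prod [] = \<one>" "word_prod (s # ws) = s \<otimes> word_prod ws"
  by (simp_all add: word_prod_def)

lemma word_prod_closed [simp, intro]: "set ws \<subseteq> carrier G \<Longrightarrow> word_prod ws \<in> carrier G"
  by (induction ws) auto

lemma word_prod_append:
  "set v \<subseteq> carrier G \<Longrightarrow> set w \<subseteq> carrier G \<Longrightarrow> word_prod (v @ w) = word_prod v \<otimes> word_prod w"
  by (induction v) (auto simp: m_assoc)

lemma cancel_left_inv [simp]:
  "x \<in> carrier G \<Longrightarrow> y \<in> carrier G \<Longrightarrow> inv x \<otimes> (x \<otimes> y) = y"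
  "x \<in> carrier G \<Longrightarrow> y \<in> carrier G \<Longrightarrow> x \<otimes> (inv x \<otimes> y) = y"
  by (simp_all flip: m_assoc)

end

context coxeter_system
begin

lemma S_carrier [simp]: "s \<in> S \<Longrightarrow> s \<in> carrier W"
  using generators_closed by auto

lemma S_square [simp]: "s \<in> S \<Longrightarrow> s \<otimes> s = \<one>"
  using generators_involutive by auto

lemma S_inv [simp]: "s \<in> S \<Longrightarrow> inv s = s"
  by (simp add: inv_equality)

lemma S_cancel [simp]: "s \<in> S \<Longrightarrow> x \<in> carrier W \<Longrightarrow> s \<otimes> (s \<otimes> x) = x"
  by (simp flip: m_assoc)

lemma S_cancel_right: "s \<in> S \<Longrightarrow> x \<in> carrier W \<Longrightarrow> x \<otimes> s \<otimes> s = x"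
  by (simp add: m_assoc)

lemma word_prod_S [simp]: "set ws \<subseteq> S \<Longrightarrow> word_prod ws \<in> carrier W"
  using generators_closed by auto

lemma word_prod_append_S:
  "set v \<subseteq> S \<Longrightarrow> set w \<subseteq> S \<Longrightarrow> word_prod (v @ w) = word_prod v \<otimes> word_prod w"
  using generators_closed by (intro word_prod_append) auto

lemma word_prod_rev: "set ws \<subseteq> S \<Longrightarrow> word_prod (rev ws) = inv (word_prod ws)"
  by (induction ws) (auto simp: word_prod_append_S inv_mult_group)

lemma generate_words:
  assumes "J \<subseteq> S"
  shows "generate W J = word_prod ` lists J"
proof (intro equalityI subsetI)
  fix x assume "x \<in> generate W J"
  then show "x \<in> word_prod ` lists J"
  proof (induction rule: generate.induct)
    case one
    show ?case by (rule image_eqI[of _ _ "[]"]) auto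
  next
    case (incl h)
    then show ?case using assms by (intro image_eqI[of _ _ "[h]"]) auto
  next
    case (inv h)
    then show ?case using assms by (intro image_eqI[of _ _ "[h]"]) auto
  next
    case (eng h1 h2)
    then obtain v w where "v \<in> lists J" "w \<in> lists J" "h1 = word_prod v" "h2 = word_prod w"
      by auto
    then show ?case using assms
      by (intro image_eqI[of _ _ "v @ w"]) (auto simp: word_prod_append_S subset_iff)
  qed
next
  fix x assume "x \<in> word_prod ` lists J"
  then obtain w where "w \<in> lists J" "x = word_prod w" by blast
  moreover have "w \<in> lists J \<Longrightarrow> word_prod w \<in> generate W J" for w
    by (induction w) (auto intro: generate.intros)
  ultimately show "x \<in> generate W J" by simp
qed

lemma carrier_words: "x \<in> carrier W \<Longrightarrow> \<exists>ws. set ws \<subseteq> S \<and> word_prod ws = x"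
  using generate_words[of S] generators_generate by auto

section \<open>Length and the exchange condition\<close>

lemma len_le: "set ws \<subseteq> S \<Longrightarrow> len (word_prod ws) \<le> length ws"
  unfolding len_def by (rule Least_le) auto

lemma reduced_word_exists:
  assumes "x \<in> carrier W"
  shows "\<exists>ws. set ws \<subseteq> S \<and> word_prod ws = x \<and> length ws = len x"
proof -
  have "\<exists>n. \<exists>ws \<in> lists S. length ws = n \<and> word_prod ws = x"
    using carrier_words[OF assms] by auto
  then have "\<exists>ws \<in> lists S. length ws = len x \<and> word_prod ws = x"
    unfolding len_def by (rule LeastI_ex)
  then show ?thesis by auto
qed

lemma len_one [simp]: "len \<one> = 0"
  using len_le[of "[]"] by simp

lemma len_mult: "x \<in> carrier W \<Longrightarrow> y \<in> carrier W \<Longrightarrow> len (x \<otimes> y) \<le> len x + len y"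
proof -
  assume "x \<in> carrier W" "y \<in> carrier W"
  then obtain v w where "set v \<subseteq> S" "word_prod v = x" "length v = len x"
     "set w \<subseteq> S" "word_prod w = y" "length w = len y"
    using reduced_word_exists by metis
  then show ?thesis using len_le[of "v @ w"] by (simp add: word_prod_append_S)
qed

lemma len_inv [simp]: assumes "x \<in> carrier W" shows "len (inv x) = len x"
proof -
  have *: "len (inv x) \<le> len x" if "x \<in> carrier W" for x
  proof -
    obtain v where "set v \<subseteq> S" "word_prod v = x" "length v = len x"
      using reduced_word_exists \<open>x \<in> carrier W\<close> by metis
    then show ?thesis using len_le[of "rev v"] by (simp add: word_prod_rev)
  qed
  from *[OF assms] *[of "inv x"] assms show ?thesis by simp
qed

lemma len_0: "x \<in> carrier W \<Longrightarrow> len x = 0 \<Longrightarrow> x = \<one>"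
  using reduced_word_exists by fastforce

lemma len_S [simp]: "s \<in> S \<Longrightarrow> len s = 1"
  using len_le[of "[s]"] len_0[of s] generators_involutive[of s] by fastforce

lemma len_mult_S_le:
  assumes "s \<in> S" "x \<in> carrier W"
  shows "len (s \<otimes> x) \<le> Suc (len x)" "len x \<le> Suc (len (s \<otimes> x))"
  using len_mult[of s x] len_mult[of s "s \<otimes> x"] assms by auto

text \<open>
  A word \<open>s\<^sub>1 \<dots> s\<^sub>n\<close> has \<open>n\<close> associated reflections \<open>s\<^sub>1 \<dots> s\<^sub>i \<dots> s\<^sub>1\<close>. This is the parity of the number of
  times that \<open>r\<close> occurs among them. It is defined on words but depends only on the group element,
  and this is where the presentation of \<open>W\<close> enters.
\<close>
fun inversion_parity :: "'a list \<Rightarrow> 'a \<Rightarrow> bool" where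
  "inversion_parity [] r = False"
| "inversion_parity (s # ws) r = ((r = s) \<noteq> inversion_parity ws (s \<otimes> r \<otimes> s))"

lemma inversion_parity_append:
  "set v \<subseteq> S \<Longrightarrow> r \<in> carrier W \<Longrightarrow>
    inversion_parity (v @ w) r = (inversion_parity v r \<noteq> inversion_parity w (inv (word_prod v) \<otimes> r \<otimes> word_prod v))"
proof (induction v arbitrary: r)
  case (Cons s v)
  then have "inv (word_prod v) \<otimes> (s \<otimes> r \<otimes> s) \<otimes> word_prod v =
     inv (word_prod (s # v)) \<otimes> r \<otimes> word_prod (s # v)"
    by (simp add: inv_mult_group m_assoc)
  with Cons show ?case by auto
qed simp

text \<open>
  The reflections of the dihedral word \<open>stst\<dots>\<close> are the elements \<open>(st)\<^sup>i s\<close>: since \<open>s\<close> inverts \<open>st\<close>,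
  conjugation by a power of \<open>st\<close> doubles the exponent.
\<close>
lemma dihedral_conj:
  assumes "s \<in> S" "t \<in> S"
  shows "(s \<otimes> t) [^] (j::nat) \<otimes> s \<otimes> inv ((s \<otimes> t) [^] j) = (s \<otimes> t) [^] (j + j) \<otimes> s"
proof -
  define c where "c = s \<otimes> t"
  have c: "c \<in> carrier W" using assms by (simp add: c_def)
  have "s \<otimes> inv (c [^] j) = c [^] j \<otimes> s" for j :: nat
  proof (induction j)
    case 0 then show ?case using assms by simp
  next
    case (Suc j)
    have 1: "s \<otimes> inv c = c \<otimes> s" using assms by (simp add: c_def inv_mult_group m_assoc)
    have "s \<otimes> inv (c [^] Suc j) = s \<otimes> inv c \<otimes> inv (c [^] j)"
      using c assms by (simp add: inv_mult_group m_assoc)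
    also have "\<dots> = c \<otimes> (c [^] j \<otimes> s)"
      using Suc c assms by (simp add: 1 m_assoc)
    also have "\<dots> = c [^] Suc j \<otimes> s"
      using c assms nat_pow_Suc2[of c j] by (simp add: m_assoc del: nat_pow_Suc)
    finally show ?case .
  qed
  then show ?thesis using c assms
    unfolding c_def[symmetric] by (simp add: m_assoc flip: nat_pow_mult)
qed

lemma word_prod_alternating:
  "s \<in> S \<Longrightarrow> t \<in> S \<Longrightarrow> word_prod (concat (replicate k [s, t])) = (s \<otimes> t) [^] k"
proof (induction k)
  case (Suc k)
  then show ?case using nat_pow_Suc2[of "s \<otimes> t" k] by (simp add: m_assoc del: nat_pow_Suc)
qed simp

lemma conj_eq_iff:
  assumes "x \<in> carrier W" "r \<in> carrier W" "y \<in> carrier W"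
  shows "inv x \<otimes> r \<otimes> x = y \<longleftrightarrow> r = x \<otimes> y \<otimes> inv x"
  using assms by (auto simp: m_assoc)

lemma inversion_parity_alternating:
  assumes st: "s \<in> S" "t \<in> S" and r: "r \<in> carrier W"
  shows "inversion_parity (concat (replicate k [s, t])) r = odd (card {i. i < 2 * k \<and> r = (s \<otimes> t) [^] i \<otimes> s})"
proof -
  \<comment> \<open>Appending one more \<open>st\<close> to the \<open>k\<close> copies adds the reflections with exponents \<open>2k\<close> and \<open>2k + 1\<close>.\<close>
  let ?f = "\<lambda>i::nat. if r = (s \<otimes> t) [^] i \<otimes> s then 1 else (0::nat)"
  define c where "c = s \<otimes> t"
  have c: "c \<in> carrier W" using st by (simp add: c_def)
  have "inversion_parity (concat (replicate k [s, t])) r = odd (\<Sum>i<2*k. ?f i)"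
  proof (induction k)
    case 0 then show ?case by simp
  next
    case (Suc k)
    define q where "q = inv (c [^] k) \<otimes> r \<otimes> c [^] k"
    have q: "q \<in> carrier W" using c r by (simp add: q_def)
    have "(q = s) = (r = c [^] k \<otimes> s \<otimes> inv (c [^] k))"
      unfolding q_def using c r st by (intro conj_eq_iff) auto
    also have "\<dots> = (r = c [^] (2 * k) \<otimes> s)"
      using dihedral_conj[OF st, of k] by (simp add: c_def mult_2)
    finally have 1: "(q = s) = (r = c [^] (2 * k) \<otimes> s)" .
    have "(s \<otimes> q \<otimes> s = t) = (inv s \<otimes> q \<otimes> s = t)" using st by simp
    also have "\<dots> = (q = c \<otimes> s)"
      using st q by (subst conj_eq_iff) (auto simp: c_def)
    also have "\<dots> = (r = c [^] k \<otimes> (c \<otimes> s) \<otimes> inv (c [^] k))"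
      unfolding q_def using c r st by (intro conj_eq_iff) auto
    also have "c [^] k \<otimes> (c \<otimes> s) \<otimes> inv (c [^] k) = c \<otimes> (c [^] k \<otimes> s \<otimes> inv (c [^] k))"
      using c st nat_pow_Suc2[of c k] by (simp add: m_assoc[symmetric])
    also have "\<dots> = c [^] (2 * k + 1) \<otimes> s"
      using dihedral_conj[OF st, of k] nat_pow_Suc2[of c "k + k"] c st
      by (simp add: c_def[symmetric] mult_2 m_assoc[symmetric])
    finally have 2: "(s \<otimes> q \<otimes> s = t) = (r = c [^] (2 * k + 1) \<otimes> s)" .
    have "concat (replicate (Suc k) [s, t]) = concat (replicate k [s, t]) @ [s, t]"
      by (simp flip: replicate_append_same)
    then have "inversion_parity (concat (replicate (Suc k) [s, t])) r =
        (inversion_parity (concat (replicate k [s, t])) r \<noteq> ((q = s) \<noteq> (s \<otimes> q \<otimes> s = t)))"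
      using st r by (subst \<open>_ = _ @ _\<close>, subst inversion_parity_append)
        (auto simp: word_prod_alternating q_def c_def split: if_splits)
    then show ?case using Suc 1 2 by (auto simp: c_def)
  qed
  also have "(\<Sum>i<2*k. ?f i) = card {i. i < 2 * k \<and> r = (s \<otimes> t) [^] i \<otimes> s}"
    by (simp add: sum.If_cases lessThan_def Int_def)
  finally show ?thesis .
qed

text \<open>
  Each reflection \<open>(st)\<^sup>i s\<close> of the relator occurs twice, at positions that differ by the order of
  \<open>st\<close>. If that order is infinite, \<open>ord\<close> is 0 and the word is empty.
\<close>
lemma inversion_parity_relator:
  assumes st: "s \<in> S" "t \<in> S" and r: "r \<in> carrier W"
  shows "\<not> inversion_parity (concat (replicate (ord (s \<otimes> t)) [s, t])) r"
proof -
  define c m where "c = s \<otimes> t" and "m = ord c"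
  have c: "c \<in> carrier W" "c [^] m = \<one>" using st by (simp_all add: c_def m_def)
  let ?A = "\<lambda>n. {i. i < n \<and> r = c [^] i \<otimes> s}"
  have "c [^] (m + i) = c [^] i" for i
    using c by (simp flip: nat_pow_mult)
  then have "?A (2 * m) = ?A m \<union> (\<lambda>i. m + i) ` ?A m"
    by (auto simp: image_iff Bex_def mult_2) (metis add_diff_inverse_nat nat_add_left_cancel_less)
  also have "card \<dots> = card (?A m) + card (?A m)"
    by (subst card_Un_disjoint) (auto simp: card_image)
  finally show ?thesis
    using inversion_parity_alternating[OF st r, of m] by (simp add: c_def m_def)
qed

text \<open>
  Inserting a relator changes no parity: the relator itself contributes an even number, and its
  product is trivial, so the reflections of the letters after it stay the same.
\<close>
lemma inversion_parity_cong:
  assumes "set v \<subseteq> S" "set w \<subseteq> S" "word_prod v = word_prod w" "r \<in> carrier W"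
  shows "inversion_parity v r = inversion_parity w r"
proof -
  have step: "inversion_parity v r = inversion_parity w r" if "coxeter_reduction S v w" for v w
  proof -
    from that obtain a b s t where
      *: "set a \<subseteq> S" "set b \<subseteq> S" "s \<in> S" "t \<in> S" "w = a @ b"
        "v = a @ concat (replicate (ord (s \<otimes> t)) [s, t]) @ b"
      unfolding coxeter_reduction_def lists_eq_set by blast
    let ?rel = "concat (replicate (ord (s \<otimes> t)) [s, t])"
    have "word_prod ?rel = \<one>" "set ?rel \<subseteq> S"
      using * by (auto simp: word_prod_alternating split: if_splits)
    then show ?thesis using * assms(4) inversion_parity_relator by (simp add: inversion_parity_append)
  qed
  have "equivclp (coxeter_reduction S) v w"
    using presentation[of v w] assms by auto
  then show ?thesis
    by (induction rule: equivclp_induct) (auto simp: step)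
qed

text \<open>
  If \<open>r = s\<^sub>1 \<dots> s\<^sub>i \<dots> s\<^sub>1\<close>, then multiplying the word by \<open>r\<close> deletes the \<open>i\<close>-th letter.
\<close>
lemma inversion_parity_imp_deletion:
  "set ws \<subseteq> S \<Longrightarrow> r \<in> carrier W \<Longrightarrow> inversion_parity ws r \<Longrightarrow>
    \<exists>a x b. ws = a @ x # b \<and> r \<otimes> word_prod ws = word_prod (a @ b)"
proof (induction ws arbitrary: r)
  case (Cons s ws)
  show ?case
  proof (cases "r = s")
    case True
    then show ?thesis using Cons.prems by (intro exI[of _ "[]"]) auto
  next
    case False
    then obtain a x b where *: "ws = a @ x # b" "s \<otimes> r \<otimes> s \<otimes> word_prod ws = word_prod (a @ b)"
      using Cons.IH[of "s \<otimes> r \<otimes> s"] Cons.prems by auto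
    have "r \<otimes> word_prod (s # ws) = s \<otimes> (s \<otimes> r \<otimes> s \<otimes> word_prod ws)"
      using Cons.prems by (simp add: m_assoc)
    then show ?thesis using * by (intro exI[of _ "s # a"]) auto
  qed
qed simp

text \<open>
  An odd parity yields a deletion and thus a shorter word. As prepending \<open>s\<close> to a word switches the
  parity of \<open>s\<close>, an even parity for \<open>x\<close> is an odd one for \<open>sx\<close>, which then is longer than \<open>x\<close>.
\<close>
lemma inversion_parity_iff_descent:
  assumes "set ws \<subseteq> S" "s \<in> S"
  shows "inversion_parity ws s \<longleftrightarrow> len (s \<otimes> word_prod ws) < len (word_prod ws)"
proof -
  have *: "len (s \<otimes> x) < len x" if hyps: "inversion_parity ws s" "set ws \<subseteq> S" "word_prod ws = x" for ws x
  proof -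
    obtain v where v: "set v \<subseteq> S" "word_prod v = x" "length v = len x"
      using reduced_word_exists[OF word_prod_S[OF hyps(2)]] hyps(3) by metis
    then have "inversion_parity v s" using inversion_parity_cong[of v ws s] hyps assms by auto
    then obtain a y b where "v = a @ y # b" "s \<otimes> x = word_prod (a @ b)"
      using inversion_parity_imp_deletion[of v s] v assms by auto
    then show ?thesis using len_le[of "a @ b"] v by auto
  qed
  show ?thesis
  proof (cases "inversion_parity ws s")
    case True
    then show ?thesis using *[of ws] assms by auto
  next
    case False
    then have "inversion_parity (s # ws) s" using assms by simp
    then have "len (word_prod ws) < len (s \<otimes> word_prod ws)"
      using *[of "s # ws" "s \<otimes> word_prod ws"] assms by simp
    then show ?thesis using False by simp
  qed
qed

lemma exchange:
  assumes "set ws \<subseteq> S" "s \<in> S" "len (s \<otimes> word_prod ws) < len (word_prod ws)"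
  shows "\<exists>a x b. ws = a @ x # b \<and> s \<otimes> word_prod ws = word_prod (a @ b)"
  using inversion_parity_imp_deletion[of ws s] inversion_parity_iff_descent[of ws s] assms by auto

lemma len_S_mult_cases:
  assumes "s \<in> S" "x \<in> carrier W"
  shows "len (s \<otimes> x) = Suc (len x) \<or> len x = Suc (len (s \<otimes> x))"
proof -
  obtain v where v: "set v \<subseteq> S" "word_prod v = x"
    using carrier_words assms by auto
  have "inversion_parity (s # v) s \<noteq> inversion_parity v s" using assms by simp
  then have "len (s \<otimes> x) \<noteq> len x"
    using inversion_parity_iff_descent[of v s] inversion_parity_iff_descent[of "s # v" s] v assms by auto
  then show ?thesis using len_mult_S_le[OF assms] by linarith
qed

lemma len_inv_mult: "x \<in> carrier W \<Longrightarrow> y \<in> carrier W \<Longrightarrow> len (inv x \<otimes> inv y) = len (y \<otimes> x)"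
  by (metis inv_mult_group len_inv m_closed)

lemma len_mult_S_cases:
  assumes "s \<in> S" "x \<in> carrier W"
  shows "len (x \<otimes> s) = Suc (len x) \<or> len x = Suc (len (x \<otimes> s))"
  using len_S_mult_cases[of s "inv x"] len_inv_mult[of s x] assms by simp

lemma exchange_right:
  assumes "set ws \<subseteq> S" "s \<in> S" "len (word_prod ws \<otimes> s) < len (word_prod ws)"
  shows "\<exists>a x b. ws = a @ x # b \<and> word_prod ws \<otimes> s = word_prod (a @ b)"
proof -
  have "len (s \<otimes> word_prod (rev ws)) < len (word_prod (rev ws))"
    using assms len_inv_mult[of s "word_prod ws"] by (simp add: word_prod_rev)
  then obtain a x b where *: "rev ws = a @ x # b" "s \<otimes> word_prod (rev ws) = word_prod (a @ b)"
    using exchange[of "rev ws" s] assms by auto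
  have ws: "ws = rev b @ x # rev a" using *(1) by (metis rev_append rev_rev_ident rev.simps(2) append_assoc append_Cons append_Nil)
  have "word_prod ws \<otimes> s = inv (s \<otimes> word_prod (rev ws))"
    using assms by (simp add: word_prod_rev inv_mult_group)
  also have "\<dots> = word_prod (rev b @ rev a)"
    using * ws assms(1) word_prod_rev[of "a @ b"] by auto
  finally show ?thesis using ws by blast
qed

text \<open>
  The exchange condition deletes a letter of a reduced word for \<open>xt\<close>. It cannot be a letter of \<open>x\<close>,
  since then \<open>sx\<close> would be shorter than \<open>x\<close>; so it is \<open>t\<close>, and \<open>sxt = x\<close>.
\<close>
lemma commuting_square:
  assumes s: "s \<in> S" "t \<in> S" "x \<in> carrier W"
    and "len x < len (s \<otimes> x)" "len x < len (x \<otimes> t)" "len (s \<otimes> x \<otimes> t) < len (x \<otimes> t)"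
  shows "s \<otimes> x = x \<otimes> t"
proof -
  obtain v where v: "set v \<subseteq> S" "word_prod v = x" "length v = len x"
    using reduced_word_exists s by blast
  have vt: "word_prod (v @ [t]) = x \<otimes> t" using v s by (simp add: word_prod_append_S)
  then obtain a y b where *: "v @ [t] = a @ y # b" "s \<otimes> (x \<otimes> t) = word_prod (a @ b)"
    using exchange[of "v @ [t]" s] v assms by (auto simp: m_assoc)
  show ?thesis
  proof (cases b rule: rev_cases)
    case Nil
    then have "s \<otimes> x \<otimes> t = x" using * v s by (auto simp: m_assoc)
    then show ?thesis using s by (metis S_cancel_right S_carrier m_closed)
  next
    case (snoc c z)
    then have "z = t" "v = a @ y # c" using * by auto
    then have "s \<otimes> x \<otimes> t = word_prod (a @ c) \<otimes> t"
      using * v s snoc word_prod_append_S[of "a @ c" "[t]"] by (simp add: m_assoc)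
    then have "s \<otimes> x = word_prod (a @ c)"
      using s v \<open>v = _\<close> by simp
    then have "len (s \<otimes> x) \<le> length (a @ c)" using v \<open>v = _\<close> len_le[of "a @ c"] by simp
    then show ?thesis using assms v \<open>v = _\<close> by simp
  qed
qed

text \<open>
  Unless \<open>sx = xt\<close>, whether \<open>s\<close> raises the length does not depend on whether \<open>t\<close> has been applied on the
  other side. This makes left and right star multiplication commute.
\<close>
lemma descents_independent:
  assumes s: "s \<in> S" "t \<in> S" "x \<in> carrier W" and ne: "s \<otimes> x \<noteq> x \<otimes> t"
  shows "len (x \<otimes> t) < len (s \<otimes> x \<otimes> t) \<longleftrightarrow> len x < len (s \<otimes> x)"
proof -
  have up: "len (x \<otimes> t) < len (s \<otimes> x \<otimes> t)"
    if x: "x \<in> carrier W" "s \<otimes> x \<noteq> x \<otimes> t" "len x < len (s \<otimes> x)" for x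
  proof (rule ccontr)
    assume "\<not> ?thesis"
    then have less: "len (s \<otimes> x \<otimes> t) < len (x \<otimes> t)"
      using len_S_mult_cases[of s "x \<otimes> t"] s x by (auto simp: m_assoc)
    show False
    proof (cases "len x < len (x \<otimes> t)")
      case True
      then show False using commuting_square[of s t x] less x s by auto
    next
      case False
      then show False
        using less x s len_mult_S_cases[of t x] len_mult_S_cases[of t "s \<otimes> x"] by auto
    qed
  qed
  have "len x < len (s \<otimes> x)" if "len (x \<otimes> t) < len (s \<otimes> x \<otimes> t)"
  proof (rule ccontr)
    assume "\<not> ?thesis"
    then have 1: "len (s \<otimes> x) < len (s \<otimes> (s \<otimes> x))"
      using len_S_mult_cases[of s x] s by auto
    have "s \<otimes> (s \<otimes> x) \<noteq> (s \<otimes> x) \<otimes> t"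
      using ne s by (metis S_cancel S_carrier m_assoc m_closed)
    from up[OF _ this 1] show False using that s by (simp add: m_assoc)
  qed
  then show ?thesis using up ne s by auto
qed

section \<open>Parabolic subgroups\<close>

text \<open>
  Exchange only deletes letters, so a word in \<open>J\<close> can be shortened to a reduced one inside \<open>J\<close>.
\<close>
lemma parabolic_reduced_word:
  assumes "J \<subseteq> S" "x \<in> generate W J"
  shows "\<exists>ws. set ws \<subseteq> J \<and> word_prod ws = x \<and> length ws = len x"
proof -
  have "set ws \<subseteq> J \<Longrightarrow> \<exists>v. set v \<subseteq> J \<and> word_prod v = word_prod ws \<and> length v = len (word_prod ws)"
    for ws
  proof (induction ws)
    case Nil
    then show ?case by simp
  next
    case (Cons s ws)
    then obtain v where v: "set v \<subseteq> J" "word_prod v = word_prod ws" "length v = len (word_prod ws)"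
      by auto
    have s: "s \<in> S" "set v \<subseteq> S" using Cons.prems assms v by auto
    show ?case
    proof (cases "len (s \<otimes> word_prod v) < len (word_prod v)")
      case True
      then obtain a x b where ax: "v = a @ x # b" "s \<otimes> word_prod v = word_prod (a @ b)"
        using exchange[of v s] s by auto
      have "length (a @ b) = len (word_prod (a @ b))"
        using ax v len_S_mult_cases[of s "word_prod v"] True s len_le[of "a @ b"] word_prod_S[of v]
        by (auto simp del: word_prod_S)
      then show ?thesis using ax v by (intro exI[of _ "a @ b"]) auto
    next
      case False
      then have "len (s \<otimes> word_prod v) = Suc (len (word_prod v))"
        using len_S_mult_cases[of s "word_prod v"] s by auto
      then show ?thesis using v Cons.prems by (intro exI[of _ "s # v"]) auto
    qed
  qed
  moreover obtain ws where "set ws \<subseteq> J" "x = word_prod ws"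
    using assms(2) unfolding generate_words[OF assms(1)] by (auto simp: subset_iff)
  ultimately show ?thesis by blast
qed

lemma S_in_parabolic: "J \<subseteq> S \<Longrightarrow> s \<in> S \<Longrightarrow> s \<in> generate W J \<Longrightarrow> s \<in> J"
proof -
  assume *: "J \<subseteq> S" "s \<in> S" "s \<in> generate W J"
  then obtain ws where "set ws \<subseteq> J" "word_prod ws = s" "length ws = 1"
    using parabolic_reduced_word[of J s] by auto
  then show ?thesis using * by (cases ws) auto
qed

lemma parabolic_closed [simp]: "x \<in> generate W J \<Longrightarrow> J \<subseteq> S \<Longrightarrow> x \<in> carrier W"
  using generate_in_carrier[of J x] generators_closed by auto

lemma parabolic_mult [simp]:
  "x \<in> generate W J \<Longrightarrow> y \<in> generate W J \<Longrightarrow> x \<otimes> y \<in> generate W J"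
  by (rule generate.eng)

lemma parabolic_inv [simp]: "J \<subseteq> S \<Longrightarrow> x \<in> generate W J \<Longrightarrow> inv x \<in> generate W J"
  using generate_m_inv_closed[of J x] generators_closed by auto

lemma parabolic_one [simp]: "\<one> \<in> generate W J"
  by (rule generate.one)

lemma parabolic_S [simp]: "s \<in> J \<Longrightarrow> s \<in> generate W J"
  by (rule generate.incl)

lemma parabolic_descent:
  assumes "J \<subseteq> S" "x \<in> generate W J" "s \<in> S" "len (s \<otimes> x) < len x"
  shows "s \<in> J"
proof -
  obtain ws where ws: "set ws \<subseteq> J" "word_prod ws = x"
    using parabolic_reduced_word[OF assms(1,2)] by blast
  have "\<exists>a y b. ws = a @ y # b \<and> s \<otimes> word_prod ws = word_prod (a @ b)"
    using ws assms by (intro exchange) auto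
  then obtain a y b where "ws = a @ y # b" "s \<otimes> x = word_prod (a @ b)"
    unfolding ws(2) by blast
  then have "s \<otimes> x \<in> generate W J" using ws generate_words[OF assms(1)] by (auto simp: subset_iff intro!: imageI)
  then have "s \<otimes> x \<otimes> inv x \<in> generate W J" using assms by simp
  then show ?thesis using S_in_parabolic assms by (simp add: m_assoc)
qed

lemma parabolic_induct [consumes 2, case_names one step]:
  assumes "J \<subseteq> S" "x \<in> generate W J"
    and "P \<one>"
    and "\<And>s x. s \<in> J \<Longrightarrow> x \<in> generate W J \<Longrightarrow> len x < len (s \<otimes> x) \<Longrightarrow> P x \<Longrightarrow> P (s \<otimes> x)"
  shows "P x"
proof -
  have "set ws \<subseteq> J \<Longrightarrow> length ws = len (word_prod ws) \<Longrightarrow> P (word_prod ws)" for ws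
  proof (induction ws)
    case Nil
    then show ?case using assms by simp
  next
    case (Cons s ws)
    have "len (word_prod ws) \<le> length ws" "len (word_prod (s # ws)) \<le> Suc (len (word_prod ws))"
      using Cons.prems len_le[of ws] len_mult_S_le(1)[of s "word_prod ws"] subset_trans[OF Cons.prems(1) assms(1)]
      by auto
    then have "length ws = len (word_prod ws)" "len (word_prod ws) < len (s \<otimes> word_prod ws)"
      using Cons.prems by auto
    moreover have "word_prod ws \<in> generate W J"
      using Cons.prems generate_words[OF assms(1)] by (auto intro!: imageI)
    ultimately show ?case using assms(4) Cons by auto
  qed
  then show ?thesis using parabolic_reduced_word[OF assms(1,2)] by auto
qed

lemma parabolic_induct_right [consumes 2, case_names one step]:
  assumes J: "J \<subseteq> S" "x \<in> generate W J"
    and "P \<one>"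
    and step: "\<And>s x. s \<in> J \<Longrightarrow> x \<in> generate W J \<Longrightarrow> len x < len (x \<otimes> s) \<Longrightarrow> P x \<Longrightarrow> P (x \<otimes> s)"
  shows "P x"
proof -
  have "inv x \<in> generate W J" using J by simp
  from J(1) this have "P (inv (inv x))"
  proof (induction rule: parabolic_induct)
    case one
    then show ?case using assms by simp
  next
    case (step s x)
    have "s \<in> S" "x \<in> carrier W" using step J by auto
    moreover from this have "len (inv x \<otimes> s) = len (s \<otimes> x)" using len_inv_mult[of x s] by simp
    ultimately show ?case using step assms(4)[of s "inv x"] J by (simp add: inv_mult_group)
  qed
  then show ?thesis using J by simp
qed

section \<open>The star product\<close>

text \<open>
  Left and right multiplication by a generator, performed only if the length grows. These are the
  star multiplications by \<open>s\<close>, before the existence of an associative product is known.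
\<close>
definition raise_left :: "'a \<Rightarrow> 'a \<Rightarrow> 'a" where
  "raise_left s x = (if len x < len (s \<otimes> x) then s \<otimes> x else x)"

definition raise_right :: "'a \<Rightarrow> 'a \<Rightarrow> 'a" where
  "raise_right x s = (if len x < len (x \<otimes> s) then x \<otimes> s else x)"

lemma raise_left_closed [simp]: "s \<in> S \<Longrightarrow> x \<in> carrier W \<Longrightarrow> raise_left s x \<in> carrier W"
  by (simp add: raise_left_def)

lemma raise_right_closed [simp]: "s \<in> S \<Longrightarrow> x \<in> carrier W \<Longrightarrow> raise_right x s \<in> carrier W"
  by (simp add: raise_right_def)

text \<open>
  Either \<open>sx = xt\<close>, and the two operations coincide on \<open>x\<close> and repeating them has no further effect,
  or the length changes on the two sides are independent.
\<close>
lemma raise_left_raise_right: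
  assumes st: "s \<in> S" "t \<in> S" "x \<in> carrier W"
  shows "raise_left s (raise_right x t) = raise_right (raise_left s x) t"
proof (cases "s \<otimes> x = x \<otimes> t")
  case True
  have "len (s \<otimes> (x \<otimes> t)) = len x" "len (s \<otimes> x \<otimes> t) = len x"
    using st True S_cancel[of s x] S_cancel_right[of t x] by auto
  then show ?thesis using True by (auto simp: raise_left_def raise_right_def)
next
  case False
  have a: "len (x \<otimes> t) < len (s \<otimes> x \<otimes> t) \<longleftrightarrow> len x < len (s \<otimes> x)"
    using descents_independent[OF st False] .
  have "len (s \<otimes> x) < len (s \<otimes> x \<otimes> t) \<longleftrightarrow> len x < len (x \<otimes> t)"
    using a len_S_mult_cases[of s x] len_S_mult_cases[of s "x \<otimes> t"] len_mult_S_cases[of t x]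
      len_mult_S_cases[of t "s \<otimes> x"] st by (auto simp: m_assoc)
  with a show ?thesis using st by (auto simp: raise_left_def raise_right_def m_assoc)
qed

lemma foldr_raise_left_closed [simp]:
  "set v \<subseteq> S \<Longrightarrow> x \<in> carrier W \<Longrightarrow> foldr raise_left v x \<in> carrier W"
  by (induction v) auto

lemma foldl_raise_right_closed [simp]:
  "set v \<subseteq> S \<Longrightarrow> x \<in> carrier W \<Longrightarrow> foldl raise_right x v \<in> carrier W"
  by (induction v arbitrary: x) auto

lemma foldr_raise_left_raise_right:
  "set v \<subseteq> S \<Longrightarrow> t \<in> S \<Longrightarrow> x \<in> carrier W \<Longrightarrow> foldr raise_left v (raise_right x t) = raise_right (foldr raise_left v x) t"
  by (induction v) (auto simp: raise_left_raise_right)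

lemma foldr_raise_left_foldl_raise_right:
  "set v \<subseteq> S \<Longrightarrow> set w \<subseteq> S \<Longrightarrow> x \<in> carrier W \<Longrightarrow>
    foldr raise_left v (foldl raise_right x w) = foldl raise_right (foldr raise_left v x) w"
  by (induction w arbitrary: x) (auto simp: foldr_raise_left_raise_right)

lemma foldr_raise_left_reduced:
  "set ws \<subseteq> S \<Longrightarrow> length ws = len (word_prod ws) \<Longrightarrow> foldr raise_left ws \<one> = word_prod ws"
proof (induction ws)
  case (Cons s ws)
  have "len (word_prod ws) \<le> length ws" "len (word_prod (s # ws)) \<le> Suc (len (word_prod ws))"
    using Cons.prems len_le[of ws] len_mult_S_le[of s "word_prod ws"] by auto
  then show ?case using Cons by (auto simp: raise_left_def)
qed simp

lemma foldl_raise_right_reduced: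
  "set ws \<subseteq> S \<Longrightarrow> length ws = len (word_prod ws) \<Longrightarrow> foldl raise_right \<one> ws = word_prod ws"
proof (induction ws rule: rev_induct)
  case (snoc s ws)
  have "len (word_prod ws) \<le> length ws"
    "len (word_prod (ws @ [s])) \<le> Suc (len (word_prod ws))"
    using snoc.prems len_le[of ws] len_mult_S_cases[of s "word_prod ws"]
    by (auto simp: word_prod_append_S)
  then show ?case using snoc by (auto simp: raise_right_def word_prod_append_S)
qed simp

definition some_reduced_word :: "'a \<Rightarrow> 'a list" where
  "some_reduced_word x = (SOME ws. set ws \<subseteq> S \<and> word_prod ws = x \<and> length ws = len x)"

lemma some_reduced_word:
  assumes "x \<in> carrier W"
  shows "set (some_reduced_word x) \<subseteq> S" "word_prod (some_reduced_word x) = x"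
    "length (some_reduced_word x) = len x"
  using someI_ex[OF reduced_word_exists[OF assms]] unfolding some_reduced_word_def by auto

definition demazure :: "'a \<Rightarrow> 'a \<Rightarrow> 'a" where
  "demazure x y = foldr raise_left (some_reduced_word x) y"

text \<open>
  The product can be computed by reading either factor as a word. Hence it does not depend on the
  chosen reduced words, and associativity becomes the commutation of left and right operations.
\<close>
lemma demazure_raise_right:
  assumes "x \<in> carrier W" "y \<in> carrier W"
  shows "demazure x y = foldl raise_right x (some_reduced_word y)"
proof -
  have "demazure x y = foldr raise_left (some_reduced_word x) (foldl raise_right \<one> (some_reduced_word y))"
    using foldl_raise_right_reduced some_reduced_word[OF assms(2)] by (simp add: demazure_def)
  also have "\<dots> = foldl raise_right x (some_reduced_word y)"
    using some_reduced_word assms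
    by (simp add: foldr_raise_left_foldl_raise_right foldr_raise_left_reduced)
  finally show ?thesis .
qed

lemma some_reduced_word_one: "some_reduced_word \<one> = []"
  using some_reduced_word(3)[of \<one>] by simp

lemma some_reduced_word_S: assumes "s \<in> S" shows "some_reduced_word s = [s]"
proof -
  have "length (some_reduced_word s) = 1" "word_prod (some_reduced_word s) = s"
    "set (some_reduced_word s) \<subseteq> S"
    using some_reduced_word[of s] assms by auto
  then show ?thesis by (cases "some_reduced_word s") auto
qed

lemma demazure_closed: "x \<in> carrier W \<Longrightarrow> y \<in> carrier W \<Longrightarrow> demazure x y \<in> carrier W"
  using some_reduced_word by (simp add: demazure_def)

lemma demazure_assoc:
  "x \<in> carrier W \<Longrightarrow> y \<in> carrier W \<Longrightarrow> z \<in> carrier W \<Longrightarrow>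
    demazure (demazure x y) z = demazure x (demazure y z)"
  using some_reduced_word
  by (simp add: demazure_raise_right[of _ z] demazure_closed)
     (simp add: demazure_def foldr_raise_left_foldl_raise_right)

lemma demazure_monoid:
  "monoid \<lparr>carrier = carrier W, monoid.mult = demazure, one = \<one>\<rparr>"
proof
  fix x assume "x \<in> carrier \<lparr>carrier = carrier W, monoid.mult = demazure, one = \<one>\<rparr>"
  then show "x \<otimes>\<^bsub>\<lparr>carrier = carrier W, monoid.mult = demazure, one = \<one>\<rparr>\<^esub>
      \<one>\<^bsub>\<lparr>carrier = carrier W, monoid.mult = demazure, one = \<one>\<rparr>\<^esub> = x"
    by (simp add: demazure_raise_right some_reduced_word_one)
qed (auto simp: demazure_closed demazure_assoc, simp add: demazure_def some_reduced_word_one)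

lemma demazure_S_right: "x \<in> carrier W \<Longrightarrow> s \<in> S \<Longrightarrow> demazure x s = raise_right x s"
  by (simp add: demazure_raise_right some_reduced_word_S)

lemma bruhat_le_len: "bruhat_le x y \<Longrightarrow> x = y \<or> len x < len y"
  unfolding bruhat_le_def by (induction rule: rtranclp_induct) (auto simp: bruhat_step_def)

lemma bruhat_less_len: "bruhat_less x y \<Longrightarrow> len x < len y"
  using bruhat_le_len by (auto simp: bruhat_less_def)

lemma bruhat_less_step: "bruhat_step x y \<Longrightarrow> bruhat_less x y"
  unfolding bruhat_less_def bruhat_le_def
  by (rule conjI, rule r_into_rtranclp) (auto simp: bruhat_step_def)

lemma bruhat_less_right:
  assumes "x \<in> carrier W" "s \<in> S" "len x < len (x \<otimes> s)"
  shows "bruhat_less x (x \<otimes> s)"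
proof -
  have "s = \<one> \<otimes> s \<otimes> inv \<one>" using assms by simp
  then have "s \<in> reflections" using assms unfolding reflections_def by blast
  then show ?thesis using assms by (auto intro!: bruhat_less_step simp: bruhat_step_def)
qed

lemma bruhat_less_left:
  assumes "x \<in> carrier W" "s \<in> S" "len x < len (s \<otimes> x)"
  shows "bruhat_less x (s \<otimes> x)"
proof -
  have "inv x \<otimes> s \<otimes> inv (inv x) \<in> reflections" unfolding reflections_def using assms by blast
  moreover have "s \<otimes> x = x \<otimes> (inv x \<otimes> s \<otimes> inv (inv x))" using assms by (simp add: m_assoc)
  ultimately show ?thesis using assms by (auto intro!: bruhat_less_step simp: bruhat_step_def)
qed

text \<open>
  The conditions defining the star product determine it on all pairs, by induction on a reduced
  word of the second factor.
\<close>
lemma star_eq_demazure: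
  assumes "x \<in> carrier W" "y \<in> carrier W"
  shows "star x y = demazure x y"
proof -
  define good where "good = (\<lambda>m. monoid \<lparr>carrier = carrier W, monoid.mult = m, one = \<one>\<rparr> \<and>
     (\<forall>x \<in> carrier W. \<forall>s \<in> S.
        (bruhat_less x (x \<otimes> s) \<longrightarrow> m x s = x \<otimes> s) \<and>
        (bruhat_less (x \<otimes> s) x \<longrightarrow> m x s = x)))"
  have "good demazure"
    unfolding good_def using demazure_monoid
    by (auto simp: demazure_S_right raise_right_def dest: bruhat_less_len bruhat_less_right)
  then have "good (SOME m. good m)" by (rule someI[of good])
  moreover have "star = (SOME m. good m)" unfolding star_def good_def ..
  ultimately have "good star" by simp
  then interpret m: monoid "\<lparr>carrier = carrier W, monoid.mult = star, one = \<one>\<rparr>"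
    by (simp add: good_def)
  have S: "star x s = raise_right x s" if "x \<in> carrier W" "s \<in> S" for x s
  proof (cases "len x < len (x \<otimes> s)")
    case True
    then show ?thesis using \<open>good star\<close> that bruhat_less_right
      by (auto simp: good_def raise_right_def)
  next
    case False
    then have "len (x \<otimes> s) < len (x \<otimes> s \<otimes> s)"
      using len_mult_S_cases[of s x] that S_cancel_right by auto
    then have "bruhat_less (x \<otimes> s) x"
      using bruhat_less_right[of "x \<otimes> s" s] that S_cancel_right by auto
    then show ?thesis using \<open>good star\<close> that False by (auto simp: good_def raise_right_def)
  qed
  have "y \<in> generate W S" using assms generators_generate by simp
  with order_refl show ?thesis
  proof (induction rule: parabolic_induct_right)
    case one
    then show ?case using m.r_one assms by (simp add: demazure_raise_right some_reduced_word_one)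
  next
    case (step s y)
    then have y: "y \<in> carrier W" "s \<in> S" by (auto simp: generators_generate)
    have "star x (y \<otimes> s) = star x (star y s)" using S y step by (simp add: raise_right_def)
    also have "\<dots> = star (star x y) s" using m.m_assoc[of x y s] assms y by simp
    also have "\<dots> = demazure (demazure x y) s"
      using S y step assms by (simp add: demazure_closed demazure_S_right)
    also have "\<dots> = demazure x (demazure y s)" using assms y by (simp add: demazure_assoc)
    also have "\<dots> = demazure x (y \<otimes> s)" using y step by (simp add: demazure_S_right raise_right_def)
    finally show ?case .
  qed
qed

lemma star_closed [simp]: "x \<in> carrier W \<Longrightarrow> y \<in> carrier W \<Longrightarrow> star x y \<in> carrier W"
  by (simp add: star_eq_demazure demazure_closed)

lemma star_assoc:
  "x \<in> carrier W \<Longrightarrow> y \<in> carrier W \<Longrightarrow> z \<in> carrier W \<Longrightarrow> star (star x y) z = star x (star y z)"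
  by (simp add: star_eq_demazure demazure_closed demazure_assoc)

lemma star_one [simp]: "x \<in> carrier W \<Longrightarrow> star x \<one> = x" "x \<in> carrier W \<Longrightarrow> star \<one> x = x"
  using demazure_raise_right[of x \<one>] by (auto simp: star_eq_demazure demazure_def some_reduced_word_one)

lemma star_right_S:
  "x \<in> carrier W \<Longrightarrow> s \<in> S \<Longrightarrow> star x s = (if len x < len (x \<otimes> s) then x \<otimes> s else x)"
  by (simp add: star_eq_demazure demazure_S_right raise_right_def)

lemma star_left_S:
  "x \<in> carrier W \<Longrightarrow> s \<in> S \<Longrightarrow> star s x = (if len x < len (s \<otimes> x) then s \<otimes> x else x)"
  by (simp add: star_eq_demazure demazure_def some_reduced_word_S raise_left_def)

lemma star_left_fix:
  assumes "x \<in> carrier W" "s \<in> S" shows "star s x = x \<longleftrightarrow> len (s \<otimes> x) < len x"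
  using assms len_S_mult_cases[of s x] by (auto simp: star_left_S)

lemma star_right_fix:
  assumes "x \<in> carrier W" "s \<in> S" shows "star x s = x \<longleftrightarrow> len (x \<otimes> s) < len x"
  using assms len_mult_S_cases[of s x] by (auto simp: star_right_S)

lemma carrier_generate: "x \<in> carrier W \<longleftrightarrow> x \<in> generate W S"
  by (simp add: generators_generate)

lemma star_left_up: "x \<in> carrier W \<Longrightarrow> s \<in> S \<Longrightarrow> len x < len (s \<otimes> x) \<Longrightarrow> s \<otimes> x = star s x"
  by (simp add: star_left_S)

lemma star_right_up: "x \<in> carrier W \<Longrightarrow> s \<in> S \<Longrightarrow> len x < len (x \<otimes> s) \<Longrightarrow> x \<otimes> s = star x s"
  by (simp add: star_right_S)

text \<open>Each step of a star multiplication either keeps the element or lengthens it.\<close>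
lemma star_len_right:
  assumes "x \<in> carrier W" "y \<in> carrier W"
  shows "star x y = x \<or> len x < len (star x y)"
proof -
  have "y \<in> generate W S" using assms by (simp add: carrier_generate)
  with order_refl show ?thesis
  proof (induction rule: parabolic_induct_right)
    case (step s y)
    then have y: "y \<in> carrier W" "s \<in> S" by (auto simp: carrier_generate)
    have "star x (y \<otimes> s) = star (star x y) s"
      using y step assms by (simp add: star_right_up[OF _ _ step(3)] star_assoc)
    then show ?case using step y assms by (auto simp: star_right_S)
  qed (use assms in auto)
qed

lemma star_len_left:
  assumes "x \<in> carrier W" "y \<in> carrier W"
  shows "star x y = y \<or> len y < len (star x y)"
proof -
  have "x \<in> generate W S" using assms by (simp add: carrier_generate)
  with order_refl show ?thesis
  proof (induction rule: parabolic_induct)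
    case (step s x)
    then have y: "x \<in> carrier W" "s \<in> S" by (auto simp: carrier_generate)
    have "star (s \<otimes> x) y = star s (star x y)"
      using y step assms by (simp add: star_left_up[OF _ _ step(3)] star_assoc)
    then show ?case using step y assms by (auto simp: star_left_S)
  qed (use assms in auto)
qed

lemma star_additive:
  assumes "x \<in> carrier W" "y \<in> carrier W" "len (x \<otimes> y) = len x + len y"
  shows "star x y = x \<otimes> y"
proof -
  have "x \<in> generate W S" using assms by (simp add: carrier_generate)
  from order_refl this assms(3) show ?thesis
  proof (induction rule: parabolic_induct)
    case (step s x)
    then have x: "x \<in> carrier W" "s \<in> S" by (auto simp: carrier_generate)
    have "len (s \<otimes> x) = Suc (len x)" using len_S_mult_cases[of s x] x step by auto
    moreover have "len (s \<otimes> x \<otimes> y) \<le> Suc (len (x \<otimes> y))" "len (x \<otimes> y) \<le> len x + len y"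
      using x assms len_mult[of x y] len_mult_S_le[of s "x \<otimes> y"] by (auto simp: m_assoc)
    ultimately have l: "len (x \<otimes> y) = len x + len y" "len (x \<otimes> y) < len (s \<otimes> (x \<otimes> y))"
      using step.prems x assms by (auto simp: m_assoc)
    have "star (s \<otimes> x) y = star s (star x y)"
      using x step assms by (simp add: star_left_up[OF _ _ step(3)] star_assoc)
    also have "\<dots> = s \<otimes> x \<otimes> y" using step.IH l x assms by (simp add: star_left_S m_assoc)
    finally show ?case .
  qed (use assms in auto)
qed

lemma star_parabolic_left:
  assumes "J \<subseteq> S" "a \<in> generate W J" "x \<in> carrier W"
  shows "\<exists>a' \<in> generate W J. star a x = a' \<otimes> x"
  using assms(1,2)
proof (induction rule: parabolic_induct)
  case one
  then show ?case using assms by (intro bexI[of _ \<one>]) auto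
next
  case (step s a)
  then obtain a' where a': "a' \<in> generate W J" "star a x = a' \<otimes> x" by auto
  have c: "s \<in> S" "a \<in> carrier W" "a' \<in> carrier W" using step a' assms by auto
  have "star (s \<otimes> a) x = star s (a' \<otimes> x)"
    using c step a' assms by (simp add: star_left_up[OF _ _ step(3)] star_assoc)
  then have "star (s \<otimes> a) x = (s \<otimes> a') \<otimes> x \<or> star (s \<otimes> a) x = a' \<otimes> x"
    using c assms by (simp add: star_left_S m_assoc)
  then show ?case using a' step by auto
qed

lemma star_parabolic_right:
  assumes "I \<subseteq> S" "b \<in> generate W I" "x \<in> carrier W"
  shows "\<exists>b' \<in> generate W I. star x b = x \<otimes> b'"
  using assms(1,2)
proof (induction rule: parabolic_induct_right)
  case one
  then show ?case using assms by (intro bexI[of _ \<one>]) auto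
next
  case (step s b)
  then obtain b' where b': "b' \<in> generate W I" "star x b = x \<otimes> b'" by auto
  have c: "s \<in> S" "b \<in> carrier W" "b' \<in> carrier W" using step b' assms by auto
  have "star x (b \<otimes> s) = star (x \<otimes> b') s"
    using c step b' assms by (simp add: star_right_up[OF _ _ step(3)] star_assoc[symmetric])
  then have "star x (b \<otimes> s) = x \<otimes> (b' \<otimes> s) \<or> star x (b \<otimes> s) = x \<otimes> b'"
    using c assms by (simp add: star_right_S m_assoc)
  then show ?case using b' step by auto
qed

lemma star_in_parabolic:
  assumes "J \<subseteq> S" "a \<in> generate W J" "b \<in> generate W J"
  shows "star a b \<in> generate W J"
  using star_parabolic_left[of J a b] assms by auto

section \<open>Full and minimal elements\<close>

text \<open>
  In a double coset the element that is full on both sides is the maximal one, and the element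
  that is minimal on both sides is the minimal one (\<open>max_elt_eq\<close>, \<open>min_elt_eq\<close>).
\<close>
definition lfull :: "'a set \<Rightarrow> 'a \<Rightarrow> bool" where
  "lfull J x \<longleftrightarrow> (\<forall>s \<in> J. len (s \<otimes> x) < len x)"

definition rfull :: "'a \<Rightarrow> 'a set \<Rightarrow> bool" where
  "rfull x I \<longleftrightarrow> (\<forall>s \<in> I. len (x \<otimes> s) < len x)"

definition lmin :: "'a set \<Rightarrow> 'a \<Rightarrow> bool" where
  "lmin J x \<longleftrightarrow> (\<forall>s \<in> J. len x < len (s \<otimes> x))"

definition rmin :: "'a \<Rightarrow> 'a set \<Rightarrow> bool" where
  "rmin x I \<longleftrightarrow> (\<forall>s \<in> I. len x < len (x \<otimes> s))"

lemma not_lmin: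
  assumes "\<not> lmin J x" "J \<subseteq> S" "x \<in> carrier W"
  obtains s where "s \<in> J" "len (s \<otimes> x) < len x"
proof -
  obtain s where s: "s \<in> J" "\<not> len x < len (s \<otimes> x)" using assms(1) unfolding lmin_def by blast
  then have "len (s \<otimes> x) < len x" using len_S_mult_cases[of s x] assms by auto
  then show ?thesis using s that by blast
qed

lemma lfull_inv: "x \<in> carrier W \<Longrightarrow> I \<subseteq> S \<Longrightarrow> lfull I (inv x) \<longleftrightarrow> rfull x I"
  unfolding lfull_def rfull_def using len_inv_mult[of _ x] by (intro ball_cong) (auto, (metis S_carrier S_inv subsetD)+)

lemma lmin_inv: "x \<in> carrier W \<Longrightarrow> I \<subseteq> S \<Longrightarrow> lmin I (inv x) \<longleftrightarrow> rmin x I"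
  unfolding lmin_def rmin_def using len_inv_mult[of _ x] by (intro ball_cong) (auto, (metis S_carrier S_inv subsetD)+)

lemma lfull_absorb:
  assumes "J \<subseteq> S" "a \<in> generate W J" "x \<in> carrier W" "lfull J x"
  shows "star a x = x"
  using assms(1,2)
proof (induction rule: parabolic_induct)
  case (step s a)
  then have "s \<in> S" "a \<in> carrier W" using assms by auto
  then show ?case using step assms by (simp add: star_left_up[OF _ _ step(3)] star_assoc star_left_fix lfull_def)
qed (use assms in auto)

lemma rfull_absorb:
  assumes "J \<subseteq> S" "a \<in> generate W J" "x \<in> carrier W" "rfull x J"
  shows "star x a = x"
  using assms(1,2)
proof (induction rule: parabolic_induct_right)
  case (step s a)
  then have "s \<in> S" "a \<in> carrier W" using assms by auto
  then show ?case using step assms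
    by (simp add: star_right_up[OF _ _ step(3)] star_assoc[symmetric] star_right_fix rfull_def)
qed (use assms in auto)

lemma lfull_star:
  assumes "J \<subseteq> S" "x \<in> carrier W" "y \<in> carrier W" "lfull J x"
  shows "lfull J (star x y)"
  unfolding lfull_def
proof
  fix s assume "s \<in> J"
  then have "s \<in> S" "star s x = x" using assms by (auto simp: lfull_def star_left_fix)
  then have "star s (star x y) = star x y" using assms by (simp flip: star_assoc)
  then show "len (s \<otimes> star x y) < len (star x y)"
    using assms \<open>s \<in> S\<close> by (simp add: star_left_fix)
qed

lemma rfull_star:
  assumes "J \<subseteq> S" "x \<in> carrier W" "y \<in> carrier W" "rfull y J"
  shows "rfull (star x y) J"
  unfolding rfull_def
proof
  fix s assume "s \<in> J"
  then have "s \<in> S" "star y s = y" using assms by (auto simp: rfull_def star_right_fix)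
  then have "star (star x y) s = star x y" using assms by (simp add: star_assoc)
  then show "len (star x y \<otimes> s) < len (star x y)"
    using assms \<open>s \<in> S\<close> by (simp add: star_right_fix)
qed

section \<open>Longest elements\<close>

lemma finitary_S: "finitary I \<Longrightarrow> I \<subseteq> S"
  by (simp add: finitary_def)

lemma finitary_subset: "finitary I \<Longrightarrow> J \<subseteq> I \<Longrightarrow> finitary J"
  using mono_generate[of J I] by (auto simp: finitary_def dest: finite_subset)

lemma finitary_empty [simp]: "finitary {}"
  by (simp add: finitary_def generate_empty)

lemma finitary_finite: "finitary I \<Longrightarrow> finite I"
  unfolding finitary_def by (meson finite_subset parabolic_S subsetI)

text \<open>
  An element of maximal length is full on both sides. If \<open>w\<close> and \<open>w'\<close> both are, then \<open>w' * w\<close> equals \<open>w\<close>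
  since \<open>w\<close> absorbs on the left, and \<open>w'\<close> since \<open>w'\<close> absorbs on the right.
\<close>
lemma longest_unique_ex:
  assumes "finitary I"
  shows "\<exists>!w. w \<in> generate W I \<and> (\<forall>v \<in> generate W I. len v \<le> len w)"
proof -
  have I: "I \<subseteq> S" using assms by (simp add: finitary_S)
  have full: "lfull I w \<and> rfull w I"
    if w: "w \<in> generate W I" "\<forall>v \<in> generate W I. len v \<le> len w" for w
  proof -
    have "len (s \<otimes> w) \<noteq> len w" "len (w \<otimes> s) \<noteq> len w" "len (s \<otimes> w) \<le> len w" "len (w \<otimes> s) \<le> len w"
      if "s \<in> I" for s
      using len_S_mult_cases[of s w] len_mult_S_cases[of s w] w that I by auto
    then show ?thesis unfolding lfull_def rfull_def by (simp add: le_neq_implies_less)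
  qed
  have "finite (len ` generate W I)" "len ` generate W I \<noteq> {}"
    using assms unfolding finitary_def by (blast, metis empty_iff image_is_empty parabolic_one)
  then have "Max (len ` generate W I) \<in> len ` generate W I" by (rule Max_in)
  then obtain w where "w \<in> generate W I" "Max (len ` generate W I) = len w" by blast
  moreover from this have "\<forall>v \<in> generate W I. len v \<le> len w"
    using \<open>finite (len ` generate W I)\<close> by (metis Max_ge imageI)
  moreover have "w = w'"
    if "w \<in> generate W I" "\<forall>v \<in> generate W I. len v \<le> len w"
      "w' \<in> generate W I" "\<forall>v \<in> generate W I. len v \<le> len w'" for w w'
    using full[of w] full[of w'] lfull_absorb[of I w w'] rfull_absorb[of I w' w] that I by simp
  ultimately show ?thesis by blast
qed

lemma longest_mem: "finitary I \<Longrightarrow> longest I \<in> generate W I"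
  and longest_max: "finitary I \<Longrightarrow> v \<in> generate W I \<Longrightarrow> len v \<le> len (longest I)"
  using theI'[OF longest_unique_ex[of I]] unfolding longest_def by auto

lemma longest_carrier [simp]: "finitary I \<Longrightarrow> longest I \<in> carrier W"
  by (meson longest_mem finitary_S parabolic_closed)

lemma longest_full:
  assumes "finitary I" shows "lfull I (longest I)" "rfull (longest I) I"
proof -
  have w: "longest I \<in> generate W I" "longest I \<in> carrier W"
    using longest_mem assms by auto
  have "len (s \<otimes> longest I) < len (longest I) \<and> len (longest I \<otimes> s) < len (longest I)" if "s \<in> I" for s
    using len_S_mult_cases[of s "longest I"] len_mult_S_cases[of s "longest I"] w that
      longest_max[OF assms, of "s \<otimes> longest I"] longest_max[OF assms, of "longest I \<otimes> s"]
      finitary_S[OF assms] by auto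
  then show "lfull I (longest I)" "rfull (longest I) I" by (auto simp: lfull_def rfull_def)
qed

lemma lfull_longest:
  assumes "finitary I" "x \<in> generate W I" "lfull I x" shows "x = longest I"
  using lfull_absorb[of I "longest I" x] rfull_absorb[of I x "longest I"] longest_full[of I] assms
    finitary_S longest_mem by auto

lemma rfull_longest:
  assumes "finitary I" "x \<in> generate W I" "rfull x I" shows "x = longest I"
  using rfull_absorb[of I "longest I" x] lfull_absorb[of I x "longest I"] longest_full[of I] assms
    finitary_S longest_mem by auto

lemma longest_inv [simp]: assumes "finitary I" shows "inv (longest I) = longest I"
  using assms lfull_inv[of "longest I" I] longest_full[of I] longest_mem[of I] finitary_S
  by (intro lfull_longest) auto

lemma longest_square [simp]: "finitary I \<Longrightarrow> longest I \<otimes> longest I = \<one>"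
  using r_inv[of "longest I"] by simp

lemma longest_cancel [simp]: "finitary I \<Longrightarrow> x \<in> carrier W \<Longrightarrow> longest I \<otimes> (longest I \<otimes> x) = x"
  by (simp flip: m_assoc)

text \<open>
  From \<open>x\<close>, lengths can be raised on the right until the element is full, and the only full element
  is the longest one.
\<close>
lemma longest_complement:
  assumes "finitary I" "x \<in> generate W I"
  shows "\<exists>y \<in> generate W I. x \<otimes> y = longest I \<and> len x + len y = len (longest I)"
  using assms(2)
proof (induction "len (longest I) - len x" arbitrary: x rule: less_induct)
  case less
  have I: "I \<subseteq> S" "x \<in> carrier W" using assms less finitary_S by auto
  show ?case
  proof (cases "rfull x I")
    case True
    then show ?thesis using rfull_longest[of I x] less assms I by (intro bexI[of _ \<one>]) auto
  next
    case False
    then obtain s where s: "s \<in> I" "len (x \<otimes> s) = Suc (len x)"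
      using len_mult_S_cases[of _ x] I by (fastforce simp: rfull_def)
    have "x \<otimes> s \<in> generate W I" "len (x \<otimes> s) \<le> len (longest I)"
      using s longest_max[OF assms(1), of "x \<otimes> s"] parabolic_mult[OF less.prems parabolic_S[OF s(1)]]
      by (simp_all del: parabolic_mult)
    moreover from this have "len (longest I) - len (x \<otimes> s) < len (longest I) - len x"
      using s by simp
    ultimately obtain y where y: "y \<in> generate W I" "x \<otimes> s \<otimes> y = longest I"
        "len (x \<otimes> s) + len y = len (longest I)"
      using less.hyps[of "x \<otimes> s"] by blast
    have c: "s \<in> S" "y \<in> carrier W" using s y I by auto
    have "x \<otimes> (s \<otimes> y) = longest I" using y c I by (simp add: m_assoc)
    moreover have "len (s \<otimes> y) \<le> Suc (len y)" "len (x \<otimes> (s \<otimes> y)) \<le> len x + len (s \<otimes> y)"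
      using len_mult_S_le[of s y] c I by (auto intro: len_mult)
    ultimately show ?thesis using s y by (intro bexI[of _ "s \<otimes> y"]) auto
  qed
qed

lemma longest_len_left:
  assumes "finitary I" "x \<in> generate W I"
  shows "len (x \<otimes> longest I) + len x = len (longest I)"
proof -
  have x: "x \<in> carrier W" "I \<subseteq> S" using assms finitary_S by auto
  then obtain y where y: "y \<in> generate W I" "inv x \<otimes> y = longest I" "len x + len y = len (longest I)"
    using longest_complement[of I "inv x"] assms by auto
  then have "y = x \<otimes> longest I" using x by (metis cancel_left_inv(2) parabolic_closed)
  then show ?thesis using y by simp
qed

lemma longest_len_right:
  assumes "finitary I" "x \<in> generate W I"
  shows "len (longest I \<otimes> x) + len x = len (longest I)"
proof -
  have x: "x \<in> carrier W" "I \<subseteq> S" using assms finitary_S by auto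
  then show ?thesis
    using longest_len_left[of I "inv x"] assms len_inv_mult[of x "longest I"] by simp
qed

text \<open>
  The length of \<open>w\<^sub>I s w\<^sub>I\<close> is \<open>len(w\<^sub>I) - (len(w\<^sub>I) - 1) = 1\<close>.
\<close>
lemma longest_conj:
  assumes "finitary I" "s \<in> I"
  shows "longest I \<otimes> s \<otimes> longest I \<in> I"
proof -
  have I: "I \<subseteq> S" "s \<in> S" using assms finitary_S by auto
  let ?y = "longest I \<otimes> (s \<otimes> longest I)"
  have "len ?y = 1"
    using longest_len_left[of I s] longest_len_right[of I "s \<otimes> longest I"] assms longest_mem I by simp
  moreover have "?y \<in> generate W I" using assms longest_mem by simp
  ultimately obtain ws where "set ws \<subseteq> I" "word_prod ws = ?y" "length ws = 1"
    using parabolic_reduced_word[of I ?y] I by auto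
  then have "?y \<in> I" using I by (cases ws) auto
  then show ?thesis using I assms by (simp add: m_assoc)
qed

lemma longest_conj_inj:
  assumes "finitary I" "s \<in> carrier W"
  shows "longest I \<otimes> (longest I \<otimes> s \<otimes> longest I) \<otimes> longest I = s"
  using assms by (simp add: m_assoc)

lemma longest_less:
  assumes "finitary I" "J \<subset> I"
  shows "len (longest J) < len (longest I)"
proof -
  have J: "finitary J" "J \<subseteq> S" "I \<subseteq> S" using assms finitary_subset finitary_S by auto
  have m: "longest J \<in> generate W I" using longest_mem[OF J(1)] mono_generate[of J I] assms by auto
  obtain s where s: "s \<in> I" "s \<notin> J" using assms by auto
  have "\<not> len (s \<otimes> longest J) < len (longest J)"
    using parabolic_descent[of J "longest J" s] J s longest_mem[of J] by auto
  then have "len (longest J) < len (s \<otimes> longest J)"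
    using len_S_mult_cases[of s "longest J"] J s by auto
  also have "\<dots> \<le> len (longest I)" using m s assms by (intro longest_max) auto
  finally show ?thesis .
qed

lemma longest_star_left:
  "finitary I \<Longrightarrow> J \<subseteq> I \<Longrightarrow> star (longest J) (longest I) = longest I"
  using longest_mem[of J] mono_generate[of J I] longest_full[of I] finitary_subset[of I J]
  by (intro lfull_absorb[of I]) (auto simp: finitary_S)

lemma longest_star_right:
  "finitary I \<Longrightarrow> J \<subseteq> I \<Longrightarrow> star (longest I) (longest J) = longest I"
  using longest_mem[of J] mono_generate[of J I] longest_full[of I] finitary_subset[of I J]
  by (intro rfull_absorb[of I]) (auto simp: finitary_S)

lemma longest_empty [simp]: "longest {} = \<one>"
  using longest_mem[of "{}"] by (simp add: generate_empty)

lemma longest_singleton: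
  assumes "finitary {s}" shows "longest {s} = s"
proof -
  have s: "s \<in> S" using assms finitary_S by auto
  then show ?thesis using assms by (intro lfull_longest[symmetric]) (auto simp: lfull_def)
qed

section \<open>Double cosets\<close>

lemma double_coset_iff:
  assumes "J \<subseteq> S" "I \<subseteq> S" "x \<in> carrier W"
  shows "y \<in> double_coset J {x} I \<longleftrightarrow> (\<exists>a \<in> generate W J. \<exists>b \<in> generate W I. y = a \<otimes> x \<otimes> b)"
  unfolding double_coset_def set_mult_def by auto

lemma double_coset_carrier:
  assumes "J \<subseteq> S" "I \<subseteq> S" "x \<in> carrier W" "y \<in> double_coset J {x} I"
  shows "y \<in> carrier W"
  using assms double_coset_iff[of J I x y] by auto

lemma double_coset_mult:
  assumes J: "J \<subseteq> S" "I \<subseteq> S" "x \<in> carrier W" and y: "y \<in> double_coset J {x} I"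
    and ab: "a \<in> generate W J" "b \<in> generate W I"
  shows "a \<otimes> y \<otimes> b \<in> double_coset J {x} I"
proof -
  obtain c d where cd: "c \<in> generate W J" "d \<in> generate W I" "y = c \<otimes> x \<otimes> d"
    using y double_coset_iff[OF J] by auto
  have "a \<in> carrier W" "b \<in> carrier W" "c \<in> carrier W" "d \<in> carrier W"
    using J ab cd parabolic_closed by blast+
  then have "a \<otimes> y \<otimes> b = (a \<otimes> c) \<otimes> x \<otimes> (d \<otimes> b)" using J(3) cd(3) by (simp add: m_assoc)
  moreover have "a \<otimes> c \<in> generate W J" "d \<otimes> b \<in> generate W I" using cd ab by auto
  ultimately show ?thesis unfolding double_coset_iff[OF J] by (intro bexI)
qed

lemma double_coset_refl [simp]:
  assumes "J \<subseteq> S" "I \<subseteq> S" "x \<in> carrier W" shows "x \<in> double_coset J {x} I"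
  using double_coset_iff[OF assms] assms by (metis l_one r_one parabolic_one)

lemma double_coset_eq:
  assumes J: "J \<subseteq> S" "I \<subseteq> S" "x \<in> carrier W" and y: "y \<in> double_coset J {x} I"
  shows "double_coset J {y} I = double_coset J {x} I"
proof -
  have sub: "double_coset J {y} I \<subseteq> double_coset J {x} I"
    if "x \<in> carrier W" "y \<in> double_coset J {x} I" for x y
    using double_coset_mult[OF J(1,2) that] double_coset_iff[OF J(1,2) double_coset_carrier[OF J(1,2) that]]
    by auto
  obtain a b where ab: "a \<in> generate W J" "b \<in> generate W I" "y = a \<otimes> x \<otimes> b"
    using y double_coset_iff[OF J] by auto
  then have "x = inv a \<otimes> y \<otimes> inv b" using J by (simp add: m_assoc)
  then have "x \<in> double_coset J {y} I"
    using ab J double_coset_iff[OF J(1,2) double_coset_carrier[OF J y]]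
      parabolic_inv[of J a] parabolic_inv[of I b] by blast
  then show ?thesis using sub J y double_coset_carrier[OF J y] by blast
qed

lemma double_coset_star:
  assumes J: "J \<subseteq> S" "I \<subseteq> S" "x \<in> carrier W" "a \<in> generate W J" "b \<in> generate W I"
  shows "star a (star x b) \<in> double_coset J {x} I"
proof -
  obtain b' where b': "b' \<in> generate W I" "star x b = x \<otimes> b'"
    using star_parabolic_right[of I b x] assms by auto
  then obtain a' where a': "a' \<in> generate W J" "star a (star x b) = a' \<otimes> (x \<otimes> b')"
    using star_parabolic_left[of J a "x \<otimes> b'"] assms by auto
  have "star a (star x b) = a' \<otimes> x \<otimes> b'" using a' b' J by (simp add: m_assoc)
  then show ?thesis using a' b' double_coset_iff[OF J(1,2,3)] by blast
qed

text \<open>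
  The set of all \<open>y\<close> with \<open>w\<^sub>J * y * w\<^sub>I = x\<close> is stable under multiplication by the generators in \<open>J\<close> and
  \<open>I\<close>: if \<open>sy > y\<close> then \<open>w\<^sub>J * sy = w\<^sub>J * s * y = w\<^sub>J * y\<close>, and the other case is the same with \<open>y\<close> and \<open>sy\<close>
  exchanged.
\<close>
lemma double_coset_star_longest:
  assumes J: "finitary J" "finitary I" "x \<in> carrier W" and y: "y \<in> double_coset J {x} I"
  shows "star (longest J) (star y (longest I)) = star (longest J) (star x (longest I))"
proof -
  have JS: "J \<subseteq> S" "I \<subseteq> S" using J finitary_S by auto
  have l: "star (longest J) (s \<otimes> y) = star (longest J) y" if "s \<in> J" "y \<in> carrier W" for s y
  proof -
    have s: "s \<in> S" "star (longest J) s = longest J"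
      using that JS J longest_full[of J] by (auto simp: star_right_fix rfull_def)
    have "s \<otimes> y = star s y \<or> y = star s (s \<otimes> y)"
      using s that len_S_mult_cases[of s y] by (auto simp: star_left_S)
    moreover have "star (longest J) (star s z) = star (longest J) z" if "z \<in> carrier W" for z
      using s that J by (metis S_carrier longest_carrier star_assoc)
    ultimately show ?thesis using s that by (metis S_carrier m_closed)
  qed
  have r: "star (y \<otimes> s) (longest I) = star y (longest I)" if "s \<in> I" "y \<in> carrier W" for s y
  proof -
    have s: "s \<in> S" "star s (longest I) = longest I"
      using that JS J longest_full[of I] by (auto simp: star_left_fix lfull_def)
    have "y \<otimes> s = star y s \<or> y = star (y \<otimes> s) s"
      using s that len_mult_S_cases[of s y] S_cancel_right[of s y] by (auto simp: star_right_S)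
    moreover have "star (star z s) (longest I) = star z (longest I)" if "z \<in> carrier W" for z
      using s that J by (metis S_carrier longest_carrier star_assoc)
    ultimately show ?thesis using s that by (metis S_carrier m_closed)
  qed
  obtain a b where ab: "a \<in> generate W J" "b \<in> generate W I" "y = a \<otimes> x \<otimes> b"
    using y double_coset_iff[OF JS J(3)] by auto
  have "star (longest J) (a \<otimes> z) = star (longest J) z" if "z \<in> carrier W" for z
    using JS(1) ab(1)
  proof (induction rule: parabolic_induct)
    case (step s a)
    then have "s \<in> S" "a \<in> carrier W" using JS by auto
    then show ?case using l[of s "a \<otimes> z"] step that by (simp add: m_assoc)
  qed (use that in auto)
  moreover have "star (z \<otimes> b) (longest I) = star z (longest I)" if "z \<in> carrier W" for z
    using JS(2) ab(2)
  proof (induction rule: parabolic_induct_right)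
    case (step s b)
    then have "s \<in> S" "b \<in> carrier W" using JS by auto
    then show ?case using r[of s "z \<otimes> b"] step that by (simp flip: m_assoc)
  qed (use that in auto)
  ultimately show ?thesis using ab J JS by (simp flip: star_assoc)
qed

text \<open>
  A Bruhat-maximal element is full, because a simple reflection that raises the length gives a
  larger element of the coset. For a full element \<open>y\<close> of the coset, \<open>y = w\<^sub>J * y * w\<^sub>I\<close>, and the
  right-hand side is the same for all \<open>y\<close>.
\<close>
lemma max_elt_eq:
  assumes J: "finitary J" "finitary I" "x \<in> carrier W" and full: "lfull J x" "rfull x I"
  shows "max_elt (double_coset J {x} I) = x"
proof -
  have JS: "J \<subseteq> S" "I \<subseteq> S" using J finitary_S by auto
  have fix': "star (longest J) (star y (longest I)) = y"
    if "y \<in> carrier W" "lfull J y" "rfull y I" for y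
    using that lfull_absorb[of J "longest J" y] rfull_absorb[of I "longest I" y] JS J longest_mem by simp
  have le: "len y \<le> len x" if y: "y \<in> double_coset J {x} I" for y
  proof -
    have "y \<in> carrier W" using y JS J double_coset_carrier by blast
    then have "len y \<le> len (star (longest J) (star y (longest I)))"
      using star_len_left[of "longest J" "star y (longest I)"] star_len_right[of y "longest I"] J by fastforce
    then show ?thesis using double_coset_star_longest[OF J y] fix'[OF J(3) full] by simp
  qed
  show ?thesis unfolding max_elt_def
  proof (rule the_equality)
    show "x \<in> double_coset J {x} I \<and> \<not> (\<exists>y \<in> double_coset J {x} I. bruhat_less x y)"
      using le JS J by (fastforce dest: bruhat_less_len)
  next
    fix y assume y: "y \<in> double_coset J {x} I \<and> \<not> (\<exists>z \<in> double_coset J {x} I. bruhat_less y z)"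
    then have yc: "y \<in> carrier W" using JS J double_coset_carrier by blast
    have "len (s \<otimes> y) < len y" if "s \<in> J" for s
    proof (rule ccontr)
      assume "\<not> ?thesis"
      then have "bruhat_less y (s \<otimes> y)"
        using len_S_mult_cases[of s y] that JS yc by (intro bruhat_less_left) auto
      moreover have "s \<otimes> y \<in> double_coset J {x} I"
        using double_coset_mult[of J I x y s \<one>] JS J y that yc by auto
      ultimately show False using y by blast
    qed
    moreover have "len (y \<otimes> s) < len y" if "s \<in> I" for s
    proof (rule ccontr)
      assume "\<not> ?thesis"
      then have "bruhat_less y (y \<otimes> s)"
        using len_mult_S_cases[of s y] that JS yc by (intro bruhat_less_right) auto
      moreover have "y \<otimes> s \<in> double_coset J {x} I"
        using double_coset_mult[of J I x y \<one> s] JS J y that yc by auto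
      ultimately show False using y by blast
    qed
    ultimately have "lfull J y" "rfull y I" by (auto simp: lfull_def rfull_def)
    then show "y = x"
      using fix'[of y] fix'[of x] yc J full double_coset_star_longest[of J I x y] y by auto
  qed
qed

lemma append_eq_append_Cons:
  "u @ v = p @ x # q \<Longrightarrow>
    (\<exists>q'. u = p @ x # q' \<and> q = q' @ v) \<or> (\<exists>p'. v = p' @ x # q \<and> p = u @ p')"
  by (auto simp: append_eq_append_conv2 append_eq_Cons_conv)

text \<open>
  The elements with such a factorization contain \<open>m\<close> and are stable under multiplication by
  generators of \<open>J\<close> and \<open>I\<close>: if the length drops, the exchange condition deletes a letter of the
  concatenated reduced words, and that letter is not one of \<open>m\<close>.
\<close>
lemma double_coset_shortest_factor:
  assumes J: "J \<subseteq> S" "I \<subseteq> S" "m \<in> carrier W"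
    and short: "\<And>y. y \<in> double_coset J {m} I \<Longrightarrow> len m \<le> len y"
    and y: "y \<in> double_coset J {m} I"
  shows "\<exists>a \<in> generate W J. \<exists>b \<in> generate W I. y = a \<otimes> m \<otimes> b \<and> len y = len a + len m + len b"
proof -
  let ?U = "\<lambda>y. \<exists>a \<in> generate W J. \<exists>b \<in> generate W I. y = a \<otimes> m \<otimes> b \<and> len y = len a + len m + len b"
  have U_intro: "?U y" if "a \<in> generate W J" "b \<in> generate W I" "y = a \<otimes> m \<otimes> b"
    "len a + len m + len b \<le> len y" for a b y
  proof -
    have "len y \<le> len (a \<otimes> m) + len b" "len (a \<otimes> m) \<le> len a + len m"
      using that J by (auto intro!: len_mult)
    then show ?thesis using that by (intro bexI[of _ a] bexI[of _ b]) auto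
  qed
  obtain vm where vm: "set vm \<subseteq> S" "word_prod vm = m" "length vm = len m"
    using reduced_word_exists J by blast
  have deletion: "?U w"
    if va: "set va \<subseteq> J" and vb: "set vb \<subseteq> I" and del: "va @ vm @ vb = p @ x # q"
      and w: "w = word_prod (p @ q)" "length va + length vm + length vb \<le> Suc (len w)"
      and wd: "w \<in> double_coset J {m} I" for va vb p x q w
  proof -
    have c: "word_prod (u @ vm @ v) = word_prod u \<otimes> m \<otimes> word_prod v"
        if "set u \<subseteq> J" "set v \<subseteq> I" for u v
    proof -
      have "set u \<subseteq> S" "set v \<subseteq> S" using that J by auto
      then show ?thesis using vm by (simp add: word_prod_append_S m_assoc J)
    qed
    have g: "word_prod u \<in> generate W K" "len (word_prod u) \<le> length u"
      if "set u \<subseteq> K" "K \<subseteq> S" for u K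
      using that generate_words[of K] by (auto intro!: imageI len_le)
    consider q' where "va = p @ x # q'" "q = q' @ vm @ vb"
      | p' q' where "vm = p' @ x # q'" "p = va @ p'" "q = q' @ vb"
      | p' where "vb = p' @ x # q" "p = va @ vm @ p'"
      using append_eq_append_Cons[OF del] append_eq_append_Cons by (metis append_assoc)
    then show ?thesis
    proof cases
      case 1
      then have "w = word_prod (p @ q') \<otimes> m \<otimes> word_prod vb" "set (p @ q') \<subseteq> J"
        using c[of "p @ q'" vb] w va vb by auto
      then show ?thesis using g[of "p @ q'" J] g[of vb I] 1 w vb vm J by (intro U_intro) auto
    next
      case 2
      let ?m = "word_prod (p' @ q')"
      have m': "set (p' @ q') \<subseteq> S" using 2 vm by auto
      have "set va \<subseteq> S" "set vb \<subseteq> S" using va vb J by auto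
      then have weq: "w = word_prod va \<otimes> ?m \<otimes> word_prod vb"
        using 2 w m' by (simp add: word_prod_append_S m_assoc)
      have ab: "word_prod va \<in> generate W J" "word_prod vb \<in> generate W I"
        using g va vb J by auto
      then have "?m = inv (word_prod va) \<otimes> w \<otimes> inv (word_prod vb)"
        using weq m' J by (simp add: m_assoc)
      then have "?m \<in> double_coset J {m} I"
        using double_coset_mult[OF J wd] ab J by simp
      moreover have "length (p' @ q') < len m" using 2 vm by auto
      ultimately show ?thesis using short[of ?m] len_le[OF m'] by simp
    next
      case 3
      then have "w = word_prod va \<otimes> m \<otimes> word_prod (p' @ q)" "set (p' @ q) \<subseteq> I"
        using c[of va "p' @ q"] w va vb by auto
      then show ?thesis using g[of "p' @ q" I] g[of va J] 3 w va vm J by (intro U_intro) auto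
    qed
  qed
  have words: "\<exists>va vb. set va \<subseteq> J \<and> set vb \<subseteq> I \<and> word_prod va = a \<and> word_prod vb = b \<and>
      length va = len a \<and> length vb = len b \<and> set (va @ vm @ vb) \<subseteq> S \<and>
      word_prod (va @ vm @ vb) = a \<otimes> m \<otimes> b"
    if ga: "a \<in> generate W J" and gb: "b \<in> generate W I" for a b
  proof -
    obtain va where va: "set va \<subseteq> J" "word_prod va = a" "length va = len a"
      using parabolic_reduced_word[OF J(1) ga] by blast
    obtain vb where vb: "set vb \<subseteq> I" "word_prod vb = b" "length vb = len b"
      using parabolic_reduced_word[OF J(2) gb] by blast
    note v = va vb
    then have "set va \<subseteq> S" "set vb \<subseteq> S" using J by auto
    then show ?thesis using v vm J
      by (intro exI[of _ va] exI[of _ vb]) (auto simp: word_prod_append_S m_assoc)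
  qed
  have left: "?U (s \<otimes> y)" if U: "?U y" and s: "s \<in> J" for s y
  proof -
    from U obtain a b where ab: "a \<in> generate W J" "b \<in> generate W I" "y = a \<otimes> m \<otimes> b"
      "len y = len a + len m + len b" by blast
    have c: "a \<in> carrier W" "b \<in> carrier W" "s \<in> S" "y \<in> carrier W" using ab s J by auto
    show ?thesis
    proof (cases "len (s \<otimes> y) < len y")
      case True
      obtain va vb where v: "set va \<subseteq> J" "set vb \<subseteq> I" "length va = len a" "length vb = len b"
        "set (va @ vm @ vb) \<subseteq> S" "word_prod (va @ vm @ vb) = y"
        using words[OF ab(1,2)] ab(3) by blast
      then obtain p x q where "va @ vm @ vb = p @ x # q" "s \<otimes> y = word_prod (p @ q)"
        using exchange[of "va @ vm @ vb" s] True c by metis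
      moreover have "s \<otimes> y \<in> double_coset J {m} I"
        unfolding double_coset_iff[OF J] using ab s c J
        by (intro bexI[of _ "s \<otimes> a"] bexI[of _ b]) (simp_all add: m_assoc)
      ultimately show ?thesis
        using v ab vm len_S_mult_cases[of s y] c by (intro deletion[of va vb p x q]) auto
    next
      case False
      then have "len (s \<otimes> y) = Suc (len y)" using len_S_mult_cases[of s y] c by auto
      moreover have "len (s \<otimes> a) \<le> Suc (len a)" using len_mult_S_le[of s a] c by auto
      ultimately show ?thesis using ab c s J by (intro U_intro[of "s \<otimes> a" b]) (auto simp: m_assoc)
    qed
  qed
  have right: "?U (y \<otimes> s)" if U: "?U y" and s: "s \<in> I" for s y
  proof -
    from U obtain a b where ab: "a \<in> generate W J" "b \<in> generate W I" "y = a \<otimes> m \<otimes> b"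
      "len y = len a + len m + len b" by blast
    have c: "a \<in> carrier W" "b \<in> carrier W" "s \<in> S" "y \<in> carrier W" using ab s J by auto
    show ?thesis
    proof (cases "len (y \<otimes> s) < len y")
      case True
      obtain va vb where v: "set va \<subseteq> J" "set vb \<subseteq> I" "length va = len a" "length vb = len b"
        "set (va @ vm @ vb) \<subseteq> S" "word_prod (va @ vm @ vb) = y"
        using words[OF ab(1,2)] ab(3) by blast
      then obtain p x q where "va @ vm @ vb = p @ x # q" "y \<otimes> s = word_prod (p @ q)"
        using exchange_right[of "va @ vm @ vb" s] True c by metis
      moreover have "y \<otimes> s \<in> double_coset J {m} I"
        unfolding double_coset_iff[OF J] using ab s c J
        by (intro bexI[of _ a] bexI[of _ "b \<otimes> s"]) (simp_all add: m_assoc)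
      ultimately show ?thesis
        using v ab vm len_mult_S_cases[of s y] c by (intro deletion[of va vb p x q]) auto
    next
      case False
      then have "len (y \<otimes> s) = Suc (len y)" using len_mult_S_cases[of s y] c by auto
      moreover have "len (b \<otimes> s) \<le> Suc (len b)" using len_mult_S_cases[of s b] c by auto
      ultimately show ?thesis using ab c s J by (intro U_intro[of a "b \<otimes> s"]) (auto simp: m_assoc)
    qed
  qed
  obtain a b where ab: "a \<in> generate W J" "b \<in> generate W I" "y = a \<otimes> m \<otimes> b"
    using y double_coset_iff[OF J] by auto
  have "?U (m \<otimes> b)" using J(2) ab(2)
  proof (induction rule: parabolic_induct_right)
    case one
    then show ?case using J by (intro bexI[of _ \<one>]) auto
  next
    case (step s b)
    then show ?case using right[of "m \<otimes> b" s] J by (simp add: m_assoc subset_iff)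
  qed
  moreover have "?U (a \<otimes> z)" if "?U z" "z \<in> carrier W" for z using J(1) ab(1)
  proof (induction rule: parabolic_induct)
    case one
    then show ?case using that by simp
  next
    case (step s a)
    then show ?case using left[of "a \<otimes> z" s] J that(2) by (simp add: m_assoc subset_iff)
  qed
  ultimately show ?thesis using ab J by (simp add: m_assoc)
qed

text \<open>
  Write \<open>m = a n b\<close> with \<open>n\<close> shortest and lengths adding up. A first letter of \<open>a\<close> or a last letter of \<open>b\<close>
  would be a descent of \<open>m\<close>, so \<open>m = n\<close>.
\<close>
lemma minimal_shortest:
  assumes J: "J \<subseteq> S" "I \<subseteq> S" "x \<in> carrier W"
    and m: "m \<in> double_coset J {x} I" "lmin J m" "rmin m I"
    and y: "y \<in> double_coset J {x} I"
  shows "len m \<le> len y" "len m = len y \<Longrightarrow> y = m"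
proof -
  obtain n where n: "n \<in> double_coset J {x} I" "\<forall>y. y \<in> double_coset J {x} I \<longrightarrow> len n \<le> len y"
    using ex_has_least_nat[of "\<lambda>y. y \<in> double_coset J {x} I" m len] m by blast
  have nc: "n \<in> carrier W" using n J double_coset_carrier by blast
  have eq: "double_coset J {n} I = double_coset J {x} I" using double_coset_eq[OF J n(1)] .
  have fac: "\<exists>a \<in> generate W J. \<exists>b \<in> generate W I. z = a \<otimes> n \<otimes> b \<and> len z = len a + len n + len b"
    if "z \<in> double_coset J {x} I" for z
    using double_coset_shortest_factor[OF J(1,2) nc, unfolded eq] n(2) that by blast
  obtain a b where ab: "a \<in> generate W J" "b \<in> generate W I" "m = a \<otimes> n \<otimes> b"
      "len m = len a + len n + len b" using fac[OF m(1)] by blast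
  have c: "a \<in> carrier W" "b \<in> carrier W" using ab J by auto
  have "a = \<one>"
  proof (rule ccontr)
    assume "a \<noteq> \<one>"
    then obtain s v where v: "set (s # v) \<subseteq> J" "word_prod (s # v) = a" "length (s # v) = len a"
      using parabolic_reduced_word[OF J(1) ab(1)]
      by (metis word_prod_simps(1) neq_Nil_conv)
    have vS: "set v \<subseteq> S" "s \<in> S" using v J by auto
    then have "s \<otimes> m = word_prod v \<otimes> n \<otimes> b" using ab(3) v(2) c nc by (auto simp: m_assoc)
    then have "len (s \<otimes> m) \<le> len (word_prod v) + len n + len b"
      using len_mult[of "word_prod v \<otimes> n" b] len_mult[of "word_prod v" n] c nc vS by auto
    then have "len (s \<otimes> m) < len m" using ab(4) v(3) len_le[of v] vS by simp
    then show False using m(2) v by (auto simp: lmin_def)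
  qed
  moreover have "b = \<one>"
  proof (rule ccontr)
    assume "b \<noteq> \<one>"
    then obtain v s where v: "set (v @ [s]) \<subseteq> I" "word_prod (v @ [s]) = b" "length (v @ [s]) = len b"
      using parabolic_reduced_word[OF J(2) ab(2)]
      by (metis word_prod_simps(1) rev_exhaust)
    have vS: "set v \<subseteq> S" "s \<in> S" using v J by auto
    then have "m \<otimes> s = a \<otimes> n \<otimes> word_prod v"
      using ab(3) v(2) c nc by (auto simp: m_assoc word_prod_append_S)
    then have "len (m \<otimes> s) \<le> len a + len n + len (word_prod v)"
      using len_mult[of "a \<otimes> n" "word_prod v"] len_mult[of a n] c nc vS by auto
    then have "len (m \<otimes> s) < len m" using ab(4) v(3) len_le[of v] vS by simp
    then show False using m(3) v by (auto simp: rmin_def)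
  qed
  ultimately have mn: "m = n" using ab nc by simp
  then show "len m \<le> len y" using n y by blast
  assume "len m = len y"
  obtain a' b' where ab': "a' \<in> generate W J" "b' \<in> generate W I" "y = a' \<otimes> n \<otimes> b'"
      "len y = len a' + len n + len b'" using fac[OF y] by blast
  then have "a' = \<one>" "b' = \<one>" using \<open>len m = len y\<close> mn J len_0[of a'] len_0[of b'] by auto
  then show "y = m" using ab' mn nc by simp
qed

lemma min_elt_eq:
  assumes J: "J \<subseteq> S" "I \<subseteq> S" "x \<in> carrier W"
    and m: "m \<in> double_coset J {x} I" "lmin J m" "rmin m I"
  shows "min_elt (double_coset J {x} I) = m"
  unfolding min_elt_def
proof (rule the_equality)
  show "m \<in> double_coset J {x} I \<and> \<not> (\<exists>y \<in> double_coset J {x} I. bruhat_less y m)"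
    using m minimal_shortest(1)[OF J m] by (fastforce dest: bruhat_less_len)
next
  fix y assume y: "y \<in> double_coset J {x} I \<and> \<not> (\<exists>z \<in> double_coset J {x} I. bruhat_less z y)"
  then have yc: "y \<in> carrier W" using J double_coset_carrier by blast
  have "len y < len (s \<otimes> y)" if s: "s \<in> J" for s
  proof (rule ccontr)
    assume "\<not> ?thesis"
    then have "bruhat_less (s \<otimes> y) (s \<otimes> (s \<otimes> y))"
      using len_S_mult_cases[of s y] s J yc by (intro bruhat_less_left) auto
    moreover have "s \<otimes> y \<in> double_coset J {x} I"
      using double_coset_mult[of J I x y s \<one>] J y s yc by auto
    moreover have "s \<otimes> (s \<otimes> y) = y" using s J yc by auto
    ultimately show False using y by auto
  qed
  moreover have "len y < len (y \<otimes> s)" if s: "s \<in> I" for s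
  proof (rule ccontr)
    assume "\<not> ?thesis"
    moreover have "y \<otimes> s \<otimes> s = y" using s J yc S_cancel_right by auto
    ultimately have "bruhat_less (y \<otimes> s) (y \<otimes> s \<otimes> s)"
      using len_mult_S_cases[of s y] s J yc by (intro bruhat_less_right) auto
    moreover have "y \<otimes> s \<in> double_coset J {x} I"
      using double_coset_mult[of J I x y \<one> s] J y s yc by auto
    ultimately show False using y \<open>y \<otimes> s \<otimes> s = y\<close> by auto
  qed
  ultimately have "lmin J y" "rmin y I" by (auto simp: lmin_def rmin_def)
  then show "y = m"
    using minimal_shortest[OF J m, of y] minimal_shortest(1)[OF J, of y m] y m by force
qed

lemma minimal_exists:
  assumes J: "J \<subseteq> S" "I \<subseteq> S" "x \<in> carrier W"
  shows "\<exists>m \<in> double_coset J {x} I. lmin J m \<and> rmin m I"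
proof -
  obtain m where m: "m \<in> double_coset J {x} I" "\<forall>y. y \<in> double_coset J {x} I \<longrightarrow> len m \<le> len y"
    using ex_has_least_nat[of "\<lambda>y. y \<in> double_coset J {x} I" x len] J by auto
  have mc: "m \<in> carrier W" using m J double_coset_carrier by blast
  have "len m < len (s \<otimes> m)" if s: "s \<in> J" for s
  proof -
    have "s \<otimes> m \<in> double_coset J {x} I"
      using double_coset_mult[of J I x m s \<one>] J m s mc by auto
    then show ?thesis using m(2) len_S_mult_cases[of s m] s J mc by fastforce
  qed
  moreover have "len m < len (m \<otimes> s)" if s: "s \<in> I" for s
  proof -
    have "m \<otimes> s \<in> double_coset J {x} I"
      using double_coset_mult[of J I x m \<one> s] J m s mc by auto
    then show ?thesis using m(2) len_mult_S_cases[of s m] s J mc by fastforce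
  qed
  ultimately show ?thesis using m by (auto simp: lmin_def rmin_def)
qed

lemma lmin_additive:
  assumes J: "J \<subseteq> S" "m \<in> carrier W" "lmin J m" "a \<in> generate W J"
  shows "len (a \<otimes> m) = len a + len m"
proof -
  have m: "m \<in> double_coset J {m} {}" "rmin m {}" using J by (auto simp: rmin_def)
  have "a \<otimes> m \<in> double_coset J {m} {}"
    using double_coset_mult[of J "{}" m m a \<one>] J m by simp
  then obtain a' b where a': "a' \<in> generate W J" "b \<in> generate W {}" "a \<otimes> m = a' \<otimes> m \<otimes> b"
      "len (a \<otimes> m) = len a' + len m + len b"
    using double_coset_shortest_factor[of J "{}" m "a \<otimes> m"] J minimal_shortest(1)[of J "{}" m m] m
    by auto
  then have "b = \<one>" by (simp add: generate_empty)
  then have "a \<otimes> m = a' \<otimes> m" using a' J by simp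
  then have "a = a'" using a' J right_cancel[of m a a'] by auto
  then show ?thesis using a' \<open>b = \<one>\<close> by simp
qed

lemma rmin_additive:
  assumes "I \<subseteq> S" "m \<in> carrier W" "rmin m I" "b \<in> generate W I"
  shows "len (m \<otimes> b) = len m + len b"
  using lmin_additive[of I "inv m" "inv b"] assms lmin_inv[of m I] len_inv_mult[of b m]
  by simp

text \<open>
  Write \<open>x = a m\<close> with \<open>m\<close> shortest in \<open>W\<^sub>J x\<close>. By additivity of lengths the descents of \<open>x\<close> in \<open>J\<close> are those
  of \<open>a\<close>, so \<open>a = w\<^sub>J\<close>.
\<close>
lemma lfull_split:
  assumes J: "finitary J" "x \<in> carrier W" "lfull J x"
  shows "lmin J (longest J \<otimes> x)" "len x = len (longest J) + len (longest J \<otimes> x)"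
proof -
  have JS: "J \<subseteq> S" using J finitary_S by auto
  obtain m where m: "m \<in> double_coset J {x} {}" "lmin J m"
    using minimal_exists[of J "{}" x] JS J by auto
  then have mc: "m \<in> carrier W" using double_coset_carrier[of J "{}" x m] JS J by simp
  obtain c where c: "c \<in> generate W J" "m = c \<otimes> x"
    using m(1) double_coset_iff[of J "{}" x m] JS J by (auto simp: generate_empty)
  define a where "a = inv c"
  have a: "a \<in> generate W J" "x = a \<otimes> m" "a \<in> carrier W"
    using c JS J by (auto simp: a_def)
  have "lfull J a" unfolding lfull_def
  proof
    fix s assume s: "s \<in> J"
    then have "len (s \<otimes> a \<otimes> m) < len (a \<otimes> m)"
      using J(3) a JS mc by (auto simp: lfull_def m_assoc subset_iff)
    then show "len (s \<otimes> a) < len a"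
      using lmin_additive[OF JS mc m(2)] s a by simp
  qed
  then have "a = longest J" using a J lfull_longest by auto
  then have "longest J \<otimes> x = m" using a J mc by simp
  then show "lmin J (longest J \<otimes> x)" "len x = len (longest J) + len (longest J \<otimes> x)"
    using m(2) lmin_additive[OF JS mc m(2) a(1)] a \<open>a = longest J\<close> by auto
qed

lemma rfull_split:
  assumes J: "finitary J" "x \<in> carrier W" "rfull x J"
  shows "rmin (x \<otimes> longest J) J" "len x = len (x \<otimes> longest J) + len (longest J)"
proof -
  have eq: "longest J \<otimes> inv x = inv (x \<otimes> longest J)" using J by (simp add: inv_mult_group)
  have "lfull J (inv x)" using J lfull_inv finitary_S by auto
  from lfull_split[OF J(1) _ this] show "rmin (x \<otimes> longest J) J" 
    "len x = len (x \<otimes> longest J) + len (longest J)"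
    unfolding eq using J finitary_S lmin_inv[of "x \<otimes> longest J" J] by auto
qed

section \<open>Evaluation of expressions\<close>

definition star_prod :: "'a set list \<Rightarrow> 'a" where
  "star_prod Is = foldr (\<lambda>I. star (longest I)) Is \<one>"

lemma star_prod_simps [simp]:
  "star_prod [] = \<one>" "star_prod (I # Is) = star (longest I) (star_prod Is)"
  by (simp_all add: star_prod_def)

lemma star_prod_closed [simp]: "\<forall>I \<in> set Is. finitary I \<Longrightarrow> star_prod Is \<in> carrier W"
  by (induction Is) auto

lemma star_prod_append:
  "\<forall>I \<in> set Is. finitary I \<Longrightarrow> \<forall>I \<in> set Js. finitary I \<Longrightarrow>
    star_prod (Is @ Js) = star (star_prod Is) (star_prod Js)"
  by (induction Is) (auto simp: star_assoc)

lemma star_prod_lfull: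
  assumes "\<forall>I \<in> set Is. finitary I" "Is \<noteq> []" shows "lfull (hd Is) (star_prod Is)"
proof (cases Is)
  case (Cons I Js)
  then show ?thesis using assms longest_full[of I] by (auto intro!: lfull_star finitary_S)
qed (use assms in auto)

lemma star_prod_rfull:
  assumes "\<forall>I \<in> set Is. finitary I" "Is \<noteq> []" shows "rfull (star_prod Is) (last Is)"
proof (cases Is rule: rev_cases)
  case (snoc Js I)
  then show ?thesis using assms longest_full[of I]
    by (auto simp: star_prod_append intro!: rfull_star finitary_S)
qed (use assms in auto)

lemma longest_star_self: "finitary I \<Longrightarrow> star (longest I) (longest I) = longest I"
  by (simp add: longest_star_left)

text \<open>
  The representative on the right is full on both sides, hence the maximal element of the coset.
\<close>
lemma gen_double_coset:
  assumes "finitary I" "finitary J"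
  shows "double_coset I {\<one>} J = double_coset I {star (longest I) (longest J)} J"
proof -
  have "star (longest I) (star \<one> (longest J)) \<in> double_coset I {\<one>} J"
    using assms by (intro double_coset_star longest_mem) (auto simp: finitary_S)
  then have "star (longest I) (longest J) \<in> double_coset I {\<one>} J" using assms by simp
  then show ?thesis using assms
    by (intro double_coset_eq[symmetric]) (auto simp only: finitary_S one_closed)
qed

lemma max_elt_star_prod:
  assumes "\<forall>I \<in> set Is. finitary I" "Is \<noteq> []"
  shows "max_elt (double_coset (hd Is) {star_prod Is} (last Is)) = star_prod Is"
  using assms star_prod_lfull star_prod_rfull by (intro max_elt_eq) auto

text \<open>
  The products of longest elements are full on both sides, hence are the maximal elements of their
  cosets, and \<open>w\<^sub>J * w\<^sub>J = w\<^sub>J\<close> absorbs the object at which two expressions are composed.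
\<close>
lemma sc_eval_star_prod:
  assumes "\<forall>I \<in> set Is. finitary I" "Is \<noteq> []"
  shows "sc_eval Is = (hd Is, double_coset (hd Is) {star_prod Is} (last Is), last Is)"
  using assms
proof (induction Is rule: sc_eval.induct)
  case (2 I)
  then show ?case using gen_double_coset[of I I] by (simp add: sc_id_def longest_star_self)
next
  case (3 I J Is)
  have IJ: "max_elt (double_coset I {\<one>} J) = star (longest I) (longest J)"
    using max_elt_star_prod[of "[I, J]"] 3 by (simp add: gen_double_coset)
  have "star (star (longest I) (longest J)) (star_prod (J # Is)) = star_prod (I # J # Is)"
    using 3 longest_star_self[of J] by (simp add: star_assoc) (simp flip: star_assoc)
  then show ?case
    using 3 max_elt_star_prod[of "J # Is"] by (simp add: sc_gen_def IJ)
qed simp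

lemma expression_finitary: "expression Is \<Longrightarrow> \<forall>I \<in> set Is. finitary I"
  by (simp add: expression_def)

lemma expression_nonempty: "expression Is \<Longrightarrow> Is \<noteq> []"
  by (simp add: expression_def)

lemma sc_eval_eq_iff:
  assumes "expression Is" "expression Js"
  shows "sc_eval Is = sc_eval Js \<longleftrightarrow>
    hd Is = hd Js \<and> last Is = last Js \<and> star_prod Is = star_prod Js"
proof -
  note Is = expression_finitary[OF assms(1)] expression_nonempty[OF assms(1)]
  note Js = expression_finitary[OF assms(2)] expression_nonempty[OF assms(2)]
  have "sc_eval Is = sc_eval Js \<Longrightarrow> max_elt (fst (snd (sc_eval Is))) = max_elt (fst (snd (sc_eval Js)))"
    by simp
  then show ?thesis
    unfolding sc_eval_star_prod[OF Is] sc_eval_star_prod[OF Js] fst_conv snd_conv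
      max_elt_star_prod[OF Is] max_elt_star_prod[OF Js] by auto
qed

lemma double_coset_extend:
  assumes "I0 \<subseteq> S" "I \<subseteq> I'" "I' \<subseteq> S" "x \<in> carrier W"
  shows "double_coset I0 (double_coset I0 {x} I) I' = double_coset I0 {x} I'"
proof -
  have I: "I \<subseteq> S" using assms by auto
  have sub: "generate W I \<subseteq> generate W I'" using assms by (intro mono_generate)
  have "y \<in> double_coset I0 (double_coset I0 {x} I) I' \<longleftrightarrow>
     (\<exists>a \<in> generate W I0. \<exists>z \<in> double_coset I0 {x} I. \<exists>b \<in> generate W I'. y = a \<otimes> z \<otimes> b)" for y
    unfolding double_coset_def[of I0 "double_coset I0 {x} I" I'] set_mult_def by auto
  moreover have "(\<exists>a \<in> generate W I0. \<exists>z \<in> double_coset I0 {x} I. \<exists>b \<in> generate W I'. y = a \<otimes> z \<otimes> b) \<longleftrightarrow>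
     y \<in> double_coset I0 {x} I'" for y
  proof
    assume "\<exists>a \<in> generate W I0. \<exists>z \<in> double_coset I0 {x} I. \<exists>b \<in> generate W I'. y = a \<otimes> z \<otimes> b"
    then obtain a z b where *: "a \<in> generate W I0" "z \<in> double_coset I0 {x} I" "b \<in> generate W I'"
      "y = a \<otimes> z \<otimes> b" by blast
    have "z \<in> double_coset I0 {x} I'"
      using *(2) sub unfolding double_coset_iff[OF assms(1) I assms(4)]
        double_coset_iff[OF assms(1,3,4)] by blast
    then show "y \<in> double_coset I0 {x} I'" using * assms double_coset_mult by blast
  next
    assume "y \<in> double_coset I0 {x} I'"
    then obtain a b where "a \<in> generate W I0" "b \<in> generate W I'" "y = a \<otimes> x \<otimes> b"
      using double_coset_iff[OF assms(1,3,4)] by blast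
    moreover have "x \<in> double_coset I0 {x} I" using assms I by simp
    ultimately show "\<exists>a \<in> generate W I0. \<exists>z \<in> double_coset I0 {x} I. \<exists>b \<in> generate W I'. y = a \<otimes> z \<otimes> b"
      by blast
  qed
  ultimately show ?thesis by blast
qed

lemma double_coset_star_right:
  assumes "I0 \<subseteq> S" "finitary I" "x \<in> carrier W"
  shows "double_coset I0 {star x (longest I)} I = double_coset I0 {x} I"
proof -
  have "star \<one> (star x (longest I)) \<in> double_coset I0 {x} I"
    using assms longest_mem finitary_S by (intro double_coset_star) auto
  then have "star x (longest I) \<in> double_coset I0 {x} I" using assms by simp
  then show ?thesis using assms by (intro double_coset_eq) (auto simp only: finitary_S)
qed

text \<open>
  Unlike the evaluation, the forward path enlarges or shrinks the coset only on the right; both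
  kinds of steps multiply the maximal element by the next longest element.
\<close>
lemma forward_path_star_prod:
  assumes "\<forall>I \<in> set Is. finitary I" "i < length Is"
  shows "forward_path Is i = double_coset (Is ! 0) {star_prod (take (Suc i) Is)} (Is ! i)"
  using assms(2)
proof (induction i)
  case 0
  then have "take (Suc 0) Is = [Is ! 0]" by (cases Is) auto
  then show ?case using assms 0 gen_double_coset[of "Is ! 0" "Is ! 0"]
    by (simp add: longest_star_self)
next
  case (Suc i)
  let ?x = "star_prod (take (Suc i) Is)"
  have fin: "finitary (Is ! j)" if "j < length Is" for j
    using assms(1) nth_mem[OF that] by blast
  have "0 < length Is" "i < length Is" using Suc.prems by linarith+
  note f = fin[OF this(1)] fin[OF this(2)] fin[OF Suc.prems]
  have f4: "\<forall>I \<in> set (take (Suc i) Is). finitary I"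
    using assms(1) by (blast dest: in_set_takeD)
  note f = f f4
  then have x: "?x \<in> carrier W" by simp
  have "star_prod (take (Suc (Suc i)) Is) = star ?x (longest (Is ! Suc i))"
    using Suc.prems f by (simp add: take_Suc_conv_app_nth[of "Suc i"] star_prod_append)
  then have eq: "double_coset (Is ! 0) {star_prod (take (Suc (Suc i)) Is)} (Is ! Suc i) =
      double_coset (Is ! 0) {?x} (Is ! Suc i)"
    using double_coset_star_right[of "Is ! 0" "Is ! Suc i" ?x] f x finitary_S by simp
  show ?case
  proof (cases "Is ! i \<subset> Is ! Suc i")
    case True
    then show ?thesis using Suc f x eq by (simp add: double_coset_extend finitary_S)
  next
    case False
    have hl: "hd (take (Suc i) Is) = Is ! 0" "last (take (Suc i) Is) = Is ! i" "take (Suc i) Is \<noteq> []"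
      using Suc.prems by (auto simp: take_Suc_conv_app_nth hd_append hd_conv_nth)
    then have "max_elt (forward_path Is i) = ?x"
      using max_elt_star_prod[of "take (Suc i) Is"] f Suc by simp
    then show ?thesis using False eq by simp
  qed
qed

end

section \<open>Rotation sequences\<close>

text \<open>
  The data \<open>(J, s, t)\<close> of a rotation sequence are encoded by \<open>M = Js\<close> and the two initial values
  \<open>u(0) = s\<close> and \<open>u(-1) = w\<^sub>M t w\<^sub>M\<close>, since these two play symmetric roles in the recursion.
\<close>
locale rotation = coxeter_system W S for W (structure) and S +
  fixes M :: "'a set" and u :: "int \<Rightarrow> 'a"
  assumes fin_M: "finitary M"
    and u_start: "u 0 \<in> M" "u (-1) \<in> M" "u 0 \<noteq> u (-1)"
    and u_step: "\<And>i. u (i + 1) = longest (M - {u i}) \<otimes> u (i - 1) \<otimes> longest (M - {u i})"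
begin

abbreviation I :: "nat \<Rightarrow> 'a set" where "I k \<equiv> M - {u (int k)}"

abbreviation L :: "nat \<Rightarrow> 'a set" where "L k \<equiv> M - {u (int k), u (int k - 1)}"

text \<open>
  The maximal element after \<open>k\<close> rounds of the rotation. It increases strictly until it equals the
  longest element of \<open>W\<^sub>M\<close>.
\<close>
definition a :: "nat \<Rightarrow> 'a" where "a k = star_prod (rotation_expression M u k)"

lemma M_S [simp]: "x \<in> M \<Longrightarrow> x \<in> S"
  using finitary_S[OF fin_M] by auto

lemma fin_sub [simp]: "finitary (M - A)"
  by (rule finitary_subset[OF fin_M]) auto

lemma sub_S: "M - A \<subseteq> S" "M \<subseteq> S"
  by auto

lemma u_mem: "u (int k) \<in> M \<and> u (int k - 1) \<in> M \<and> u (int k) \<noteq> u (int k - 1)"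
proof (induction k)
  case 0
  then show ?case using u_start by simp
next
  case (Suc k)
  have "longest (I k) \<otimes> u (int k - 1) \<otimes> longest (I k) \<in> I k"
    using Suc by (intro longest_conj) auto
  then have "u (int k + 1) \<in> I k" using u_step[of "int k"] by simp
  then show ?case using Suc by (auto simp: add.commute)
qed

text \<open>
  Conjugation by \<open>w(I(k))\<close> permutes \<open>I(k)\<close> and exchanges \<open>u(k-1)\<close> with \<open>u(k+1)\<close>.
\<close>
lemma rotation_conj:
  assumes "x \<in> L (Suc k)" shows "longest (I k) \<otimes> x \<otimes> longest (I k) \<in> L k"
proof -
  have x: "x \<in> I k" "x \<in> carrier W" "x \<noteq> u (int k + 1)" using assms by (auto simp: add.commute)
  have "longest (I k) \<otimes> x \<otimes> longest (I k) \<noteq> u (int k - 1)"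
    using x longest_conj_inj[of "I k" x] u_step[of "int k"] by auto
  then show ?thesis using longest_conj[OF _ x(1)] by auto
qed

lemma rotation_expression_0: "rotation_expression M u 0 = [I 0]"
  by (simp add: rotation_expression_def)

lemma rotation_expression_Suc:
  "rotation_expression M u (Suc k) = rotation_expression M u k @ [L (Suc k), I (Suc k)]"
  by (simp add: rotation_expression_def upto_rec2)

lemma rotation_expression_finitary: "\<forall>J \<in> set (rotation_expression M u k). finitary J"
  by (induction k) (auto simp: rotation_expression_0 rotation_expression_Suc)

lemma rotation_expression_hd: "hd (rotation_expression M u k) = I 0"
  by (simp add: rotation_expression_def)

lemma rotation_expression_nonempty [simp]: "rotation_expression M u k \<noteq> []"
  by (simp add: rotation_expression_def)

lemma rotation_expression_last: "last (rotation_expression M u k) = I k"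
  by (cases k) (auto simp: rotation_expression_0 rotation_expression_Suc)

lemma length_rotation_expression: "length (rotation_expression M u k) = 2 * k + 1"
  by (induction k) (auto simp: rotation_expression_0 rotation_expression_Suc)

lemma take_rotation_expression:
  "j \<le> k \<Longrightarrow> take (2 * j + 1) (rotation_expression M u k) = rotation_expression M u j"
proof (induction k)
  case (Suc k)
  then show ?case
    by (cases "j = Suc k") (auto simp: rotation_expression_Suc length_rotation_expression)
qed (simp add: rotation_expression_0)

lemma nth_rotation_expression:
  "j \<le> k \<Longrightarrow> rotation_expression M u k ! (2 * j) = I j"
  "j < k \<Longrightarrow> rotation_expression M u k ! (2 * j + 1) = L (Suc j)"
proof -
  show even: "rotation_expression M u k ! (2 * j) = I j" if "j \<le> k" for k
  proof -
    have "rotation_expression M u k ! (2 * j) = last (take (2 * j + 1) (rotation_expression M u k))"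
      using that by (simp add: take_Suc_conv_app_nth length_rotation_expression)
    then show ?thesis using take_rotation_expression[OF that] rotation_expression_last by simp
  qed
  show "rotation_expression M u k ! (2 * j + 1) = L (Suc j)" if "j < k"
  proof -
    have "rotation_expression M u k ! (2 * j + 1) =
        take (2 * Suc j + 1) (rotation_expression M u k) ! (2 * j + 1)"
      by simp
    also have "\<dots> = L (Suc j)"
      unfolding take_rotation_expression[OF Suc_leI[OF that]]
      by (simp add: rotation_expression_Suc nth_append length_rotation_expression)
    finally show ?thesis .
  qed
qed

lemma L_Suc: "L (Suc k) = I k - {u (int (Suc k))}" "I (Suc k) = insert (u (int k)) (L (Suc k))"
  using u_mem[of k] u_mem[of "Suc k"] by auto

lemma expression_rotation: "expression (rotation_expression M u k)"
proof -
  have "successively adjacent (rotation_expression M u k)"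
  proof (induction k)
    case (Suc k)
    have u: "u (int (Suc k)) \<in> I k" "u (int k) \<notin> L (Suc k)" "u (int k) \<in> S" "u (int (Suc k)) \<in> S"
      using u_mem[of "Suc k"] u_mem[of k] by auto
    have "adjacent (I k) (L (Suc k))"
      unfolding adjacent_def using u(1,4) L_Suc(1) by blast
    moreover have "adjacent (L (Suc k)) (I (Suc k))"
      unfolding adjacent_def using u(2,3) L_Suc(2) by blast
    ultimately show ?case using Suc
      by (simp add: rotation_expression_Suc successively_append_iff rotation_expression_last)
  qed (simp add: rotation_expression_0)
  then show ?thesis using rotation_expression_finitary by (simp add: expression_def)
qed

lemma a_0: "a 0 = longest (I 0)"
  by (simp add: a_def rotation_expression_0)

lemma a_closed [simp]: "a k \<in> carrier W"
  using rotation_expression_finitary by (simp add: a_def)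

lemma a_Suc: "a (Suc k) = star (a k) (longest (I (Suc k)))"
proof -
  have "star (longest (L (Suc k))) (longest (I (Suc k))) = longest (I (Suc k))"
    by (rule longest_star_left) auto
  then show ?thesis
    using rotation_expression_finitary
    by (simp add: a_def rotation_expression_Suc star_prod_append)
qed

lemma a_lfull: "lfull (I 0) (a k)"
  using star_prod_lfull[OF rotation_expression_finitary, of k]
  by (simp add: a_def rotation_expression_hd)

lemma a_rfull: "rfull (a k) (I k)"
  using star_prod_rfull[OF rotation_expression_finitary, of k]
  by (simp add: a_def rotation_expression_last)

lemma sub_M: "x \<in> generate W (M - A) \<Longrightarrow> x \<in> generate W M"
  using mono_generate[of "M - A" M] by auto

lemma a_M: "a k \<in> generate W M"
proof (induction k)
  case 0
  show ?case unfolding a_0 by (rule sub_M[OF longest_mem[OF fin_sub]])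
next
  case (Suc k)
  then show ?case unfolding a_Suc
    by (rule star_in_parabolic[OF sub_S(2) _ sub_M[OF longest_mem[OF fin_sub]]])
qed

text \<open>
  The element \<open>a(k)\<close> is full for \<open>I(k) = M - {u(k)}\<close>; a descent at \<open>u(k)\<close> would make it full for \<open>M\<close>.
\<close>
lemma a_up:
  assumes "a k \<noteq> longest M" shows "len (a k) < len (a k \<otimes> u (int k))"
proof (rule ccontr)
  assume "\<not> ?thesis"
  then have "len (a k \<otimes> u (int k)) < len (a k)"
    using len_mult_S_cases[of "u (int k)" "a k"] u_mem[of k] by auto
  then have "rfull (a k) M" using a_rfull[of k] by (auto simp: rfull_def)
  then show False using rfull_longest[OF fin_M a_M] assms by simp
qed

lemma a_less: assumes "a k \<noteq> longest M" shows "len (a k) < len (a (Suc k))"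
proof -
  have "a (Suc k) \<noteq> a k"
    using a_up[OF assms] a_rfull[of "Suc k"] unfolding rfull_def L_Suc(2)[of k]
    by (metis insertI1 not_less_iff_gr_or_eq)
  then show ?thesis using star_len_right[of "a k" "longest (I (Suc k))"] by (simp add: a_Suc)
qed

definition conj_into :: "'a \<Rightarrow> 'a set \<Rightarrow> 'a set \<Rightarrow> bool" where
  "conj_into d A B \<longleftrightarrow> (\<forall>x \<in> A. d \<otimes> x \<otimes> inv d \<in> B)"

lemma conj_into_mult:
  assumes "d \<in> carrier W" "e \<in> carrier W" "A \<subseteq> carrier W" "conj_into e A B" "conj_into d B C"
  shows "conj_into (d \<otimes> e) A C"
  unfolding conj_into_def
proof
  fix x assume x: "x \<in> A"
  then have "(d \<otimes> e) \<otimes> x \<otimes> inv (d \<otimes> e) = d \<otimes> (e \<otimes> x \<otimes> inv e) \<otimes> inv d"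
    using assms by (simp add: inv_mult_group m_assoc subset_iff)
  then show "(d \<otimes> e) \<otimes> x \<otimes> inv (d \<otimes> e) \<in> C" using assms x by (simp add: conj_into_def)
qed

text \<open>Conjugating a reduced word letter by letter does not make it longer.\<close>
lemma conj_into_parabolic:
  assumes d: "d \<in> carrier W" and AB: "A \<subseteq> S" "B \<subseteq> S" and conj: "conj_into d A B"
    and g: "g \<in> generate W A"
  shows "\<exists>h \<in> generate W B. d \<otimes> g = h \<otimes> d \<and> len h \<le> len g"
proof -
  have *: "\<exists>v. set v \<subseteq> B \<and> length v = length ws \<and> d \<otimes> word_prod ws = word_prod v \<otimes> d"
    if "set ws \<subseteq> A" for ws
    using that
  proof (induction ws)
    case Nil
    then show ?case using d by (intro exI[of _ "[]"]) auto
  next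
    case (Cons s ws)
    then obtain v where v: "set v \<subseteq> B" "length v = length ws" "d \<otimes> word_prod ws = word_prod v \<otimes> d"
      by auto
    have s: "s \<in> S" "set ws \<subseteq> S" "set v \<subseteq> S" using Cons.prems v AB by auto
    have "d \<otimes> word_prod (s # ws) = (d \<otimes> s \<otimes> inv d) \<otimes> (d \<otimes> word_prod ws)"
      using s d by (simp add: m_assoc)
    also have "\<dots> = word_prod ((d \<otimes> s \<otimes> inv d) # v) \<otimes> d"
      using s d by (simp add: v m_assoc)
    finally show ?case using v conj Cons.prems
      by (intro exI[of _ "(d \<otimes> s \<otimes> inv d) # v"]) (auto simp: conj_into_def)
  qed
  obtain ws where ws: "set ws \<subseteq> A" "word_prod ws = g" "length ws = len g"
    using parabolic_reduced_word[OF AB(1) g] by blast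
  obtain v where v: "set v \<subseteq> B" "length v = length ws" "d \<otimes> g = word_prod v \<otimes> d"
    using *[OF ws(1)] ws(2) by auto
  have "word_prod v \<in> generate W B" using v(1) generate_words[OF AB(2)] by (auto intro!: imageI)
  moreover have "len (word_prod v) \<le> len g" using len_le[of v] v AB ws by auto
  ultimately show ?thesis using v(3) by blast
qed

text \<open>
  The invariant that drives the rotation. In geometric terms, the path stays on the circle fixed
  by \<open>W(L(0))\<close> in the Coxeter complex of \<open>W\<^sub>M\<close>, and runs through one half of it.
\<close>
abbreviation transports :: "nat \<Rightarrow> bool" where "transports k \<equiv> conj_into (a k) (L (Suc k)) (L 0)"

text \<open>
  The shortest element of \<open>a(k) W(L(k+1))\<close>, by \<open>d_rmin_L\<close>.
\<close>
definition d :: "nat \<Rightarrow> 'a" where "d k = a k \<otimes> longest (L (Suc k))"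

lemma d_closed [simp]: "d k \<in> carrier W"
  by (simp add: d_def)

lemma L_carrier: "M - A \<subseteq> carrier W"
  using sub_S generators_closed by auto

lemma conj_into_longest: "conj_into (longest (M - A)) (M - A) (M - A)"
  unfolding conj_into_def using longest_conj[of "M - A"] by simp

lemma rotation_conj_into: "conj_into (longest (I k)) (L (Suc k)) (L k)"
  unfolding conj_into_def using rotation_conj[of _ k] by simp

lemma transports_0: "transports 0"
  using rotation_conj_into[of 0] by (simp add: a_0)

lemma a_rfull_L: "rfull (a k) (L (Suc k))"
  using a_rfull[of k] by (auto simp: rfull_def)

lemma d_rmin_L: "rmin (d k) (L (Suc k))" and len_a_d: "len (a k) = len (d k) + len (longest (L (Suc k)))"
  using rfull_split[OF _ a_closed a_rfull_L] by (auto simp: d_def)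

lemma a_d: "a k = d k \<otimes> longest (L (Suc k))"
  by (simp add: d_def m_assoc)

lemma d_conj: "transports k \<Longrightarrow> conj_into (d k) (L (Suc k)) (L 0)"
  unfolding d_def by (rule conj_into_mult[OF _ _ L_carrier conj_into_longest]) auto

text \<open>
  Since conjugation by \<open>d(k)\<close> maps \<open>L(k+1)\<close> into \<open>L(0)\<close>, the longest element in \<open>a(k) = d(k) w(L(k+1))\<close>
  can be moved to the left.
\<close>
lemma a_left_factor:
  assumes "transports k"
  shows "\<exists>g \<in> generate W (L 0). a k = g \<otimes> d k \<and> len g \<le> len (longest (L (Suc k)))"
  using conj_into_parabolic[OF d_closed sub_S(1) sub_S(1) d_conj[OF assms] longest_mem[OF fin_sub]]
  by (metis a_d)

text \<open>
  If \<open>u(k)\<close> shortened \<open>d(k)\<close>, then it would shorten \<open>a(k) = g d(k)\<close> as well, because the lengths of \<open>g\<close>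
  and \<open>d(k)\<close> add up.
\<close>
lemma d_up:
  assumes "transports k" "a k \<noteq> longest M"
  shows "len (d k) < len (d k \<otimes> u (int k))"
proof (rule ccontr)
  assume "\<not> ?thesis"
  then have less: "len (d k \<otimes> u (int k)) < len (d k)"
    using len_mult_S_cases[of "u (int k)" "d k"] u_mem[of k] by auto
  obtain g where g: "g \<in> generate W (L 0)" "a k = g \<otimes> d k" "len g \<le> len (longest (L (Suc k)))"
    using a_left_factor[OF assms(1)] by blast
  have gc: "g \<in> carrier W" using g(1) sub_S parabolic_closed by blast
  have "len (a k \<otimes> u (int k)) \<le> len g + len (d k \<otimes> u (int k))"
    using len_mult[of g "d k \<otimes> u (int k)"] g gc u_mem[of k] by (simp add: m_assoc)
  also have "\<dots> < len (a k)" using less g(3) len_a_d[of k] by simp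
  finally show False using a_up[OF assms(2)] by simp
qed

lemma d_rmin:
  assumes "transports k" "a k \<noteq> longest M"
  shows "rmin (d k) (I (Suc k))"
  using d_rmin_L[of k] d_up[OF assms] unfolding L_Suc(2) by (auto simp: rmin_def)

text \<open>
  The factor \<open>w(L(k+1))\<close> of \<open>a(k) = d(k) * w(L(k+1))\<close> is absorbed by \<open>w(I(k+1))\<close>, and \<open>d(k)\<close> is minimal
  for \<open>I(k+1)\<close>.
\<close>
lemma a_Suc_d:
  assumes "transports k" "a k \<noteq> longest M"
  shows "a (Suc k) = d k \<otimes> longest (I (Suc k))"
proof -
  have "len (d k \<otimes> longest (L (Suc k))) = len (d k) + len (longest (L (Suc k)))"
    using len_a_d[of k] a_d by simp
  then have "a k = star (d k) (longest (L (Suc k)))"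
    using a_d by (simp add: star_additive)
  then have "a (Suc k) = star (d k) (longest (I (Suc k)))"
    using longest_star_left[of "I (Suc k)" "L (Suc k)"]
    by (simp add: a_Suc star_assoc subset_iff)
  also have "\<dots> = d k \<otimes> longest (I (Suc k))"
    using rmin_additive[OF _ _ d_rmin[OF assms] longest_mem] sub_S by (intro star_additive) auto
  finally show ?thesis .
qed

lemma transports_Suc:
  assumes "transports k" "a k \<noteq> longest M"
  shows "transports (Suc k)"
  unfolding a_Suc_d[OF assms]
  by (rule conj_into_mult[OF _ _ L_carrier rotation_conj_into d_conj[OF assms(1)]]) auto

definition N :: nat where "N = (LEAST k. a k = longest M)"

lemma a_N: "a N = longest M"
proof -
  have "\<exists>k. a k = longest M"
  proof (rule ccontr)
    assume no: "\<nexists>k. a k = longest M"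
    have "k \<le> len (a k)" for k
    proof (induction k)
      case (Suc k)
      then show ?case using a_less[of k] no by auto
    qed simp
    from this[of "Suc (len (longest M))"] longest_max[OF fin_M a_M] show False
      by (meson not_less_eq_eq order_trans)
  qed
  then show ?thesis unfolding N_def by (rule LeastI_ex)
qed

lemma a_before_N: "k < N \<Longrightarrow> a k \<noteq> longest M"
  unfolding N_def by (rule not_less_Least)

lemma transports_upto_N: "k \<le> N \<Longrightarrow> transports k"
proof (induction k)
  case 0
  show ?case by (rule transports_0)
next
  case (Suc k)
  then show ?case using transports_Suc[of k] a_before_N[of k] by simp
qed

text \<open>
  In rank two, where \<open>w(I(0))\<close> has length 1, this bounds the number of letters that a switchback
  produces.
\<close>
lemma N_len: "N + len (longest (I 0)) \<le> len (longest M)"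
proof -
  have "k \<le> N \<Longrightarrow> k + len (longest (I 0)) \<le> len (a k)" for k
  proof (induction k)
    case (Suc k)
    then show ?case using a_less[of k] a_before_N[of k] by auto
  qed (simp add: a_0)
  from this[of N] show ?thesis by (simp add: a_N)
qed

lemma N_pos: "0 < N"
proof (rule ccontr)
  assume "\<not> ?thesis"
  then have "longest (I 0) = longest M" using a_N a_0 by simp
  then show False using longest_less[OF fin_M, of "I 0"] u_start by auto
qed

abbreviation \<sigma> :: "'a \<Rightarrow> 'a" where "\<sigma> x \<equiv> longest M \<otimes> x \<otimes> longest M"

lemma opposition_mem: "x \<in> M \<Longrightarrow> \<sigma> x \<in> M"
  using longest_conj[OF fin_M] .

lemma opposition_involutive: "x \<in> M \<Longrightarrow> \<sigma> (\<sigma> x) = x"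
  using longest_conj_inj[OF fin_M] by simp

text \<open>
  Conjugation by \<open>a(N) = w\<^sub>M\<close> maps \<open>L(N+1) = M - {u(N+1), u(N)}\<close> onto \<open>L(0) = M - {u(0), u(-1)}\<close>, so it
  maps the complements to each other.
\<close>
lemma u_N_cases: "\<sigma> (u (int N)) = u 0 \<or> \<sigma> (u (int N)) = u (-1)"
proof (rule ccontr)
  assume "\<not> ?thesis"
  then have mem: "\<sigma> (u (int N)) \<in> L 0" using opposition_mem u_mem[of N] by simp
  have into: "\<sigma> ` L (Suc N) \<subseteq> L 0"
    using transports_upto_N[of N] a_N fin_M by (auto simp: conj_into_def)
  have inj: "inj_on \<sigma> (L (Suc N))"
    by (rule inj_on_inverseI[of _ \<sigma>]) (use opposition_involutive in auto)
  have card: "card (L k) = card M - 2" for k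
    using u_mem[of k] finitary_finite[OF fin_M] by (subst card_Diff_subset) auto
  have "card (\<sigma> ` L (Suc N)) = card (L 0)"
    using card_image[OF inj] card[of "Suc N"] card[of 0] by simp
  then have "\<sigma> ` L (Suc N) = L 0"
    using into finitary_finite[OF fin_M] by (intro card_subset_eq) auto
  then obtain x where "x \<in> L (Suc N)" "\<sigma> (u (int N)) = \<sigma> x" using mem by auto
  then have "u (int N) \<in> L (Suc N)" using opposition_involutive[of x] opposition_involutive[of "u (int N)"] u_mem[of N] by auto
  then show False by auto
qed

text \<open>
  The value \<open>\<sigma>(u(0))\<close> has to be excluded. The element \<open>d(N-1) = w\<^sub>M w(I(N))\<close> has \<open>\<sigma>(u(N))\<close> as its only
  left descent in \<open>M\<close>. But it has a left descent in \<open>I(0) = M - {u(0)}\<close>: otherwise the fullness of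
  \<open>a(N-1) = g d(N-1)\<close> on \<open>I(0)\<close> would make \<open>g\<close> full on \<open>I(0)\<close>, although \<open>g\<close> lies in the smaller group
  \<open>W(L(0))\<close>.
\<close>
lemma u_N: "u (int N) = \<sigma> (u (-1))"
proof (cases "\<sigma> (u (int N)) = u (-1)")
  case True
  then show ?thesis using opposition_involutive[of "u (int N)"] u_mem[of N] by simp
next
  case False
  then have s: "\<sigma> (u (int N)) = u 0" using u_N_cases by simp
  obtain k where k: "N = Suc k" using N_pos by (cases N) auto
  have tr: "transports k" and ne: "a k \<noteq> longest M" using transports_upto_N a_before_N k by auto
  have dk: "longest M = d k \<otimes> longest (I N)" using a_Suc_d[OF tr ne] a_N k by simp
  have "\<not> lmin (I 0) (d k)"
  proof
    assume min: "lmin (I 0) (d k)"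
    obtain g where g: "g \<in> generate W (L 0)" "a k = g \<otimes> d k"
      using a_left_factor[OF tr] by blast
    have g0: "g \<in> generate W (I 0)" using g(1) mono_generate[of "L 0" "I 0"] by auto
    have x: "u (-1) \<in> I 0" "u (-1) \<in> S" "u (-1) \<notin> L 0" using u_start by auto
    have gc: "g \<in> carrier W" using g0 sub_S parabolic_closed by blast
    have add: "len (h \<otimes> d k) = len h + len (d k)" if "h \<in> generate W (I 0)" for h
      using lmin_additive[OF sub_S(1) d_closed min that] .
    have "len (u (-1) \<otimes> g \<otimes> d k) < len (g \<otimes> d k)"
      using a_lfull[of k] x gc by (auto simp: lfull_def g(2) m_assoc)
    then have "len (u (-1) \<otimes> g) < len g" using add[of g] add[of "u (-1) \<otimes> g"] g0 x by simp
    then show False using parabolic_descent[OF sub_S(1) g(1) x(2)] x by simp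
  qed
  then obtain x where x: "x \<in> I 0" "len (x \<otimes> d k) < len (d k)"
    using not_lmin[OF _ sub_S(1) d_closed] by blast
  let ?y = "longest (I N)"
  have c: "x \<in> M" "x \<in> S" "x \<in> carrier W" using x by auto
  have y: "?y \<in> generate W M" by (rule sub_M[OF longest_mem[OF fin_sub]])
  have d_eq: "d k = longest M \<otimes> ?y"
    using dk by (simp add: m_assoc)
  have "x \<otimes> d k = longest M \<otimes> (\<sigma> x \<otimes> ?y)"
    using c fin_M by (simp add: d_eq m_assoc)
  moreover have "\<sigma> x \<otimes> ?y \<in> generate W M" using y opposition_mem[OF c(1)] by simp
  ultimately have "len ?y < len (\<sigma> x \<otimes> ?y)"
    using longest_len_right[OF fin_M y] longest_len_right[OF fin_M, of "\<sigma> x \<otimes> ?y"] x(2) d_eq by simp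
  then have "\<sigma> x \<notin> I N" using longest_full(1)[of "I N"] unfolding lfull_def
    by (metis fin_sub not_less_iff_gr_or_eq)
  then have "\<sigma> x = u (int N)" using opposition_mem[OF c(1)] by simp
  then have "x = u 0" using s opposition_involutive[OF c(1)] by simp
  then show ?thesis using x by simp
qed

section \<open>Reducedness of rotation expressions\<close>

text \<open>
  The minimal element of \<open>W(I(0)) a(k) W(L(k+1))\<close> (\<open>min_elt_L\<close>).
\<close>
definition m :: "nat \<Rightarrow> 'a" where "m k = longest (I 0) \<otimes> a k"

lemma m_mem [simp]: "m k \<in> carrier W"
  by (simp add: m_def)

lemma m_lmin: "lmin (I 0) (m k)" and len_a_m: "len (a k) = len (longest (I 0)) + len (m k)"
  using lfull_split[OF fin_sub a_closed a_lfull] by (auto simp: m_def)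

lemma a_m: "a k = longest (I 0) \<otimes> m k"
  by (simp add: m_def)

lemma m_conj: "transports k \<Longrightarrow> conj_into (m k) (L (Suc k)) (I 0)"
proof -
  have "conj_into (longest (I 0)) (L 0) (I 0)"
    using conj_into_longest[of "{u 0}"] by (auto simp: conj_into_def)
  then show "transports k \<Longrightarrow> ?thesis"
    unfolding m_def by (intro conj_into_mult[OF _ _ L_carrier]) auto
qed

lemma m_rmin_L: assumes "transports k" shows "rmin (m k) (L (Suc k))"
  unfolding rmin_def
proof
  fix x assume x: "x \<in> L (Suc k)"
  let ?y = "m k \<otimes> x \<otimes> inv (m k)"
  have y: "?y \<in> I 0" using m_conj[OF assms] x by (auto simp: conj_into_def)
  have "x \<in> carrier W" using x by auto
  then have "m k \<otimes> x = ?y \<otimes> m k" by (simp add: m_assoc)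
  moreover have "len (m k) < len (?y \<otimes> m k)" using m_lmin[of k] y unfolding lmin_def by blast
  ultimately show "len (m k) < len (m k \<otimes> x)" by simp
qed

lemma m_coset: "m k \<in> double_coset (I 0) {a k} (M - A)"
proof -
  have "longest (I 0) \<otimes> a k \<otimes> \<one> \<in> double_coset (I 0) {a k} (M - A)"
    using longest_mem sub_S by (intro double_coset_mult double_coset_refl) auto
  then show ?thesis by (simp add: m_def)
qed

lemma min_elt_L: "transports k \<Longrightarrow> min_elt (double_coset (I 0) {a k} (L (Suc k))) = m k"
  using m_coset m_lmin m_rmin_L sub_S by (intro min_elt_eq) auto

text \<open>
  The two cosets have the same minimal element \<open>m(k)\<close> and differ only in \<open>u(k)\<close>, which is not a
  descent of \<open>a(k) = w(I(0)) m(k)\<close>. Hence \<open>u(k)\<close> neither shortens \<open>m(k)\<close> nor is conjugated by \<open>m(k)\<close> into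
  \<open>I(0)\<close>, as in both cases \<open>a(k) u(k)\<close> would be shorter than \<open>a(k)\<close>.
\<close>
lemma step_reduced:
  assumes "transports k" "a k \<noteq> longest M"
  defines "p \<equiv> double_coset (I 0) {a k} (L (Suc k))"
    and "p' \<equiv> double_coset (I 0) {a k} (I (Suc k))"
  shows "min_elt p = min_elt p'" "left_redundancy (I 0) p (L (Suc k)) = left_redundancy (I 0) p' (I (Suc k))"
proof -
  have uk: "u (int k) \<in> S" "u (int k) \<in> carrier W" using u_mem[of k] by auto
  have up: "len (m k) < len (m k \<otimes> u (int k))"
  proof (rule ccontr)
    assume "\<not> ?thesis"
    then have "len (m k \<otimes> u (int k)) < len (m k)" using len_mult_S_cases[of "u (int k)" "m k"] uk by auto
    moreover have "len (a k \<otimes> u (int k)) \<le> len (longest (I 0)) + len (m k \<otimes> u (int k))"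
      using len_mult[of "longest (I 0)" "m k \<otimes> u (int k)"] uk by (simp add: a_m m_assoc)
    ultimately show False using a_up[OF assms(2)] len_a_m[of k] by simp
  qed
  then have "rmin (m k) (I (Suc k))"
    using m_rmin_L[OF assms(1)] unfolding L_Suc(2) by (auto simp: rmin_def)
  then have p': "min_elt p' = m k" unfolding p'_def
    using m_coset m_lmin sub_S by (intro min_elt_eq) auto
  moreover have p: "min_elt p = m k" unfolding p_def using min_elt_L[OF assms(1)] .
  ultimately show "min_elt p = min_elt p'" by simp
  have "m k \<otimes> u (int k) \<otimes> inv (m k) \<notin> I 0"
  proof
    let ?y = "m k \<otimes> u (int k) \<otimes> inv (m k)"
    assume y: "?y \<in> I 0"
    have "a k \<otimes> u (int k) = (longest (I 0) \<otimes> ?y) \<otimes> m k"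
      using uk by (simp add: a_m m_assoc)
    then have "len (a k \<otimes> u (int k)) \<le> len (longest (I 0) \<otimes> ?y) + len (m k)"
      using len_mult[of "longest (I 0) \<otimes> ?y" "m k"] uk by simp
    moreover have "len (longest (I 0) \<otimes> ?y) < len (longest (I 0))"
      using longest_full(2)[of "I 0"] y by (simp add: rfull_def)
    ultimately show False using a_up[OF assms(2)] len_a_m[of k] by simp
  qed
  then show "left_redundancy (I 0) p (L (Suc k)) = left_redundancy (I 0) p' (I (Suc k))"
    unfolding left_redundancy_def p p' L_Suc(2) by auto
qed

text \<open>
  Both cosets have \<open>w\<^sub>M = w(I(0)) m(N)\<close> as maximal element. If \<open>m(N)\<close> is minimal in both, then \<open>u(N)\<close>
  lengthens \<open>m(N)\<close> but shortens \<open>w\<^sub>M\<close>. So \<open>m(N) u(N)\<close> has a left descent \<open>x \<in> I(0)\<close>, and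
  \<open>x m(N) = m(N) u(N)\<close>. This puts \<open>x\<close> into the left redundancy of the second coset but not of the
  first.
\<close>
lemma step_not_reduced:
  defines "p \<equiv> double_coset (I 0) {a N} (L (Suc N))"
    and "p' \<equiv> double_coset (I 0) {a N} (I (Suc N))"
  assumes eq: "min_elt p = min_elt p'" "left_redundancy (I 0) p (L (Suc N)) = left_redundancy (I 0) p' (I (Suc N))"
  shows False
proof -
  let ?u = "u (int N)"
  have u: "?u \<in> M" "?u \<in> S" "?u \<in> carrier W" "?u \<in> I (Suc N)" "?u \<notin> L (Suc N)"
    using u_mem[of N] u_mem[of "Suc N"] by auto
  have p: "min_elt p = m N" unfolding p_def using min_elt_L transports_upto_N by simp
  obtain m' where m': "m' \<in> p'" "lmin (I 0) m'" "rmin m' (I (Suc N))"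
    using minimal_exists[of "I 0" "I (Suc N)" "a N"] sub_S unfolding p'_def by auto
  then have "min_elt p' = m'"
    unfolding p'_def using sub_S by (intro min_elt_eq) auto
  then have "m' = m N" using eq p by simp
  then have up: "len (m N) < len (m N \<otimes> ?u)" using m'(3) u by (auto simp: rmin_def)
  have down: "len (longest (I 0) \<otimes> (m N \<otimes> ?u)) < len (longest (I 0) \<otimes> m N)"
    using longest_full(2)[OF fin_M] u by (simp add: rfull_def a_N[symmetric] a_m m_assoc)
  have "\<not> lmin (I 0) (m N \<otimes> ?u)"
  proof
    assume *: "lmin (I 0) (m N \<otimes> ?u)"
    show False
      using lmin_additive[OF sub_S(1) _ * longest_mem[of "I 0"]]
        lmin_additive[OF sub_S(1) _ m_lmin longest_mem[of "I 0"]] down up u by simp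
  qed
  then obtain x where x: "x \<in> I 0" "len (x \<otimes> (m N \<otimes> ?u)) < len (m N \<otimes> ?u)"
    using not_lmin[OF _ sub_S(1), of "{u 0}" "m N \<otimes> ?u"] u(3) by auto
  have xc: "x \<in> S" "x \<in> carrier W" using x by auto
  have "x \<otimes> m N = m N \<otimes> ?u"
    using x xc u up m_lmin[of N] by (intro commuting_square) (auto simp: lmin_def m_assoc)
  then have "x = m N \<otimes> ?u \<otimes> inv (m N)" using xc by (metis inv_solve_right m_mem m_closed u(3))
  then have "m N \<otimes> ?u \<otimes> inv (m N) \<in> left_redundancy (I 0) p' (I (Suc N))"
    unfolding left_redundancy_def eq(1)[symmetric] p using x u by auto
  then obtain y where y: "y \<in> L (Suc N)" "m N \<otimes> ?u \<otimes> inv (m N) = m N \<otimes> y \<otimes> inv (m N)"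
    unfolding eq(2)[symmetric] unfolding left_redundancy_def p by blast
  have "y \<in> carrier W" using y by auto
  then have "?u = y" using y(2) u by simp
  then show False using y u by simp
qed

lemma forward_path_rotation:
  assumes "j < k"
  shows "forward_path (rotation_expression M u k) (2 * j + 1) = double_coset (I 0) {a j} (L (Suc j))"
    "forward_path (rotation_expression M u k) (Suc (2 * j + 1)) = double_coset (I 0) {a j} (I (Suc j))"
proof -
  let ?R = "rotation_expression M u k"
  have nth: "?R ! 0 = I 0" "?R ! (2 * j + 1) = L (Suc j)" "?R ! (2 * Suc j) = I (Suc j)"
    using nth_rotation_expression(1)[of 0 k] nth_rotation_expression(1)[of "Suc j" k]
      nth_rotation_expression(2)[of j k] assms by auto
  have "take (Suc (2 * j + 1)) ?R = rotation_expression M u j @ [L (Suc j)]"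
    using assms take_rotation_expression[of j k] nth
    by (subst take_Suc_conv_app_nth) (auto simp: length_rotation_expression)
  then have "star_prod (take (Suc (2 * j + 1)) ?R) = star (a j) (longest (L (Suc j)))"
    using rotation_expression_finitary by (simp add: star_prod_append a_def)
  also have "\<dots> = a j" 
    by (rule rfull_absorb[OF sub_S(1) longest_mem[OF fin_sub] a_closed a_rfull_L])
  finally show "forward_path ?R (2 * j + 1) = double_coset (I 0) {a j} (L (Suc j))"
    using forward_path_star_prod[OF rotation_expression_finitary, of "2 * j + 1" k] assms nth
    by (simp add: length_rotation_expression)
  have "take (Suc (2 * Suc j)) ?R = rotation_expression M u (Suc j)"
    using take_rotation_expression[of "Suc j" k] assms by simp
  then have "star_prod (take (Suc (2 * Suc j)) ?R) = star (a j) (longest (I (Suc j)))"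
    by (simp add: a_def[symmetric] a_Suc del: mult_Suc_right)
  then have "forward_path ?R (2 * Suc j) = double_coset (I 0) {star (a j) (longest (I (Suc j)))} (I (Suc j))"
    using forward_path_star_prod[OF rotation_expression_finitary, of "2 * Suc j" k] assms nth
    by (simp add: length_rotation_expression)
  also have "\<dots> = double_coset (I 0) {a j} (I (Suc j))"
    using sub_S by (intro double_coset_star_right) auto
  finally show "forward_path ?R (Suc (2 * j + 1)) = double_coset (I 0) {a j} (I (Suc j))" by simp
qed

lemma reduced_upto_N:
  assumes "k \<le> N" shows "reduced (rotation_expression M u k)"
  unfolding reduced_def
proof (intro conjI allI impI, rule expression_rotation)
  let ?R = "rotation_expression M u k"
  fix i assume i: "Suc i < length ?R \<and> ?R ! i \<subset> ?R ! Suc i"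
  have "odd i"
  proof (rule ccontr)
    assume "\<not> odd i"
    then obtain j where j: "i = 2 * j" by auto
    then have "?R ! i = I j" "?R ! Suc i = L (Suc j)"
      using i nth_rotation_expression[of j k] by (auto simp: length_rotation_expression)
    then show False using i L_Suc(1)[of j] by blast
  qed
  then obtain j where j: "i = 2 * j + 1" by (elim oddE)
  then have jk: "j < k" using i by (auto simp: length_rotation_expression)
  have nth: "?R ! 0 = I 0" "?R ! i = L (Suc j)" "?R ! Suc i = I (Suc j)"
    using nth_rotation_expression(1)[of 0 k] nth_rotation_expression(1)[of "Suc j" k]
      nth_rotation_expression(2)[of j k] jk j by auto
  have *: "transports j" "a j \<noteq> longest M" using transports_upto_N a_before_N jk assms by auto
  show "min_elt (forward_path ?R i) = min_elt (forward_path ?R (Suc i))"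
    using step_reduced(1)[OF *] unfolding j forward_path_rotation[OF jk] .
  show "left_redundancy (?R ! 0) (forward_path ?R i) (?R ! i) =
      left_redundancy (?R ! 0) (forward_path ?R (Suc i)) (?R ! Suc i)"
    using step_reduced(2)[OF *] unfolding nth unfolding j forward_path_rotation[OF jk] .
qed

lemma not_reduced_Suc_N: "\<not> reduced (rotation_expression M u (Suc N))"
proof
  let ?R = "rotation_expression M u (Suc N)" and ?i = "2 * N + 1"
  assume red: "reduced ?R"
  have nth: "?R ! 0 = I 0" "?R ! ?i = L (Suc N)" "?R ! Suc ?i = I (Suc N)"
    using nth_rotation_expression(1)[of 0 "Suc N"] nth_rotation_expression(1)[of "Suc N" "Suc N"]
      nth_rotation_expression(2)[of N "Suc N"] by auto
  have "u (int N) \<notin> L (Suc N)" by simp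
  then have "L (Suc N) \<subset> I (Suc N)" using L_Suc(2)[of N] by blast
  moreover have "Suc ?i < length ?R" by (simp add: length_rotation_expression)
  ultimately have "min_elt (forward_path ?R ?i) = min_elt (forward_path ?R (Suc ?i)) \<and>
      left_redundancy (I 0) (forward_path ?R ?i) (L (Suc N)) =
      left_redundancy (I 0) (forward_path ?R (Suc ?i)) (I (Suc N))"
    using red nth unfolding reduced_def by metis
  then show False
    unfolding forward_path_rotation[OF lessI] using step_not_reduced by blast
qed

lemma rotation_length_N: "rotation_length M u = N"
  unfolding rotation_length_def
proof (rule Greatest_equality)
  show "\<forall>k. 1 \<le> k \<and> k \<le> N \<longrightarrow> reduced (rotation_expression M u k)"
    using reduced_upto_N by blast
  fix y assume "\<forall>k. 1 \<le> k \<and> k \<le> y \<longrightarrow> reduced (rotation_expression M u k)"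
  then show "y \<le> N" using not_reduced_Suc_N by (metis Suc_le_eq le_add1 not_le plus_1_eq_Suc)
qed

lemma path_rotation:
  "path (M - {u 0}) (concat (map (\<lambda>i. [Minus (u i), Plus (u (i - 1))]) [1..int k])) =
    rotation_expression M u k"
proof -
  have path_nonempty: "path J xs \<noteq> []" for J :: "'a set" and xs
    by (induction J xs rule: path.induct) auto
  have path_append: "path J (xs @ ys) = butlast (path J xs) @ path (last (path J xs)) ys"
    for J :: "'a set" and xs ys
  proof (induction J xs rule: path.induct)
    case (2 J s xs)
    moreover have "path (insert s J) xs \<noteq> []" using path_nonempty .
    ultimately show ?case by simp
  next
    case (3 J s xs)
    moreover have "path (J - {s}) xs \<noteq> []" using path_nonempty .
    ultimately show ?case by simp
  qed simp
  show ?thesis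
  proof (induction k)
    case (Suc k)
    have "insert (u (int k)) (I k - {u (1 + int k)}) = I (Suc k)"
      using u_mem[of k] u_mem[of "Suc k"] by auto
    moreover have "I k - {u (1 + int k)} = L (Suc k)" by auto
    moreover have "[1..int (Suc k)] = [1..int k] @ [1 + int k]"
      by (simp add: upto_rec2)
    ultimately show ?case
      using append_butlast_last_id[of "rotation_expression M u k"]
      by (simp add: path_append Suc rotation_expression_Suc rotation_expression_last del: append_butlast_last_id)
  qed (simp add: rotation_expression_0)
qed

end

context coxeter_system
begin

section \<open>The relations hold\<close>

lemma rotation_of_switchback:
  assumes "s \<notin> J" "finitary (insert s J)" "t \<in> insert s J"
    "s \<noteq> longest (insert s J) \<otimes> t \<otimes> longest (insert s J)" "rotation_sequence J s t u"
  shows "rotation W S (insert s J) u" "u 0 = s"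
    "u (-1) = longest (insert s J) \<otimes> t \<otimes> longest (insert s J)"
proof -
  show "u 0 = s" "u (-1) = longest (insert s J) \<otimes> t \<otimes> longest (insert s J)"
    using assms by (auto simp: rotation_sequence_def)
  then show "rotation W S (insert s J) u"
    using assms longest_conj[of "insert s J" t]
    by unfold_locales (auto simp: rotation_sequence_def)
qed

text \<open>
  The consequences of the theory of rotation sequences in the form in which the relation uses
  them: the right-hand side starts and ends like \<open>[J + s - t]\<close> and has the same star product.
\<close>
lemma switchback_path:
  assumes "s \<notin> J" "finitary (insert s J)" "t \<in> insert s J"
    "s \<noteq> longest (insert s J) \<otimes> t \<otimes> longest (insert s J)" "rotation_sequence J s t u"
  defines "x \<equiv> rotation_expression (insert s J) u (rotation_length (insert s J) u)"
  shows "path J (concat (map (\<lambda>i. [Minus (u i), Plus (u (i - 1))])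
      [1..int (rotation_length (insert s J) u)])) = x"
    "expression x" "hd x = J" "last x = insert s J - {t}"
    "star_prod x = longest (insert s J)"
proof -
  interpret r: rotation W S "insert s J" u
    using rotation_of_switchback[OF assms(1-5)] by simp
  have J: "J = insert s J - {u 0}" using rotation_of_switchback(2)[OF assms(1-5)] assms(1) by auto
  show "path J (concat (map (\<lambda>i. [Minus (u i), Plus (u (i - 1))])
      [1..int (rotation_length (insert s J) u)])) = x"
    using r.path_rotation[of "rotation_length (insert s J) u"] J by (simp add: x_def)
  show "expression x" unfolding x_def by (rule r.expression_rotation)
  show "hd x = J" unfolding x_def using r.rotation_expression_hd J by simp
  have "u (int r.N) = t"
    using r.u_N rotation_of_switchback(3)[OF assms(1-5)] longest_conj_inj[of "insert s J" t]
      assms(2,3) r.M_S by simp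
  then show "last x = insert s J - {t}"
    unfolding x_def r.rotation_length_N r.rotation_expression_last by simp
  show "star_prod x = longest (insert s J)"
    unfolding x_def r.rotation_length_N using r.a_N by (simp add: r.a_def)
qed

lemma sc_relation_ends:
  assumes "sc_relation x y"
  shows "x \<noteq> [] \<and> y \<noteq> [] \<and> hd x = hd y \<and> last x = last y"
  using assms
proof cases
  case (switchback s J t u \<delta>)
  note sp = switchback_path[OF switchback(3-7)]
  show ?thesis unfolding switchback(1,2,8) sp(1)
    using sp(3,4) expression_nonempty[OF sp(2)] by simp
qed (auto simp: insert_commute)

lemma sc_relation_star_prod:
  assumes "sc_relation x y" "\<forall>I \<in> set x. finitary I"
  shows "star_prod x = star_prod y"
  using assms(1)
proof cases
  case (up_up s J t)
  have "finitary (insert s J)" "finitary (insert t J)" "finitary J" "finitary (insert t (insert s J))"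
    using up_up(6) by (auto intro: finitary_subset[of "J \<union> {s, t}"] simp: insert_commute)
  then show ?thesis using up_up(1,2)
    by (auto simp: longest_star_left insert_commute subset_insertI subset_insertI2)
next
  case (down_down J s t)
  have fin: "finitary (J - A)" for A using down_down by (auto intro: finitary_subset[of J])
  have "star (longest (J - {s})) (longest (J - {s, t})) = longest (J - {s})"
    "star (longest (J - {t})) (longest (J - {s, t})) = longest (J - {t})"
    using fin by (auto intro!: longest_star_right)
  moreover have "star (longest J) (longest (J - A)) = longest J" for A
    using down_down by (intro longest_star_right) auto
  moreover have "J - {s} - {t} = J - {s, t}" "J - {t} - {s} = J - {s, t}" by auto
  ultimately show ?thesis using down_down fin by simp
next
  case (switchback s J t u \<delta>)
  note sp = switchback_path[OF switchback(3-7)]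
  have f: "finitary J" "finitary (insert s J - {t})"
    using switchback(4) by (auto intro: finitary_subset[of "insert s J"])
  have "star_prod x = longest (insert s J)"
    using switchback(1,4) f by (simp add: longest_star_left longest_star_right subset_insertI)
  then show ?thesis unfolding switchback(2,8) sp(1) using sp(5) by simp
next
  case (star_quadratic J s)
  then have "finitary (J - {s})" by (auto intro: finitary_subset[of J])
  then show ?thesis using star_quadratic by (simp add: insert_absorb longest_star_left)
qed

lemma sc_rewrite_invariants:
  assumes "sc_rewrite Is Js"
  shows "expression Is \<and> expression Js \<and> hd Is = hd Js \<and> last Is = last Js \<and>
    star_prod Is = star_prod Js"
proof -
  obtain a x y b where *: "expression Is" "expression Js" "sc_relation x y"
      "Is = a @ x @ b" "Js = a @ y @ b"
    using assms unfolding sc_rewrite_def by blast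
  have f: "\<forall>I \<in> set Is. finitary I" "\<forall>I \<in> set Js. finitary I"
    using * by (auto simp: expression_def)
  then have "star_prod x = star_prod y" using sc_relation_star_prod * by auto
  moreover have "hd x = hd y" "last x = last y" "x \<noteq> []" "y \<noteq> []"
    using sc_relation_ends[OF *(3)] by auto
  ultimately show ?thesis using * f by (simp add: star_prod_append hd_append last_append)
qed

text \<open>
  The rewriting relation restricted to expressions: the reflexive closure in \<open>sc_equiv\<close> also relates
  lists that are no expressions to themselves.
\<close>
definition eqv :: "'a set list \<Rightarrow> 'a set list \<Rightarrow> bool" (infix "\<simeq>" 50) where
  "x \<simeq> y \<longleftrightarrow> expression x \<and> expression y \<and> sc_equiv x y"

lemma eqv_refl: "expression x \<Longrightarrow> x \<simeq> x"
  by (simp add: eqv_def sc_equiv_def)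

lemma eqv_sym: "x \<simeq> y \<Longrightarrow> y \<simeq> x"
  by (auto simp: eqv_def sc_equiv_def intro: equivclp_sym)

lemma eqv_trans [trans]: "x \<simeq> y \<Longrightarrow> y \<simeq> z \<Longrightarrow> x \<simeq> z"
  by (auto simp: eqv_def sc_equiv_def intro: equivclp_trans)

lemma eqv_rewrite: "sc_rewrite x y \<Longrightarrow> x \<simeq> y"
  using sc_rewrite_invariants by (auto simp: eqv_def sc_equiv_def)

lemma eqv_relation:
  assumes "sc_relation x y" "expression x" "expression y" shows "x \<simeq> y"
proof (rule eqv_rewrite)
  have "x = [] @ x @ []" "y = [] @ y @ []" by simp_all
  then show "sc_rewrite x y" unfolding sc_rewrite_def using assms by blast
qed

lemma eqv_expression: "x \<simeq> y \<Longrightarrow> expression x" "x \<simeq> y \<Longrightarrow> expression y"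
  by (auto simp: eqv_def)

lemma expression_append:
  "expression (x @ y) \<longleftrightarrow> (x = [] \<and> expression y) \<or> (y = [] \<and> expression x) \<or>
     (expression x \<and> expression y \<and> adjacent (last x) (hd y))"
  by (auto simp: expression_def successively_append_iff)

lemma expression_replace:
  assumes "expression (a @ x @ b)" "expression x" "expression y" "hd x = hd y" "last x = last y"
  shows "expression (a @ y @ b)"
proof -
  have "x \<noteq> []" "y \<noteq> []" using assms expression_nonempty by auto
  then show ?thesis using assms by (auto simp: expression_append hd_append last_append)
qed

lemma eqv_induct [consumes 1, case_names base step]:
  assumes "x \<simeq> y" "P x" "\<And>y z. P y \<Longrightarrow> sc_rewrite y z \<or> sc_rewrite z y \<Longrightarrow> P z"
  shows "P y"
  using assms(1) unfolding eqv_def sc_equiv_def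
  by (auto elim!: equivclp_induct intro: assms)

lemma eqv_invariants:
  assumes "x \<simeq> y" shows "hd x = hd y \<and> last x = last y \<and> star_prod x = star_prod y"
  using assms by (induction rule: eqv_induct) (auto dest: sc_rewrite_invariants)

text \<open>
  Replacing the middle of an expression by an equivalent one leads to an expression again, since
  the end objects agree at every rewrite step.
\<close>
lemma eqv_context:
  assumes "x \<simeq> y" "expression (a @ x @ b)"
  shows "a @ x @ b \<simeq> a @ y @ b"
proof -
  have "expression y \<and> hd x = hd y \<and> last x = last y \<and> a @ x @ b \<simeq> a @ y @ b"
    using assms(1)
  proof (induction rule: eqv_induct)
    case base
    then show ?case using assms eqv_expression eqv_refl by blast
  next
    case (step y z)
    have *: "a @ y @ b \<simeq> a @ z @ b" if rw: "sc_rewrite y z" and ex: "expression (a @ y @ b)" for y z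
    proof -
      have "expression (a @ z @ b)"
        using expression_replace[OF ex] sc_rewrite_invariants[OF rw] by auto
      moreover obtain p q l r where "sc_relation l r" "y = p @ l @ q" "z = p @ r @ q"
        using rw unfolding sc_rewrite_def by blast
      ultimately have "sc_rewrite (a @ y @ b) (a @ z @ b)"
        unfolding sc_rewrite_def using ex
        by (intro conjI exI[of _ "a @ p"] exI[of _ l] exI[of _ r] exI[of _ "q @ b"]) auto
      then show ?thesis by (rule eqv_rewrite)
    qed
    have y: "expression (a @ y @ b)" using step eqv_expression by blast
    have inv: "expression z \<and> expression y \<and> hd y = hd z \<and> last y = last z"
      using step.prems sc_rewrite_invariants[of y z] sc_rewrite_invariants[of z y] step by auto
    then have "expression (a @ z @ b)" using expression_replace[OF y] by auto
    then have "a @ y @ b \<simeq> a @ z @ b"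
      using *[of y z] *[of z y] y step eqv_sym by blast
    then show ?case using inv step eqv_trans by metis
  qed
  then show ?thesis by simp
qed

section \<open>Equivalence is compatible with composition\<close>

text \<open>
  Composition in the category: the last object of \<open>x\<close> is the first object of \<open>y\<close> and is not repeated.
\<close>
definition glue :: "'a set list \<Rightarrow> 'a set list \<Rightarrow> 'a set list" (infixr "\<bullet>" 65) where
  "x \<bullet> y = x @ tl y"

lemma glue_butlast: "x \<noteq> [] \<Longrightarrow> y \<noteq> [] \<Longrightarrow> last x = hd y \<Longrightarrow> x \<bullet> y = butlast x @ y"
  by (cases x rule: rev_cases; cases y) (auto simp: glue_def)

lemma glue_hd [simp]: "x \<noteq> [] \<Longrightarrow> hd (x \<bullet> y) = hd x"
  by (simp add: glue_def)

lemma glue_last: "y \<noteq> [] \<Longrightarrow> last x = hd y \<Longrightarrow> last (x \<bullet> y) = last y"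
  by (cases y) (auto simp: glue_def)

lemma glue_nonempty [simp]: "x \<noteq> [] \<Longrightarrow> x \<bullet> y \<noteq> []"
  by (simp add: glue_def)

lemma glue_assoc: "y \<noteq> [] \<Longrightarrow> (x \<bullet> y) \<bullet> z = x \<bullet> y \<bullet> z"
  by (simp add: glue_def)

lemma glue_single [simp]: "x \<bullet> [I] = x"
  by (simp add: glue_def)

lemma single_glue [simp]: "y \<noteq> [] \<Longrightarrow> [hd y] \<bullet> y = y"
  by (simp add: glue_def)

lemma set_glue: "set (x \<bullet> y) \<subseteq> set x \<union> set y"
  by (cases y) (auto simp: glue_def)

lemma expression_glue:
  assumes "expression x" "expression y" "last x = hd y" shows "expression (x \<bullet> y)"
proof -
  have "x \<noteq> []" "y \<noteq> []" using assms expression_nonempty by auto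
  then show ?thesis using assms
    by (cases y) (auto simp: glue_def expression_def successively_append_iff successively_Cons)
qed

lemma eqv_glue:
  assumes "x \<simeq> x'" "y \<simeq> y'" "last x = hd y"
  shows "x \<bullet> y \<simeq> x' \<bullet> y'"
proof -
  have e: "expression x" "expression y" "expression x'" "expression y'"
    using assms eqv_expression by auto
  note ne = this[THEN expression_nonempty]
  have ends: "last x' = hd y" "last x' = hd y'"
    using eqv_invariants[OF assms(1)] eqv_invariants[OF assms(2)] assms(3) by auto
  have "x \<bullet> y \<simeq> x' \<bullet> y"
    using eqv_context[OF assms(1), of "[]" "tl y"] expression_glue[OF e(1,2) assms(3)]
    by (simp add: glue_def)
  also have "x' \<bullet> y \<simeq> x' \<bullet> y'"
    using eqv_context[OF assms(2), of "butlast x'" "[]"] expression_glue[OF e(3,2) ends(1)]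
      glue_butlast[OF ne(3,2) ends(1)] glue_butlast[OF ne(3,4) ends(2)] by simp
  finally show ?thesis .
qed

lemma star_prod_glue:
  assumes "expression x" "expression y" "last x = hd y"
  shows "star_prod (x \<bullet> y) = star (star_prod x) (star_prod y)"
proof -
  note f = assms(1,2)[THEN expression_finitary] and ne = assms(1,2)[THEN expression_nonempty]
  obtain I z where y: "y = I # z" using ne(2) by (cases y) auto
  have I: "finitary I" "\<forall>J \<in> set z. finitary J" using f y by auto
  have "star (star_prod x) (longest I) = star_prod x"
    using star_prod_rfull[OF f(1) ne(1)] assms(3) y f(1) I
    by (intro rfull_absorb[OF _ longest_mem]) (auto simp: finitary_S)
  then show ?thesis
    using f(1) I by (simp add: y glue_def star_prod_append flip: star_assoc)
qed

lemma expression_pair: "expression [I, J] \<longleftrightarrow> finitary I \<and> finitary J \<and> adjacent I J"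
  by (auto simp: expression_def)

lemma expression_single: "expression [I] \<longleftrightarrow> finitary I"
  by (simp add: expression_def)

lemma adjacent_sym: "adjacent I J \<Longrightarrow> adjacent J I"
  unfolding adjacent_def by (metis Diff_insert_absorb insertI1 insert_Diff Diff_iff singletonI)

lemma adjacent_remove: "finitary J \<Longrightarrow> s \<in> J \<Longrightarrow> adjacent J (J - {s})"
  unfolding adjacent_def using finitary_S by blast

lemma finitary_remove: "finitary J \<Longrightarrow> finitary (J - A)"
  by (rule finitary_subset) auto

lemma eqv_quadratic:
  assumes "finitary J" "s \<in> J"
  shows "[J, J - {s}, J] \<simeq> [J]"
proof -
  have "sc_relation [J, J - {s}, J] [J]"
    using star_quadratic[OF assms] assms by (simp add: insert_absorb)
  then show ?thesis
    using assms adjacent_remove adjacent_sym finitary_remove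
    by (intro eqv_relation) (auto simp: expression_def)
qed

lemma eqv_down:
  assumes "finitary J" "s \<in> J" "t \<in> J" "s \<noteq> t"
  shows "[J, J - {s}, J - {s, t}] \<simeq> [J, J - {t}, J - {s, t}]"
proof -
  have eq: "J - {s} - {t} = J - {s, t}" "J - {t} - {s} = J - {s, t}" by auto
  have "sc_relation [J, J - {s}, J - {s, t}] [J, J - {t}, J - {s, t}]"
    using down_down[OF assms] by (simp add: eq)
  moreover have "adjacent (J - {s}) (J - {s, t})" "adjacent (J - {t}) (J - {s, t})"
    using adjacent_remove[of "J - {s}" t] adjacent_remove[of "J - {t}" s] assms
    by (auto simp: eq finitary_remove)
  ultimately show ?thesis
    using assms by (intro eqv_relation) (auto simp: expression_def adjacent_remove finitary_remove)
qed

lemma eqv_up: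
  assumes "finitary J" "s \<in> J" "t \<in> J" "s \<noteq> t"
  shows "[J - {s, t}, J - {s}, J] \<simeq> [J - {s, t}, J - {t}, J]"
proof -
  have eq: "insert t (J - {s, t}) = J - {s}" "insert s (J - {s, t}) = J - {t}"
    "insert s (J - {s}) = J" "insert t (J - {t}) = J" "J - {s, t} \<union> {t, s} = J" using assms by auto
  have eq': "J - {s} - {t} = J - {s, t}" "J - {t} - {s} = J - {s, t}" by auto
  have "sc_relation [J - {s, t}, J - {s}, J] [J - {s, t}, J - {t}, J]"
    using up_up[of t "J - {s, t}" s] assms finitary_S[of J]
    by (simp add: eq subset_iff insert_absorb)
  moreover have "adjacent (J - {s}) (J - {s, t})" "adjacent (J - {t}) (J - {s, t})"
    using adjacent_remove[of "J - {s}" t] adjacent_remove[of "J - {t}" s] assms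
    by (auto simp: eq' finitary_remove)
  ultimately show ?thesis
    using assms
    by (intro eqv_relation) (auto simp: expression_def adjacent_remove finitary_remove adjacent_sym)
qed

text \<open>
  The recursion for \<open>(u(i-1), u(i))\<close> is a bijection, with inverse \<open>G\<close>, because the longest elements
  are involutions. So it can be run from \<open>i = 0\<close> in both directions.
\<close>
lemma rotation_sequence_exists:
  assumes M: "finitary (insert s J)" "t \<in> insert s J"
  shows "\<exists>u. rotation_sequence J s t u"
proof -
  define M where "M = insert s J"
  define cj where "cj x y = longest (M - {x}) \<otimes> y \<otimes> longest (M - {x})" for x y
  define F where "F = (\<lambda>(a, b). (b, cj b a))"
  \<comment> \<open>\<open>F\<close> maps \<open>(u(i-1), u(i))\<close> to \<open>(u(i), u(i+1))\<close>, and \<open>P i\<close> is the pair \<open>(u(i-1), u(i))\<close>.\<close>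
  define G where "G = (\<lambda>(b, c). (cj b c, b))"
  define p where "p = (longest M \<otimes> t \<otimes> longest M, s)"
  have fin: "finitary (M - A)" for A using M finitary_remove M_def by simp
  have cc: "cj x (cj x y) = y" if "y \<in> carrier W" for x y
    using that fin by (simp add: cj_def m_assoc)
  have cl: "cj x y \<in> carrier W" if "y \<in> carrier W" for x y
    using that fin by (simp add: cj_def)
  let ?C = "carrier W \<times> carrier W"
  have FG: "F (G q) = q" if "q \<in> ?C" for q
    using that cc by (auto simp: F_def G_def)
  have GC: "G q \<in> ?C" if "q \<in> ?C" for q
    using that cl by (auto simp: G_def)
  have pC: "p \<in> ?C" using M finitary_S[OF M(1)] by (auto simp: p_def M_def)
  have GnC: "(G ^^ n) p \<in> ?C" for n by (induction n) (auto simp: pC GC)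
  define P where "P i = (if 0 \<le> i then (F ^^ nat i) p else (G ^^ nat (- i)) p)" for i :: int
  have step: "P (i + 1) = F (P i)" for i
  proof (cases "0 \<le> i")
    case True
    then have "nat (i + 1) = Suc (nat i)" by simp
    then show ?thesis using True by (simp add: P_def)
  next
    case False
    then have "nat (- i) = Suc (nat (- (i + 1)))" by simp
    then have "P i = G ((G ^^ nat (- (i + 1))) p)" using False by (simp add: P_def)
    then have "F (P i) = (G ^^ nat (- (i + 1))) p" using FG GnC by simp
    then show ?thesis using False by (auto simp: P_def)
  qed
  define u where "u i = snd (P i)" for i
  have fst_P: "fst (P i) = u (i - 1)" for i
    using step[of "i - 1"] by (simp add: u_def F_def split: prod.splits)
  have "u (i + 1) = cj (u i) (u (i - 1))" for i
    using step[of i] fst_P[of i] by (simp add: u_def F_def split: prod.splits)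
  moreover have "u 0 = s" "u (-1) = longest M \<otimes> t \<otimes> longest M"
    using fst_P[of 0] by (auto simp: u_def P_def p_def)
  ultimately show ?thesis unfolding rotation_sequence_def
    by (intro exI[of _ u]) (simp add: cj_def M_def)
qed

lemma eqv_switchback:
  assumes "finitary M" "s \<in> M" "t \<in> M" "s \<noteq> longest M \<otimes> t \<otimes> longest M"
  obtains u where "rotation W S M u" "u 0 = s"
    "[M - {s}, M, M - {t}] \<simeq> rotation_expression M u (rotation_length M u)"
    "last (rotation_expression M u (rotation_length M u)) = M - {t}"
proof -
  have M: "insert s (M - {s}) = M" using assms by auto
  obtain u where u: "rotation_sequence (M - {s}) s t u"
    using rotation_sequence_exists[of s "M - {s}" t] assms M by auto
  have pre: "s \<notin> M - {s}" "finitary (insert s (M - {s}))" "t \<in> insert s (M - {s})"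
      "s \<noteq> longest (insert s (M - {s})) \<otimes> t \<otimes> longest (insert s (M - {s}))"
    unfolding M using assms by auto
  note sp = switchback_path[OF pre u, unfolded M]
  have "sc_relation [M - {s}, M, M - {t}] (rotation_expression M u (rotation_length M u))"
    using switchback[OF pre u refl] unfolding M sp(1) by (simp add: M insert_absorb assms(2))
  then have "[M - {s}, M, M - {t}] \<simeq> rotation_expression M u (rotation_length M u)"
    using assms adjacent_remove[of M] adjacent_sym finitary_remove
    by (intro eqv_relation sp(2)) (auto simp: expression_def)
  then show ?thesis
    using rotation_of_switchback(1,2)[OF pre u, unfolded M] sp(4) by (intro that)
qed

section \<open>Cutting expressions into loops at the empty set\<close>

text \<open>
  The descent from \<open>set xs\<close> to \<open>\<emptyset>\<close> that removes the elements in the order of the list, and its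
  reverse.
\<close>
fun dn :: "'a list \<Rightarrow> 'a set list" where
  "dn [] = [{}]"
| "dn (x # xs) = set (x # xs) # dn xs"

definition up :: "'a list \<Rightarrow> 'a set list" where
  "up xs = rev (dn xs)"

lemma dn_nonempty [simp]: "dn xs \<noteq> []" "up xs \<noteq> []"
  by (cases xs; simp add: up_def)+

lemma dn_hd [simp]: "hd (dn xs) = set xs" "last (up xs) = set xs"
  by (cases xs; simp add: up_def last_rev)+

lemma dn_last [simp]: "last (dn xs) = {}" "hd (up xs) = {}"
proof -
  show "last (dn xs) = {}" by (induction xs) auto
  then show "hd (up xs) = {}" by (simp add: up_def hd_rev)
qed

lemma expression_dn: "distinct xs \<Longrightarrow> finitary (set xs) \<Longrightarrow> expression (dn xs)"
proof (induction xs)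
  case (Cons x xs)
  have xs: "finitary (set xs)" "set (x # xs) - {x} = set xs"
    using Cons.prems by (auto intro: finitary_subset[of "insert x (set xs)"])
  then have "adjacent (set (x # xs)) (set xs)"
    using adjacent_remove[of "set (x # xs)" x] Cons.prems by auto
  moreover have "expression (dn xs)" using Cons xs by simp
  ultimately show ?case using Cons.prems by (auto simp: expression_def successively_Cons)
qed (simp add: expression_single)

lemma expression_rev: "expression x \<Longrightarrow> expression (rev x)"
  using adjacent_sym by (auto simp: expression_def successively_rev intro: successively_mono)

lemma expression_up: "distinct xs \<Longrightarrow> finitary (set xs) \<Longrightarrow> expression (up xs)"
  by (simp add: up_def expression_rev expression_dn)

lemma dn_Cons_glue: "dn (x # xs) = [set (x # xs), set xs] \<bullet> dn xs"
  by (cases xs) (auto simp: glue_def)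

lemma up_Cons_glue: "up (x # xs) = up xs \<bullet> [set xs, set (x # xs)]"
  by (simp add: up_def glue_def)

lemma expression_dn_step:
  assumes "distinct (x # xs)" "finitary (set (x # xs))"
  shows "expression [set (x # xs), set xs]" "expression [set xs, set (x # xs)]"
    "finitary (set xs)"
proof -
  have xs: "finitary (set xs)" "set (x # xs) - {x} = set xs"
    using assms by (auto intro: finitary_subset[of "insert x (set xs)"])
  then have "adjacent (set (x # xs)) (set xs)"
    using adjacent_remove[of "set (x # xs)" x] assms by auto
  then show "expression [set (x # xs), set xs]" "expression [set xs, set (x # xs)]"
    "finitary (set xs)"
    using xs assms adjacent_sym by (auto simp: expression_pair)
qed

text \<open>The quadratic relation cancels the lowest descent and ascent, and so on upwards.\<close>
lemma eqv_detour: "distinct xs \<Longrightarrow> finitary (set xs) \<Longrightarrow> dn xs \<bullet> up xs \<simeq> [set xs]"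
proof (induction xs)
  case Nil
  then show ?case by (simp add: up_def eqv_refl expression_single)
next
  case (Cons x xs)
  let ?X = "set (x # xs)"
  note st = expression_dn_step[OF Cons.prems]
  have IH: "dn xs \<bullet> up xs \<simeq> [set xs]" using Cons st by simp
  have "dn (x # xs) \<bullet> up (x # xs) = [?X, set xs] \<bullet> (dn xs \<bullet> up xs) \<bullet> [set xs, ?X]"
    unfolding dn_Cons_glue up_Cons_glue by (simp add: glue_assoc)
  also have "\<dots> \<simeq> [?X, set xs] \<bullet> [set xs] \<bullet> [set xs, ?X]"
    using IH st by (intro eqv_glue eqv_refl) (auto simp: glue_last)
  also have "[?X, set xs] \<bullet> [set xs] \<bullet> [set xs, ?X] = [?X, ?X - {x}, ?X]"
    using Cons.prems by (auto simp: glue_def)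
  also have "\<dots> \<simeq> [?X]" using Cons.prems by (intro eqv_quadratic) auto
  finally show ?case .
qed

lemma distinct_list_exists: "finite A \<Longrightarrow> \<exists>xs. distinct xs \<and> set xs = A"
  using finite_distinct_list by auto

text \<open>
  Two orders of removing elements are compared through an order that removes the other first
  element second; there the down-down (and for ascents the up-up) relation applies.
\<close>
lemma dn_independent:
  "distinct xs \<Longrightarrow> distinct ys \<Longrightarrow> set xs = set ys \<Longrightarrow> finitary (set xs) \<Longrightarrow>
    dn xs \<simeq> dn ys \<and> up xs \<simeq> up ys"
proof (induction "length xs" arbitrary: xs ys rule: less_induct)
  case less
  show ?case
  proof (cases xs)
    case Nil
    then show ?thesis using less.prems by (simp add: up_def eqv_refl expression_single)
  next
    case (Cons x xs')
    then obtain y ys' where ys: "ys = y # ys'" using less.prems by (cases ys) auto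
    define M where "M = set xs"
    have M: "finitary M" "x \<in> M" "y \<in> M" "set (x # xs') = M" "set (y # ys') = M"
      using less.prems Cons ys by (auto simp: M_def)
    have sets: "set xs' = M - {x}" "set ys' = M - {y}"
      using less.prems Cons ys by (auto simp: M_def)
    have dist: "distinct xs'" "distinct ys'" using less.prems Cons ys by auto
    have len: "length ys = length xs" using less.prems by (metis distinct_card)
    note stx = expression_dn_step[of x xs', unfolded M(4) sets, OF _ M(1)]
      and sty = expression_dn_step[of y ys', unfolded M(5) sets, OF _ M(1)]
    have dx: "distinct (x # xs')" "distinct (y # ys')" using less.prems Cons ys by auto
    have xs_glue: "dn xs = [M, M - {x}] \<bullet> dn xs'" "up xs = up xs' \<bullet> [M - {x}, M]"
      unfolding Cons dn_Cons_glue up_Cons_glue M(4) sets by auto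
    have ys_glue: "dn ys = [M, M - {y}] \<bullet> dn ys'" "up ys = up ys' \<bullet> [M - {y}, M]"
      unfolding ys dn_Cons_glue up_Cons_glue M(5) sets by auto
    show ?thesis
    proof (cases "x = y")
      case True
      then have "dn xs' \<simeq> dn ys' \<and> up xs' \<simeq> up ys'"
        using less.hyps[of xs' ys'] Cons dist sets finitary_remove[OF M(1)] by simp
      then show ?thesis
        unfolding xs_glue ys_glue using stx(1,2)[OF dx(1)] sets
        unfolding True by (intro conjI eqv_glue eqv_refl) simp_all
    next
      case False
      obtain zs where zs: "distinct zs" "set zs = M - {x, y}"
        using distinct_list_exists[of "M - {x, y}"] finitary_finite[OF M(1)] by auto
      have dz: "distinct (y # zs)" "set (y # zs) = M - {x}" "distinct (x # zs)" "set (x # zs) = M - {y}"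
        using zs False M by auto
      have fin: "finitary (M - A)" for A using M(1) by (rule finitary_remove)
      have len': "length xs' < length xs" "length (x # zs) < length xs"
        using Cons dz(3,4) dx ys sets len distinct_card[of "x # zs"] distinct_card[of ys'] by auto
      have 1: "dn xs' \<simeq> dn (y # zs) \<and> up xs' \<simeq> up (y # zs)"
        using less.hyps[of xs' "y # zs"] len' dist sets dz fin by simp
      have 2: "dn (x # zs) \<simeq> dn ys' \<and> up (x # zs) \<simeq> up ys'"
        using less.hyps[of "x # zs" ys'] len' dist sets dz fin by simp
      have ez: "expression (dn zs)" "expression (up zs)"
        using expression_dn expression_up zs fin by auto
      have d: "dn (y # zs) = [M - {x}, M - {x, y}] \<bullet> dn zs" "up (y # zs) = up zs \<bullet> [M - {x, y}, M - {x}]"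
          "dn (x # zs) = [M - {y}, M - {x, y}] \<bullet> dn zs" "up (x # zs) = up zs \<bullet> [M - {x, y}, M - {y}]"
        unfolding dn_Cons_glue up_Cons_glue dz zs by auto
      have "dn xs \<simeq> [M, M - {x}] \<bullet> dn (y # zs)"
        unfolding xs_glue using 1 stx(1,2)[OF dx(1)] sets by (intro eqv_glue eqv_refl) simp_all
      also have "\<dots> = [M, M - {x}, M - {x, y}] \<bullet> dn zs"
        unfolding d by (simp add: glue_def)
      also have "\<dots> \<simeq> [M, M - {y}, M - {x, y}] \<bullet> dn zs"
        using eqv_down[OF M(1-3) False] ez zs by (intro eqv_glue eqv_refl) simp_all
      also have "\<dots> = [M, M - {y}] \<bullet> dn (x # zs)"
        unfolding d by (simp add: glue_def)
      also have "\<dots> \<simeq> dn ys"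
        unfolding ys_glue using 2 sty(1,2)[OF dx(2)] dz by (intro eqv_glue eqv_refl) simp_all
      finally have down: "dn xs \<simeq> dn ys" .
      have "up xs \<simeq> up (y # zs) \<bullet> [M - {x}, M]"
        unfolding xs_glue using 1 stx(1,2)[OF dx(1)] sets by (intro eqv_glue eqv_refl) simp_all
      also have "\<dots> = up zs \<bullet> [M - {x, y}, M - {x}, M]"
        unfolding d by (simp add: glue_def)
      also have "\<dots> \<simeq> up zs \<bullet> [M - {x, y}, M - {y}, M]"
        using eqv_up[OF M(1-3) False] ez zs by (intro eqv_glue eqv_refl) simp_all
      also have "\<dots> = up (x # zs) \<bullet> [M - {y}, M]"
        unfolding d by (simp add: glue_def)
      also have "\<dots> \<simeq> up ys"
        unfolding ys_glue using 2 sty(1,2)[OF dx(2)] dz by (intro eqv_glue eqv_refl) simp_all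
      finally show ?thesis using down by simp
    qed
  qed
qed

lemma finitary_singleton: assumes "s \<in> S" shows "finitary {s}"
proof -
  have "generate W {s} \<subseteq> {\<one>, s}"
  proof
    fix x assume "x \<in> generate W {s}"
    then show "x \<in> {\<one>, s}"
      by (induction rule: generate.induct) (use assms in auto)
  qed
  then show ?thesis using assms by (auto simp: finitary_def intro: finite_subset)
qed

fun word_expr :: "'a list \<Rightarrow> 'a set list" where
  "word_expr [] = [{}]"
| "word_expr (s # ws) = {} # {s} # word_expr ws"

lemma word_expr_ends [simp]: "word_expr ws \<noteq> []" "hd (word_expr ws) = {}" "last (word_expr ws) = {}"
proof -
  show "last (word_expr ws) = {}"
    by (induction ws rule: word_expr.induct) (auto split: if_splits, (metis list.distinct(1) word_expr.elims)+)
qed (cases ws; simp)+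

lemma word_expr_append: "word_expr (v @ w) = word_expr v \<bullet> word_expr w"
  by (induction v; cases w) (auto simp: glue_def)

lemma expression_word: "set ws \<subseteq> S \<Longrightarrow> expression (word_expr ws)"
proof (induction ws)
  case (Cons s ws)
  have "adjacent {} {s}" "adjacent {s} {}" using Cons.prems by (auto simp: adjacent_def)
  then show ?case using Cons finitary_singleton
    by (auto simp: expression_def successively_Cons)
qed (simp add: expression_single)

lemma star_prod_word: "set ws \<subseteq> S \<Longrightarrow> star_prod (word_expr ws) = foldr star ws \<one>"
proof (induction ws)
  case (Cons s ws)
  then have "foldr star ws \<one> \<in> carrier W"
    using star_prod_closed[OF expression_finitary[OF expression_word]] by force
  then show ?case using Cons by (simp add: longest_singleton finitary_singleton)
qed simp

definition wordlike :: "'a set list \<Rightarrow> bool" where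
  "wordlike x \<longleftrightarrow> (\<exists>ws. set ws \<subseteq> S \<and> x \<simeq> word_expr ws)"

lemma eqv_last: "x \<simeq> y \<Longrightarrow> last x = last y" "x \<simeq> y \<Longrightarrow> hd x = hd y"
  using eqv_invariants by auto

text \<open>
  Inserting a detour through \<open>\<emptyset>\<close> after each step cuts an expression starting at \<open>\<emptyset>\<close> into loops that go
  up to some \<open>I\<close> and back down.
\<close>
lemma cut_into_loops:
  assumes loops: "\<And>xs ys. distinct xs \<Longrightarrow> distinct ys \<Longrightarrow> set xs = set ys \<Longrightarrow> finitary (set xs) \<Longrightarrow>
      length xs \<le> n \<Longrightarrow> wordlike (up xs \<bullet> dn ys)"
  shows "expression x \<Longrightarrow> hd x = {} \<Longrightarrow> \<forall>I \<in> set x. card I \<le> n \<Longrightarrow> distinct xs \<Longrightarrow> set xs = last x \<Longrightarrow>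
    \<exists>ws. set ws \<subseteq> S \<and> x \<simeq> word_expr ws \<bullet> up xs"
proof (induction x arbitrary: xs rule: rev_induct)
  case Nil
  then show ?case by (simp add: expression_def)
next
  case (snoc I' x)
  show ?case
  proof (cases "x = []")
    case True
    then have "xs = []" "I' = {}" using snoc.prems by auto
    then show ?thesis using True snoc.prems
      by (intro exI[of _ "[]"]) (simp add: up_def eqv_refl)
  next
    case False
    define I where "I = last x"
    have ex: "expression x" "adjacent I I'" "finitary I'" "finitary I" "set xs = I'"
      using snoc.prems False expression_append[of x "[I']"] last_in_set[of x]
      by (auto simp: I_def expression_def[of "x @ [I']"])
    have exs: "expression (dn xs)" "expression (up xs)" "dn xs \<bullet> up xs \<simeq> [I']"
      using expression_dn expression_up eqv_detour snoc.prems ex by auto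
    have eII: "expression [I, I']" using ex by (simp add: expression_pair)
    obtain ys where ys: "distinct ys" "set ys = I"
      using distinct_list_exists[of I] finitary_finite ex by auto
    obtain w where w: "set w \<subseteq> S" "x \<simeq> word_expr w \<bullet> up ys"
      using snoc.IH[of ys] ex False snoc.prems ys by (auto simp: I_def)
    have eys: "expression (up ys)" using expression_up ys ex by auto
    \<comment> \<open>The step from \<open>I\<close> to \<open>I'\<close> belongs to the ascent or to the descent of the loop.\<close>
    have "wordlike (up ys \<bullet> [I, I'] \<bullet> dn xs)"
    proof -
      from ex(2) obtain s where s: "s \<in> S" "s \<notin> I \<and> I' = insert s I \<or> s \<in> I \<and> I' = I - {s}"
        unfolding adjacent_def by blast
      from s(2) show ?thesis
      proof
        assume s: "s \<notin> I \<and> I' = insert s I"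
        have "up (s # ys) = up ys \<bullet> [I, I']" unfolding up_Cons_glue using s ys by simp
        moreover have "wordlike (up (s # ys) \<bullet> dn xs)"
        proof (rule loops)
          have "length (s # ys) = card I'" using s ys distinct_card[of "s # ys"] by simp
          then show "length (s # ys) \<le> n" using snoc.prems by simp
        qed (use s ys ex snoc.prems in auto)
        ultimately show ?thesis by (simp add: glue_assoc)
      next
        assume s: "s \<in> I \<and> I' = I - {s}"
        have sx: "set (s # xs) = I" using s ex by auto
        have "dn (s # xs) = [I, I'] \<bullet> dn xs" unfolding dn_Cons_glue sx using ex by simp
        moreover have "wordlike (up ys \<bullet> dn (s # xs))"
        proof (rule loops)
          have "length ys = card I" using ys distinct_card by metis
          then show "length ys \<le> n" using snoc.prems False by (simp add: I_def)
        qed (use s ys ex snoc.prems sx in auto)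
        ultimately show ?thesis by simp
      qed
    qed
    then obtain v where v: "set v \<subseteq> S" "up ys \<bullet> [I, I'] \<bullet> dn xs \<simeq> word_expr v"
      unfolding wordlike_def by blast
    have ew: "expression (word_expr w)" using expression_word w by simp
    have "x @ [I'] = x \<bullet> [I, I'] \<bullet> [I']" by (simp add: glue_def)
    also have "\<dots> \<simeq> (word_expr w \<bullet> up ys) \<bullet> [I, I'] \<bullet> (dn xs \<bullet> up xs)"
      using w(2) eII eqv_sym[OF exs(3)]
      by (intro eqv_glue[OF _ eqv_glue] eqv_refl) (simp_all add: I_def)
    also have "\<dots> = word_expr w \<bullet> (up ys \<bullet> [I, I'] \<bullet> dn xs) \<bullet> up xs"
      by (simp add: glue_assoc)
    also have "\<dots> \<simeq> word_expr w \<bullet> word_expr v \<bullet> up xs"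
      using v(2) ew exs by (intro eqv_glue[OF _ eqv_glue] eqv_refl)
        (simp_all add: glue_last ys ex)
    also have "\<dots> = word_expr (w @ v) \<bullet> up xs" by (simp add: word_expr_append glue_assoc)
    finally show ?thesis using w v by (intro exI[of _ "w @ v"]) simp
  qed
qed

lemma dn_set: "I \<in> set (dn xs) \<Longrightarrow> I \<subseteq> set xs" "I \<in> set (up xs) \<Longrightarrow> I \<subseteq> set xs"
proof -
  show *: "I \<in> set (dn xs) \<Longrightarrow> I \<subseteq> set xs" by (induction xs) auto
  then show "I \<in> set (up xs) \<Longrightarrow> I \<subseteq> set xs" by (simp add: up_def)
qed

lemma rotation_expression_psubset:
  assumes "rotation W S M u" "I \<in> set (rotation_expression M u k)" shows "I \<subset> M"
proof -
  interpret rotation W S M u by fact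
  show ?thesis using assms(2)
  proof (induction k)
    case (Suc k)
    then show ?case using u_mem[of "Suc k"] by (auto simp: rotation_expression_Suc)
  qed (use u_mem[of 0] in \<open>auto simp: rotation_expression_0\<close>)
qed

text \<open>
  At the top \<open>[M - s, M, M - t]\<close> of the loop a switchback is applied, after \<open>t\<close> has been brought into
  the right position in the descent. All sets in the resulting expression are proper subsets of \<open>M\<close>.
\<close>
lemma loop_wordlike:
  "distinct xs \<Longrightarrow> distinct ys \<Longrightarrow> set xs = set ys \<Longrightarrow> finitary (set xs) \<Longrightarrow> wordlike (up xs \<bullet> dn ys)"
proof (induction "length xs" arbitrary: xs ys rule: less_induct)
  case less
  define M where "M = set xs"
  have M: "finitary M" "M \<subseteq> S" "finite M" "card M = length xs"
    using less.prems finitary_S finitary_finite distinct_card[of xs] by (auto simp: M_def)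
  consider "xs = []" | s where "xs = [s]" | s xs' where "xs = s # xs'" "xs' \<noteq> []"
    by (cases xs; cases "tl xs") auto
  then show ?case
  proof cases
    case 1
    then show ?thesis using less.prems
      by (auto simp: wordlike_def up_def eqv_refl expression_single intro!: exI[of _ "[]"])
  next
    case 2
    then have "ys = [s]" using less.prems distinct_card[of ys]
      by (cases ys; cases "tl ys") auto
    then have "up xs \<bullet> dn ys = word_expr [s]" using 2 by (simp add: up_def glue_def)
    then show ?thesis using 2 M expression_word[of "[s]"]
      by (auto simp: wordlike_def M_def intro!: exI[of _ "[s]"] eqv_refl)
  next
    case (3 s xs')
    let ?\<sigma> = "\<lambda>t. longest M \<otimes> t \<otimes> longest M"
    have s: "s \<in> M" "set xs' = M - {s}" using 3 less.prems by (auto simp: M_def)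
    obtain s' where s': "s' \<in> M" "s' \<noteq> s" using s(2) 3(2) by (cases xs') auto
    \<comment> \<open>The side condition of the switchback excludes only one \<open>t\<close>, and \<open>M\<close> has two elements.\<close>
    have "\<exists>t \<in> M. s \<noteq> ?\<sigma> t"
    proof (rule ccontr)
      assume "\<not> ?thesis"
      then have "?\<sigma> s = ?\<sigma> s'" using s(1) s'(1) by metis
      then have "?\<sigma> (?\<sigma> s) = ?\<sigma> (?\<sigma> s')" by simp
      then show False using s s' longest_conj_inj[OF M(1)] M(2) by (simp add: subset_iff)
    qed
    then obtain t where t: "t \<in> M" "s \<noteq> ?\<sigma> t" by blast
    obtain u where u: "rotation W S M u"
      and sw: "[M - {s}, M, M - {t}] \<simeq> rotation_expression M u (rotation_length M u)"
      using eqv_switchback[OF M(1) s(1) t] by blast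
    let ?R = "rotation_expression M u (rotation_length M u)"
    obtain zs where zs: "distinct zs" "set zs = M - {t}"
      using distinct_list_exists[of "M - {t}"] M by auto
    have fin: "finitary (M - A)" for A using M(1) by (rule finitary_remove)
    have tz: "distinct (t # zs)" "set (t # zs) = M" "set (s # xs') = M" using zs t s by auto
    have d: "distinct xs'" using 3 less.prems by simp
    have e: "expression (up xs')" "expression (dn zs)" "expression (up xs)"
      using expression_up expression_dn d s zs fin less.prems by auto
    have "up xs \<bullet> dn ys \<simeq> up xs \<bullet> dn (t # zs)"
      using dn_independent[of ys "t # zs"] less.prems tz e M
      by (intro eqv_glue eqv_refl) (simp_all add: M_def)
    also have "up xs \<bullet> dn (t # zs) = up xs' \<bullet> [M - {s}, M, M - {t}] \<bullet> dn zs"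
      unfolding 3(1) up_Cons_glue dn_Cons_glue tz s zs by (simp add: glue_def)
    also have "\<dots> \<simeq> up xs' \<bullet> ?R \<bullet> dn zs"
      using sw e s zs by (intro eqv_glue[OF _ eqv_glue] eqv_refl) simp_all
    finally have *: "up xs \<bullet> dn ys \<simeq> up xs' \<bullet> ?R \<bullet> dn zs" .
    have hl: "hd ?R = M - {s}" "last ?R = M - {t}" "?R \<noteq> []"
      using eqv_last[OF sw] eqv_expression[OF sw] expression_nonempty by auto
    have "\<exists>ws. set ws \<subseteq> S \<and> up xs' \<bullet> ?R \<bullet> dn zs \<simeq> word_expr ws \<bullet> up []"
    proof (rule cut_into_loops[where n = "length xs - 1"])
      fix xs'' ys'' :: "'a list"
      assume "distinct xs''" "distinct ys''" "set xs'' = set ys''" "finitary (set xs'')"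
        "length xs'' \<le> length xs - 1"
      then show "wordlike (up xs'' \<bullet> dn ys'')" using less.hyps[of xs'' ys''] 3 by simp
    next
      show "\<forall>I \<in> set (up xs' \<bullet> ?R \<bullet> dn zs). card I \<le> length xs - 1"
      proof
        fix I assume "I \<in> set (up xs' \<bullet> ?R \<bullet> dn zs)"
        then have "I \<in> set (up xs') \<or> I \<in> set ?R \<or> I \<in> set (dn zs)"
          using set_glue by blast
        then have "I \<subset> M"
          using dn_set[of I xs'] dn_set[of I zs] rotation_expression_psubset[OF u] s zs t by blast
        then have "card I < card M" by (rule psubset_card_mono[OF M(3)])
        then show "card I \<le> length xs - 1" using M(4) by simp
      qed
    qed (use eqv_expression[OF *] hl zs s(2) in \<open>simp_all add: glue_last\<close>)
    then show ?thesis using eqv_trans[OF *] by (auto simp: wordlike_def up_def)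
  qed
qed

lemma expression_wordlike:
  assumes "expression x" "hd x = {}" "last x = {}" shows "wordlike x"
proof -
  have "\<forall>I \<in> set x. card I \<le> Max (card ` set x)" by (auto intro: Max_ge)
  then have "\<exists>ws. set ws \<subseteq> S \<and> x \<simeq> word_expr ws \<bullet> up []"
    using assms loop_wordlike by (intro cut_into_loops[where n = "Max (card ` set x)"]) auto
  then show ?thesis by (simp add: wordlike_def up_def)
qed

section \<open>Words with the same star product\<close>

definition reduced_word :: "'a list \<Rightarrow> bool" where
  "reduced_word ws \<longleftrightarrow> set ws \<subseteq> S \<and> length ws = len (word_prod ws)"

lemma star_word_closed [simp]: "set ws \<subseteq> S \<Longrightarrow> foldr star ws \<one> \<in> carrier W"
  by (induction ws) auto

lemma star_word_reduced:
  "set ws \<subseteq> S \<Longrightarrow> len (foldr star ws \<one>) \<le> length ws \<and>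
    (len (foldr star ws \<one>) = length ws \<longrightarrow> word_prod ws = foldr star ws \<one>)"
proof (induction ws)
  case (Cons s ws)
  then have s: "s \<in> S" "foldr star ws \<one> \<in> carrier W" by auto
  then show ?case
    using Cons len_S_mult_cases[OF s] by (auto simp: star_left_S)
qed simp

lemma reduced_word_Cons:
  assumes "s \<in> S" "set ws \<subseteq> S"
  shows "reduced_word (s # ws) \<longleftrightarrow>
    reduced_word ws \<and> len (word_prod ws) < len (s \<otimes> word_prod ws)"
  using assms len_le[of ws] len_S_mult_cases[of s "word_prod ws"]
  by (auto simp: reduced_word_def)

text \<open>
  In rank two all \<open>I(k)\<close> are singletons and all \<open>L(k)\<close> with \<open>k > 0\<close> are empty.
\<close>
lemma rotation_word:
  assumes "rotation W S {x, y} u"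
  shows "\<exists>v. set v \<subseteq> {x, y} \<and> length v = Suc k \<and> {hd v} = {x, y} - {u 0} \<and>
    [{}] @ rotation_expression {x, y} u k @ [{}] = word_expr v"
proof -
  interpret rotation W S "{x, y}" u by fact
  have single: "\<exists>z \<in> {x, y}. I k = {z}" and empty: "L (Suc k) = {}" for k
    using u_mem[of k] u_mem[of "Suc k"] by auto
  show ?thesis
  proof (induction k)
    case 0
    obtain z where "z \<in> {x, y}" "I 0 = {z}" using single by blast
    then show ?case by (intro exI[of _ "[z]"]) (auto simp: rotation_expression_0)
  next
    case (Suc k)
    then obtain v where v: "set v \<subseteq> {x, y}" "length v = Suc k" "{hd v} = {x, y} - {u 0}"
      "[{}] @ rotation_expression {x, y} u k @ [{}] = word_expr v" by blast
    obtain z where z: "z \<in> {x, y}" "I (Suc k) = {z}" using single by blast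
    have "[{}] @ rotation_expression {x, y} u (Suc k) @ [{}] = word_expr v @ [{z}, {}]"
      unfolding rotation_expression_Suc empty z v(4)[symmetric] by simp
    also have "\<dots> = word_expr (v @ [z])" by (simp add: word_expr_append glue_def)
    finally show ?case using v z
      by (intro exI[of _ "v @ [z]"]) (auto simp: hd_append)
  qed
qed

text \<open>
  This is the source of the braid relations. The word has star product \<open>w\<^sub>M\<close> and at most \<open>len(w\<^sub>M)\<close>
  letters, so it is reduced. Up to the equivalence of \<open>[\<emptyset>, {s}, M]\<close> and \<open>[\<emptyset>, {t}, M]\<close>, the left-hand
  side is symmetric in \<open>s\<close> and \<open>t\<close>.
\<close>
lemma dihedral_word:
  assumes st: "s \<noteq> t" "finitary {s, t}" and zs: "distinct zs" "set zs = {s, t}"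
  shows "\<exists>v. reduced_word (s # v) \<and> word_prod (s # v) = longest {s, t} \<and>
    [{}, {s}, {s, t}] \<bullet> dn zs \<simeq> word_expr (s # v)"
proof -
  define M where "M = {s, t}"
  let ?\<sigma> = "\<lambda>x. longest M \<otimes> x \<otimes> longest M"
  have M: "finitary M" "s \<in> S" "t \<in> S" using st finitary_S by (auto simp: M_def)
  have "\<exists>q \<in> M. t \<noteq> ?\<sigma> q"
  proof (rule ccontr)
    assume "\<not> ?thesis"
    then have "?\<sigma> s = ?\<sigma> t" by (auto simp: M_def)
    then have "?\<sigma> (?\<sigma> s) = ?\<sigma> (?\<sigma> t)" by simp
    then show False using st longest_conj_inj[OF M(1)] M by simp
  qed
  then obtain q where q: "q \<in> M" "t \<noteq> ?\<sigma> q" by blast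
  obtain u where u: "rotation W S M u" "u 0 = t"
    and sw: "[M - {t}, M, M - {q}] \<simeq> rotation_expression M u (rotation_length M u)"
    using eqv_switchback[OF M(1) _ q] by (metis M_def insertCI)
  interpret r: rotation W S M u by fact
  let ?R = "rotation_expression M u r.N"
  have len_N: "rotation_length M u = r.N" by (rule r.rotation_length_N)
  have Mt: "M - {t} = {s}" using st by (auto simp: M_def)
  obtain v where v: "set v \<subseteq> {s, t}" "length v = Suc r.N" "{hd v} = M - {u 0}"
    "[{}] @ ?R @ [{}] = word_expr v"
    using rotation_word[of s t u r.N] u by (auto simp: M_def)
  then obtain v' where v': "v = s # v'" using u Mt by (cases v) auto
  have vS: "set v \<subseteq> S" using v M by auto
  have "foldr star v \<one> = star_prod ([{}] @ ?R @ [{}])"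
    using star_prod_word[OF vS] v(4) by simp
  also have "\<dots> = longest M"
    using r.a_N r.rotation_expression_finitary[of r.N] M(1) by (simp add: r.a_def star_prod_append)
  finally have sv: "foldr star v \<one> = longest M" .
  have "Suc r.N \<le> len (longest M)"
    using r.N_len M(2) by (simp add: u Mt longest_singleton finitary_singleton)
  then have red: "word_prod v = longest M" "length v = len (longest M)"
    using star_word_reduced[OF vS] sv v by auto
  obtain r where r: "{q, r} = M" "q \<noteq> r" "M - {q} = {r}"
    using q st by (auto simp: M_def)
  have r_S: "r \<in> S" using r(1) finitary_S[OF M(1)] by blast
  have sets: "set zs = M" "set [q, r] = M" using zs(2) r(1) by (simp_all add: M_def)
  have e: "expression [{}, {s}]" "expression [{r}, {}]"
    using M r_S finitary_singleton by (auto simp: expression_pair adjacent_def)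
  have "[{}, {s}, M] \<bullet> dn zs \<simeq> [{}, {s}, M] \<bullet> dn [q, r]"
  proof (intro eqv_glue eqv_refl)
    show "dn zs \<simeq> dn [q, r]"
      using dn_independent[of zs "[q, r]"] zs(1) r(2) M(1) unfolding sets by simp
    have "adjacent {s} M" "adjacent {} {s}" using st M by (auto simp: adjacent_def M_def)
    then show "expression [{}, {s}, M]" using M finitary_singleton by (simp add: expression_def)
  qed (simp add: sets)
  also have "[{}, {s}, M] \<bullet> dn [q, r] = [{}, {s}] \<bullet> [M - {t}, M, M - {q}] \<bullet> [{r}, {}]"
    using r Mt by (simp add: glue_def)
  also have "\<dots> \<simeq> [{}, {s}] \<bullet> ?R \<bullet> [{r}, {}]"
    using sw e r Mt len_N by (intro eqv_glue[OF _ eqv_glue] eqv_refl) simp_all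
  also have "\<dots> = [{}] @ ?R @ [{}]"
    using eqv_last[OF sw] Mt len_N by (cases ?R) (auto simp: glue_def)
  finally have "[{}, {s}, M] \<bullet> dn zs \<simeq> word_expr v" using v(4) by simp
  then show ?thesis using red vS v' by (auto simp: reduced_word_def M_def)
qed

text \<open>
  All elements of \<open>W\<^sub>J\<close> are absorbed by \<open>x\<close>, so their lengths are bounded by that of \<open>x\<close>.
\<close>
lemma lfull_finitary:
  assumes "J \<subseteq> S" "finite J" "x \<in> carrier W" "lfull J x" shows "finitary J"
proof -
  have "len g \<le> len x" if g: "g \<in> generate W J" for g
    using star_len_right[of g x] lfull_absorb[OF assms(1) g assms(3,4)] g assms by fastforce
  then have "generate W J \<subseteq> word_prod ` {ws. set ws \<subseteq> J \<and> length ws \<le> len x}"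
    using parabolic_reduced_word[OF assms(1)] by fastforce
  moreover have "finite {ws. set ws \<subseteq> J \<and> length ws \<le> len x}"
    using assms(2) by (rule finite_lists_length_le)
  ultimately show ?thesis using assms by (auto simp: finitary_def intro: finite_subset)
qed

lemma eqv_word_append:
  assumes "word_expr v \<simeq> word_expr v'" "word_expr w \<simeq> word_expr w'"
  shows "word_expr (v @ w) \<simeq> word_expr (v' @ w')"
  unfolding word_expr_append using assms by (intro eqv_glue) auto

lemma eqv_word_Cons:
  assumes "s \<in> S" "word_expr w \<simeq> word_expr w'"
  shows "word_expr (s # w) \<simeq> word_expr (s # w')"
  using eqv_word_append[of "[s]" "[s]" w w'] assms expression_word[of "[s]"] eqv_refl by auto

text \<open>
  Matsumoto's argument. If two reduced words of \<open>x\<close> begin with different letters \<open>s\<close> and \<open>t\<close>, then \<open>x\<close> is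
  full for \<open>{s, t}\<close>, so \<open>M = {s, t}\<close> is finitary and \<open>x = w\<^sub>M z\<close> with lengths adding up. The two words
  are compared with the two dihedral words followed by a reduced word of \<open>z\<close>.
\<close>
lemma eqv_reduced_words:
  "reduced_word v \<Longrightarrow> reduced_word w \<Longrightarrow> word_prod v = word_prod w \<Longrightarrow> word_expr v \<simeq> word_expr w"
proof (induction "length v" arbitrary: v w rule: less_induct)
  case less
  show ?case
  proof (cases v)
    case Nil
    then have "len (word_prod w) = 0" using less.prems(3) by (metis len_one word_prod_simps(1))
    then have "w = []" using less.prems by (auto simp: reduced_word_def)
    then show ?thesis using Nil expression_word[of "[]"] eqv_refl by auto
  next
    case (Cons s v')
    then obtain t w' where w: "w = t # w'" using less.prems by (cases w) (auto simp: reduced_word_def)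
    have st: "s \<in> S" "t \<in> S" "set v' \<subseteq> S" "set w' \<subseteq> S"
      using less.prems Cons w by (auto simp: reduced_word_def)
    define x where "x = word_prod v"
    have x: "x \<in> carrier W" "x = s \<otimes> word_prod v'" "x = t \<otimes> word_prod w'"
      using less.prems Cons w st by (auto simp: x_def)
    have "s \<otimes> x = word_prod v'" "t \<otimes> x = word_prod w'"
      using st x(2,3) S_cancel word_prod_S by metis+
    then have red: "len (s \<otimes> x) < len x" "len (t \<otimes> x) < len x"
      using less.prems(1,2) st x(2,3) reduced_word_Cons[of s v'] reduced_word_Cons[of t w'] Cons w by metis+
    have same: "word_expr (r # p) \<simeq> word_expr (r # p')"
      if "r \<in> S" "reduced_word (r # p)" "reduced_word (r # p')"
        "word_prod (r # p) = x" "word_prod (r # p') = x" for r p p'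
    proof -
      have pS: "set p \<subseteq> S" "set p' \<subseteq> S" using that by (auto simp: reduced_word_def)
      then have "reduced_word p" "reduced_word p'" using that reduced_word_Cons by auto
      moreover have "word_prod p = word_prod p'"
        using that pS by (metis S_cancel word_prod_S word_prod_simps(2))
      moreover have "length p < length v"
        using that less.prems by (auto simp: reduced_word_def x_def)
      ultimately show ?thesis using less.hyps eqv_word_Cons that(1) by blast
    qed
    show ?thesis
    proof (cases "s = t")
      case True
      then show ?thesis using same[of s v' w'] less.prems Cons w st by (auto simp: x_def)
    next
      case False
      define M where "M = {s, t}"
      have full: "lfull M x" using red by (auto simp: lfull_def M_def)
      have fin: "finitary M" using lfull_finitary[OF _ _ x(1) full] st by (auto simp: M_def)
      obtain z where z: "set z \<subseteq> S" "word_prod z = longest M \<otimes> x" "length z = len (longest M \<otimes> x)"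
        using reduced_word_exists[of "longest M \<otimes> x"] fin x by auto
      have lx: "len x = len (longest M) + length z" "longest M \<otimes> word_prod z = x"
        using lfull_split[OF fin x(1) full] z x fin by auto
      have ext: "reduced_word (p @ z) \<and> word_prod (p @ z) = x"
        if "reduced_word p" "word_prod p = longest M" for p
        using that z lx by (auto simp: reduced_word_def word_prod_append_S)
      obtain p where p: "reduced_word (s # p)" "word_prod (s # p) = longest M"
          "[{}, {s}, M] \<bullet> dn [s, t] \<simeq> word_expr (s # p)"
        using dihedral_word[of s t "[s, t]"] False fin by (auto simp: M_def)
      obtain q where q: "reduced_word (t # q)" "word_prod (t # q) = longest M"
          "[{}, {t}, M] \<bullet> dn [s, t] \<simeq> word_expr (t # q)"
        using dihedral_word[of t s "[s, t]"] False fin by (auto simp: M_def insert_commute)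
      \<comment> \<open>An up-up relation, so that the two dihedral words come from equivalent loops around \<open>M\<close>.\<close>
      have "[{}, {s}, M] \<simeq> [{}, {t}, M]"
        using eqv_up[OF fin, of t s] False by (auto simp: M_def insert_Diff_if)
      moreover have "expression (dn [s, t])"
        using expression_dn[of "[s, t]"] False fin by (simp add: M_def)
      ultimately have up_eq: "[{}, {s}, M] \<bullet> dn [s, t] \<simeq> [{}, {t}, M] \<bullet> dn [s, t]"
        by (intro eqv_glue eqv_refl) (auto simp: M_def)
      have pq: "word_expr (s # p) \<simeq> word_expr (t # q)"
        using eqv_sym[OF p(3)] up_eq q(3) eqv_trans by blast
      have "word_expr v \<simeq> word_expr ((s # p) @ z)"
        using same[of s v' "p @ z"] ext[OF p(1,2)] less.prems(1) Cons st by (auto simp: x_def)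
      also have "\<dots> \<simeq> word_expr ((t # q) @ z)"
        using pq z expression_word eqv_refl by (intro eqv_word_append) auto
      also have "\<dots> \<simeq> word_expr w"
        using same[of t "q @ z" w'] ext[OF q(1,2)] less.prems w st by (auto simp: x_def)
      finally show ?thesis .
    qed
  qed
qed

lemma eqv_square:
  assumes "s \<in> S" shows "word_expr [s, s] \<simeq> word_expr [s]"
proof -
  have "[{s}, {}, {s}] \<simeq> [{s}]"
    using eqv_quadratic[of "{s}" s] finitary_singleton assms by auto
  moreover have "word_expr [s, s] = [{}] @ [{s}, {}, {s}] @ [{}]" by simp
  ultimately show ?thesis
    using eqv_context[of "[{s}, {}, {s}]" "[{s}]" "[{}]" "[{}]"] expression_word[of "[s, s]"] assms
    by simp
qed

text \<open>
  When the next letter \<open>s\<close> does not raise the length, the reduced word found so far can be changed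
  into one that begins with \<open>s\<close>, and the repeated letter is removed by the quadratic relation.
\<close>
lemma eqv_reduce_word:
  "set v \<subseteq> S \<Longrightarrow> \<exists>r. reduced_word r \<and> word_prod r = foldr star v \<one> \<and> word_expr v \<simeq> word_expr r"
proof (induction v)
  case Nil
  then show ?case using expression_word[of "[]"] eqv_refl
    by (intro exI[of _ "[]"]) (auto simp: reduced_word_def)
next
  case (Cons s v)
  then obtain r where r: "reduced_word r" "word_prod r = foldr star v \<one>" "word_expr v \<simeq> word_expr r"
    by auto
  have s: "s \<in> S" "set v \<subseteq> S" "set r \<subseteq> S" using Cons r by (auto simp: reduced_word_def)
  define x where "x = word_prod r"
  have x: "x \<in> carrier W" "foldr star v \<one> = x" using s r by (auto simp: x_def)
  have sr: "word_expr (s # v) \<simeq> word_expr (s # r)" using eqv_word_Cons s r by simp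
  show ?case
  proof (cases "len x < len (s \<otimes> x)")
    case True
    then have "reduced_word (s # r)" using reduced_word_Cons s r x_def by auto
    then show ?thesis using sr True s x
      by (intro exI[of _ "s # r"]) (auto simp: star_left_S x_def)
  next
    case False
    then have fix': "star s x = x" using star_left_S s x by simp
    obtain q where q: "set q \<subseteq> S" "word_prod q = s \<otimes> x" "length q = len (s \<otimes> x)"
      using reduced_word_exists[of "s \<otimes> x"] s x by auto
    have sq: "reduced_word (s # q)" "word_prod (s # q) = x"
      using q s x False len_S_mult_cases[of s x] by (auto simp: reduced_word_def)
    have "word_expr (s # r) \<simeq> word_expr (s # s # q)"
      using eqv_reduced_words[OF r(1) sq(1)] sq(2) by (intro eqv_word_Cons s) (simp only: x_def)
    also have "\<dots> \<simeq> word_expr (s # q)"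
      using eqv_word_append[OF eqv_square[OF s(1)], of q q] expression_word[OF q(1)] eqv_refl by simp
    finally show ?thesis using sr sq fix' x eqv_trans by (intro exI[of _ "s # q"]) auto
  qed
qed

lemma eqv_words:
  assumes "set v \<subseteq> S" "set w \<subseteq> S" "foldr star v \<one> = foldr star w \<one>"
  shows "word_expr v \<simeq> word_expr w"
  using eqv_reduce_word[OF assms(1)] eqv_reduce_word[OF assms(2)] eqv_reduced_words assms(3)
  by (metis eqv_sym eqv_trans)

section \<open>The presentation\<close>

text \<open>
  Composing with paths to \<open>\<emptyset>\<close> at both ends is injective up to equivalence, since by \<open>eqv_detour\<close> the
  expression \<open>z\<close> can be recovered from \<open>A z\<close>; and the star product of \<open>A z\<close> depends only on that of \<open>z\<close>.
\<close>
lemma eqv_complete: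
  assumes x: "expression x" and y: "expression y"
    and ends: "hd x = hd y" "last x = last y" and prod: "star_prod x = star_prod y"
  shows "x \<simeq> y"
proof -
  have fin: "finitary (hd x)" "finitary (last x)"
    using x expression_nonempty expression_finitary by auto
  obtain xs ys where xs: "distinct xs" "set xs = hd x" and ys: "distinct ys" "set ys = last x"
    using distinct_list_exists fin finitary_finite by meson
  define A where "A z = up xs \<bullet> z \<bullet> dn ys" for z
  have e: "expression (dn xs)" "expression (up xs)" "expression (dn ys)" "expression (up ys)"
    using expression_dn expression_up xs ys fin by auto
  have A: "expression (A z)" "hd (A z) = {}" "last (A z) = {}"
    "star_prod (A z) = star (star_prod (up xs)) (star (star_prod z) (star_prod (dn ys)))"
    if "expression z" "hd z = hd x" "last z = last x" for z
    using that e xs ys expression_nonempty[OF that(1)]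
    by (simp_all add: A_def expression_glue glue_last star_prod_glue)
  have recover: "z \<simeq> dn xs \<bullet> A z \<bullet> up ys" if z: "expression z" "hd z = hd x" "last z = last x" for z
  proof -
    have "z = [hd x] \<bullet> z \<bullet> [last x]" using single_glue[OF expression_nonempty[OF z(1)]] z(2) by simp
    also have "\<dots> \<simeq> (dn xs \<bullet> up xs) \<bullet> z \<bullet> (dn ys \<bullet> up ys)"
      using eqv_detour[of xs] eqv_detour[of ys] xs ys fin z expression_nonempty[OF z(1)]
      by (intro eqv_glue[OF _ eqv_glue] eqv_refl) (auto intro: eqv_sym)
    also have "\<dots> = dn xs \<bullet> A z \<bullet> up ys"
      using expression_nonempty[OF z(1)] by (simp add: A_def glue_assoc)
    finally show ?thesis .
  qed
  have "A x \<simeq> A y"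
  proof -
    obtain v w where v: "set v \<subseteq> S" "A x \<simeq> word_expr v" and w: "set w \<subseteq> S" "A y \<simeq> word_expr w"
      using expression_wordlike[OF A(1-3)] x y ends unfolding wordlike_def by metis
    have "foldr star v \<one> = foldr star w \<one>"
      using eqv_invariants[OF v(2)] eqv_invariants[OF w(2)] A(4) x y ends prod
        star_prod_word[OF v(1)] star_prod_word[OF w(1)] by simp
    then show ?thesis using eqv_words v w eqv_sym eqv_trans by meson
  qed
  then have "dn xs \<bullet> A x \<bullet> up ys \<simeq> dn xs \<bullet> A y \<bullet> up ys"
    using e A(2,3) x y ends A(1)[THEN expression_nonempty] by (intro eqv_glue[OF _ eqv_glue] eqv_refl) simp_all
  then show ?thesis using recover x y ends eqv_sym eqv_trans by metis
qed

lemma star_prod_parabolic: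
  "J \<subseteq> S \<Longrightarrow> \<forall>I \<in> set x. finitary I \<and> I \<subseteq> J \<Longrightarrow> star_prod x \<in> generate W J"
proof (induction x)
  case (Cons I x)
  then have "longest I \<in> generate W J" using longest_mem[of I] mono_generate[of I J] by auto
  then show ?case using Cons by (auto intro: star_in_parabolic)
qed simp

text \<open>
  The expression goes down from \<open>J\<close> to \<open>\<emptyset>\<close>, follows a reduced word of a representative \<open>w\<close>, and goes up
  to \<open>I\<close>. The descent and the ascent change the star product only by elements of \<open>W\<^sub>J\<close> and \<open>W\<^sub>I\<close>.
\<close>
lemma sc_eval_surj:
  assumes fin: "finitary I" "finitary J" and f: "f \<in> sc_hom I J"
  shows "\<exists>x. expression x \<and> sc_eval x = f"
proof -
  obtain w where w: "w \<in> carrier W" "f = (J, double_coset J {w} I, I)"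
    using f by (auto simp: sc_hom_def double_cosets_def)
  obtain xs ys where xs: "distinct xs" "set xs = J" and ys: "distinct ys" "set ys = I"
    using distinct_list_exists fin finitary_finite by meson
  obtain v where v: "set v \<subseteq> S" "word_prod v = w" "length v = len w"
    using reduced_word_exists[OF w(1)] by blast
  define x where "x = dn xs \<bullet> word_expr v \<bullet> up ys"
  have e: "expression (dn xs)" "expression (word_expr v)" "expression (up ys)"
    using expression_dn expression_up expression_word xs ys fin v by auto
  then have x: "expression x" "hd x = J" "last x = I"
    using xs ys by (auto simp: x_def expression_glue glue_last)
  have "foldr star ws \<one> = word_prod ws" if "reduced_word ws" for ws
    using that
  proof (induction ws)
    case (Cons s ws)
    then have "s \<in> S" "set ws \<subseteq> S" by (auto simp: reduced_word_def)
    then show ?case using Cons reduced_word_Cons by (simp add: star_left_S)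
  qed simp
  then have "star_prod (word_expr v) = w"
    using star_prod_word[OF v(1)] v by (simp add: reduced_word_def)
  then have "star_prod x = star (star_prod (dn xs)) (star w (star_prod (up ys)))"
    using e by (simp add: x_def star_prod_glue expression_glue)
  also have "\<dots> \<in> double_coset J {w} I"
    using e[THEN expression_finitary] dn_set xs ys fin w
    by (intro double_coset_star star_prod_parabolic) (simp_all add: finitary_S, blast+)
  finally have "double_coset J {star_prod x} I = double_coset J {w} I"
    using fin w by (intro double_coset_eq) (auto simp: finitary_S)
  then have "sc_eval x = f"
    using sc_eval_star_prod[OF expression_finitary[OF x(1)] expression_nonempty[OF x(1)]] x w by simp
  then show ?thesis using x by blast
qed

end

theorem theorem5p32:
  fixes W :: "('a, 'b) monoid_scheme" and S :: "'a set"
  assumes "coxeter_system W S"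
  shows "(\<forall>I J. coxeter_system.finitary W S I \<and> coxeter_system.finitary W S J \<longrightarrow>
            (\<forall>f \<in> coxeter_system.sc_hom W I J.
               \<exists>Is. coxeter_system.expression W S Is \<and> coxeter_system.sc_eval W S Is = f))
       \<and> (\<forall>Is Js. coxeter_system.expression W S Is \<and> coxeter_system.expression W S Js \<longrightarrow>
            (coxeter_system.sc_eval W S Is = coxeter_system.sc_eval W S Js \<longleftrightarrow>
             coxeter_system.sc_equiv W S Is Js))"
proof -
  interpret coxeter_system W S by fact
  have "sc_eval x = sc_eval y \<longleftrightarrow> sc_equiv x y" if "expression x" "expression y" for x y
  proof -
    have "sc_equiv x y \<longleftrightarrow> x \<simeq> y" using that by (simp add: eqv_def)
    also have "\<dots> \<longleftrightarrow> sc_eval x = sc_eval y"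
      using sc_eval_eq_iff[OF that] eqv_invariants[of x y] eqv_complete[OF that] by blast
    finally show ?thesis by simp
  qed
  then show ?thesis using sc_eval_surj by blast
qed

end
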